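(* Let $G$ be a simply connected Lie group with Lie algebra $\mathfrak g$, let $U$ be a neighbourhood of $1$ in $G$ such that $\log$ is defined on $U$, and let $\mathfrak a$ be a representation of $G$. If $\omega\in ZL^2(\mathfrak g,\mathfrak a^a)$, then $I^2(\omega)$ satisfies the identity $$g.I^2(\omega)(h,k)-I^2(\omega)(gh,k)+I^2(\omega)(g,h\rhd k)=0\qquad\forall (g,h,k)\in U_{3\text{-}loc}.$$ Moreover, this identity induces the local rack cocycle identity $$g.I^2(\omega)(h,k)-I^2(\omega)(g\rhd h,g\rhd k)-(g\rhd h).I^2(\omega)(g,k)+I^2(\omega)(g,h\rhd k)=0.$$
   Context: $\log$ is the inverse of $\exp$. Write $g\rhd h=ghg^{-1}$, $U_{2\text{-}loc}=\{(g,h)\in G\times U: g\rhd h\in U\}$ and $U_{3\text{-}loc}=\{(g,h,k)\in G\times G\times U: g\rhd k,\ h\rhd k,\ g\rhd(h\rhd k)\in U\}$. $ZL^2(\mathfrak g,\mathfrak a^a)$ (Leibniz 2-cocycles with coefficients in $\mathfrak a$ viewed as an anti-symmetric representation, i.e. with zero right action) is the set of bilinear maps $\omega:\mathfrak g\times\mathfrak g\to\mathfrak a$ with $x.\omega(y,z)-y.\omega(x,z)-\omega([x,y],z)-\omega(y,[x,z])+\omega(x,[y,z])=0$. $G$ acts on $Hom(\mathfrak g,\mathfrak a)$ by $(g.\alpha)(y)=g.\alpha(Ad_{g^{-1}}y)$. For a representation $V$ of $G$ and $\alpha\in Hom(\mathfrak g,V)$, the form $\alpha^{eq}\in\Omega^1(G,V)$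 is $\alpha^{eq}(h)(m)=h.\alpha(T_hL_{h^{-1}}m)$. For $\omega\in ZL^2(\mathfrak g,\mathfrak a^a)$ put $\tau^2(\omega)(x)(y)=\omega(x,y)$, so $\tau^2(\omega)\in Hom(\mathfrak g,Hom(\mathfrak g,\mathfrak a))$, and $I(\omega)(g)=\int_{c_g}\tau^2(\omega)^{eq}\in Hom(\mathfrak g,\mathfrak a)$, where $c:G\times[0,1]\to G$ is a smooth map such that $c_g$ is a path from $1$ to $g$ and $c_1$ is constant (the value does not depend on $c$). With $\gamma_k(s)=\exp(s\log k)$, define for $(g,h)\in U_{2\text{-}loc}$: $I^2(\omega)(g,h)=\int_{\gamma_{g\rhd h}}(I(\omega)(g))^{eq}\in\mathfrak a$.
   Formalization: The logarithm on U is taken to be the inverse of exp on an open Ad-invariant neighbourhood of 0 on which exp is injective, so that log(g▷k)=Ad_g(log k); for branches of log not compatible with conjugation the identity can fail (e.g. in SL(2,C)). *)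

theory Defs
  imports "HOL-Analysis.Analysis" "HOL-Algebra.Group"
begin

section \<open>Smooth maps between open subsets of Euclidean spaces\<close>

text \<open>\<open>Ck_on k f S\<close> is \<open>C\<^sup>k\<close> on an open set \<open>S\<close>: the iterated directional derivatives of order
  less than \<open>k\<close> exist and are Frechet differentiable, those of order \<open>k\<close> are continuous.\<close>

primrec Ck_on :: "nat \<Rightarrow> ('a::euclidean_space \<Rightarrow> 'b::real_normed_vector) \<Rightarrow> 'a set \<Rightarrow> bool" where
  "Ck_on 0 f S \<longleftrightarrow> continuous_on S f"
| "Ck_on (Suc k) f S \<longleftrightarrow>
     (\<forall>x\<in>S. f differentiable (at x)) \<and> (\<forall>v. Ck_on k (\<lambda>x. frechet_derivative f (at x) v) S)"

definition smooth_on :: "('a::euclidean_space \<Rightarrow> 'b::real_normed_vector) \<Rightarrow> 'a set \<Rightarrow> bool" where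
  "smooth_on f S \<longleftrightarrow> (\<forall>k. Ck_on k f S)"

section \<open>Smooth manifolds\<close>

text \<open>A chart is a pair of a domain and a coordinate map; the inverse coordinate map is
  \<open>inv_into\<close> on the domain.  The manifold is the whole (topological) type \<open>'m\<close>.\<close>

type_synonym ('m, 'e) chart = "'m set \<times> ('m \<Rightarrow> 'e)"

definition smooth_atlas ::
  "('m::topological_space, 'e::euclidean_space) chart set \<Rightarrow> bool" where
  "smooth_atlas A \<longleftrightarrow>
     (\<Union>(U, \<phi>)\<in>A. U) = UNIV \<and>
     (\<forall>(U, \<phi>)\<in>A. open U \<and> open (\<phi> ` U) \<and> homeomorphism U (\<phi> ` U) \<phi> (inv_into U \<phi>)) \<and>
     (\<forall>(U, \<phi>)\<in>A. \<forall>(V, \<psi>)\<in>A. smooth_on (\<psi> \<circ> inv_into U \<phi>) (\<phi> ` (U \<inter> V)))"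

definition std_atlas :: "('v::euclidean_space, 'v) chart set" where
  "std_atlas = {(UNIV, id)}"

definition prod_atlas ::
  "('m, 'e) chart set \<Rightarrow> ('n, 'f) chart set \<Rightarrow> ('m \<times> 'n, 'e \<times> 'f) chart set" where
  "prod_atlas A B = (\<lambda>((U, \<phi>), (V, \<psi>)). (U \<times> V, map_prod \<phi> \<psi>)) ` (A \<times> B)"

text \<open>Smoothness of \<open>f\<close> on an open subset \<open>S\<close> of the source manifold.\<close>

definition smooth_map ::
  "('m::topological_space, 'e::euclidean_space) chart set \<Rightarrow>
   ('n::topological_space, 'f::euclidean_space) chart set \<Rightarrow> 'm set \<Rightarrow> ('m \<Rightarrow> 'n) \<Rightarrow> bool" where
  "smooth_map A B S f \<longleftrightarrow>
     continuous_on S f \<and>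
     (\<forall>(U, \<phi>)\<in>A. \<forall>(V, \<psi>)\<in>B. smooth_on (\<psi> \<circ> f \<circ> inv_into U \<phi>) (\<phi> ` (S \<inter> U \<inter> f -` V)))"

text \<open>For every point \<open>p\<close> one chart of the atlas around \<open>p\<close> is chosen, and the tangent space at
  \<open>p\<close> is identified with the model space \<open>'e\<close> by means of this chart.  So a tangent vector at
  \<open>p\<close> is an element of \<open>'e\<close>, and tangent maps are derivatives read in the chosen charts.  On a
  vector space with \<open>std_atlas\<close> this is the usual identification of the tangent spaces with the
  space itself.\<close>

definition chart_at :: "('m, 'e) chart set \<Rightarrow> 'm \<Rightarrow> ('m, 'e) chart" where
  "chart_at A p = (SOME \<kappa>. \<kappa> \<in> A \<and> p \<in> fst \<kappa>)"

definition tangent_map ::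
  "('m, 'e::euclidean_space) chart set \<Rightarrow> ('n, 'f::euclidean_space) chart set \<Rightarrow>
   ('m \<Rightarrow> 'n) \<Rightarrow> 'm \<Rightarrow> 'e \<Rightarrow> 'f" where
  "tangent_map A B f p v =
     (let (U, \<phi>) = chart_at A p; (V, \<psi>) = chart_at B (f p)
      in frechet_derivative (\<psi> \<circ> f \<circ> inv_into U \<phi>) (at (\<phi> p)) v)"

text \<open>A path \<open>[0,1] \<rightarrow> M\<close> is smooth if it extends to a smooth map on an open neighbourhood of
  \<open>[0,1]\<close>; its velocity is one-sided at the end points.\<close>

definition smooth_path ::
  "('m::topological_space, 'e::euclidean_space) chart set \<Rightarrow> (real \<Rightarrow> 'm) \<Rightarrow> bool" where
  "smooth_path A p \<longleftrightarrow>
     (\<exists>q J. open J \<and> {0..1} \<subseteq> J \<and> smooth_map std_atlas A J q \<and> (\<forall>t\<in>{0..1}. p t = q t))"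

definition velocity :: "('m, 'e::euclidean_space) chart set \<Rightarrow> (real \<Rightarrow> 'm) \<Rightarrow> real \<Rightarrow> 'e" where
  "velocity A p t = vector_derivative (snd (chart_at A (p t)) \<circ> p) (at t within {0..1})"

text \<open>Integral over a path of a vector-valued 1-form \<open>\<theta>\<close>, where \<open>\<theta> h m\<close> is its value on the
  tangent vector \<open>m\<close> at \<open>h\<close>.\<close>

definition path_integral ::
  "('m, 'e::euclidean_space) chart set \<Rightarrow> ('m \<Rightarrow> 'e \<Rightarrow> 'v::real_normed_vector) \<Rightarrow>
   (real \<Rightarrow> 'm) \<Rightarrow> 'v" where
  "path_integral A \<theta> p = integral {0..1} (\<lambda>t. \<theta> (p t) (velocity A p t))"

section \<open>Lie groups\<close>

locale lie_group = group G
  for G :: "('g::{t2_space, second_countable_topology}) monoid" (structure) +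
  fixes A :: "('g, 'e::euclidean_space) chart set"
  assumes carrier_UNIV: "carrier G = UNIV"
    and smooth_atlas: "smooth_atlas A"
    and smooth_mult: "smooth_map (prod_atlas A A) A UNIV (\<lambda>(g, h). g \<otimes> h)"
    and smooth_inv: "smooth_map A A UNIV (\<lambda>g. inv g)"

definition conj_op :: "('g, 'x) monoid_scheme \<Rightarrow> 'g \<Rightarrow> 'g \<Rightarrow> 'g" where
  "conj_op G g h = g \<otimes>\<^bsub>G\<^esub> h \<otimes>\<^bsub>G\<^esub> inv\<^bsub>G\<^esub> g"

text \<open>The Lie algebra is the tangent space at \<open>\<one>\<close>, i.e. \<open>'e\<close>, with \<open>[x,y] = ad(x)(y)\<close> where
  \<open>ad\<close> is the tangent map of \<open>Ad\<close> at \<open>\<one>\<close>.\<close>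

definition Ad :: "'g monoid \<Rightarrow> ('g, 'e::euclidean_space) chart set \<Rightarrow> 'g \<Rightarrow> 'e \<Rightarrow> 'e" where
  "Ad G A g = tangent_map A A (conj_op G g) \<one>\<^bsub>G\<^esub>"

definition lie_bracket :: "'g monoid \<Rightarrow> ('g, 'e::euclidean_space) chart set \<Rightarrow> 'e \<Rightarrow> 'e \<Rightarrow> 'e" where
  "lie_bracket G A x y = tangent_map A std_atlas (\<lambda>g. Ad G A g y) \<one>\<^bsub>G\<^esub> x"

definition one_parameter_subgroup ::
  "('g::topological_space) monoid \<Rightarrow> ('g, 'e::euclidean_space) chart set \<Rightarrow> (real \<Rightarrow> 'g) \<Rightarrow> bool" where
  "one_parameter_subgroup G A \<gamma> \<longleftrightarrow>
     smooth_map std_atlas A UNIV \<gamma> \<and> (\<forall>s t. \<gamma> (s + t) = \<gamma> s \<otimes>\<^bsub>G\<^esub> \<gamma> t)"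

definition lie_exp ::
  "('g::topological_space) monoid \<Rightarrow> ('g, 'e::euclidean_space) chart set \<Rightarrow> 'e \<Rightarrow> 'g" where
  "lie_exp G A x =
     (THE \<gamma>. one_parameter_subgroup G A \<gamma> \<and> tangent_map std_atlas A \<gamma> 0 1 = x) 1"

text \<open>A logarithm is the inverse of \<open>exp\<close> restricted to an open neighbourhood \<open>D\<close> of \<open>0\<close> in the
  Lie algebra on which \<open>exp\<close> is injective.  As \<open>exp\<close> need not be globally injective, \<open>log\<close>
  depends on \<open>D\<close>.  The invariance of \<open>D\<close> under \<open>Ad\<close> makes the chosen branch compatible with
  conjugation, i.e. \<open>log (g \<rhd> k) = Ad g (log k)\<close> whenever both \<open>k\<close> and \<open>g \<rhd> k\<close> lie in a set on
  which \<open>log\<close> is defined; a branch without this property could take logarithms of conjugate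
  elements from unrelated sheets of \<open>exp\<close>.\<close>

definition log_domain ::
  "('g::topological_space) monoid \<Rightarrow> ('g, 'e::euclidean_space) chart set \<Rightarrow> 'e set \<Rightarrow> bool" where
  "log_domain G A D \<longleftrightarrow>
     open D \<and> 0 \<in> D \<and> inj_on (lie_exp G A) D \<and> (\<forall>g. \<forall>x\<in>D. Ad G A g x \<in> D)"

definition lie_log ::
  "('g::topological_space) monoid \<Rightarrow> ('g, 'e::euclidean_space) chart set \<Rightarrow> 'e set \<Rightarrow> 'g \<Rightarrow> 'e" where
  "lie_log G A D = inv_into D (lie_exp G A)"

definition U2_loc :: "('g, 'x) monoid_scheme \<Rightarrow> 'g set \<Rightarrow> ('g \<times> 'g) set" where
  "U2_loc G U = {(g, h). g \<in> carrier G \<and> h \<in> U \<and> conj_op G g h \<in> U}"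

definition U3_loc :: "('g, 'x) monoid_scheme \<Rightarrow> 'g set \<Rightarrow> ('g \<times> 'g \<times> 'g) set" where
  "U3_loc G U = {(g, h, k). g \<in> carrier G \<and> h \<in> carrier G \<and> k \<in> U \<and>
     conj_op G g k \<in> U \<and> conj_op G h k \<in> U \<and> conj_op G g (conj_op G h k) \<in> U}"

section \<open>Representations and Leibniz cocycles\<close>

definition lie_group_rep ::
  "('g::topological_space) monoid \<Rightarrow> ('g, 'e::euclidean_space) chart set \<Rightarrow>
   ('g \<Rightarrow> 'a::euclidean_space \<Rightarrow> 'a) \<Rightarrow> bool" where
  "lie_group_rep G A \<rho> \<longleftrightarrow>
     (\<forall>g. linear (\<rho> g)) \<and> \<rho> \<one>\<^bsub>G\<^esub> = id \<and> (\<forall>g h. \<rho> (g \<otimes>\<^bsub>G\<^esub> h) = \<rho> g \<circ> \<rho> h) \<and>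
     smooth_map (prod_atlas A std_atlas) std_atlas UNIV (\<lambda>(g, v). \<rho> g v)"

text \<open>The induced action \<open>x.v\<close> of the Lie algebra.\<close>

definition lie_alg_act ::
  "'g monoid \<Rightarrow> ('g, 'e::euclidean_space) chart set \<Rightarrow>
   ('g \<Rightarrow> 'a::euclidean_space \<Rightarrow> 'a) \<Rightarrow> 'e \<Rightarrow> 'a \<Rightarrow> 'a" where
  "lie_alg_act G A \<rho> x v = tangent_map A std_atlas (\<lambda>g. \<rho> g v) \<one>\<^bsub>G\<^esub> x"

definition ZL2 ::
  "'g monoid \<Rightarrow> ('g, 'e::euclidean_space) chart set \<Rightarrow>
   ('g \<Rightarrow> 'a::euclidean_space \<Rightarrow> 'a) \<Rightarrow> ('e \<Rightarrow> 'e \<Rightarrow> 'a) set" where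
  "ZL2 G A \<rho> = {\<omega>. bilinear \<omega> \<and>
     (\<forall>x y z. lie_alg_act G A \<rho> x (\<omega> y z) - lie_alg_act G A \<rho> y (\<omega> x z)
        - \<omega> (lie_bracket G A x y) z - \<omega> y (lie_bracket G A x z) + \<omega> x (lie_bracket G A y z) = 0)}"

text \<open>\<open>Hom(\<gg>, V)\<close> is the type \<open>'e \<Rightarrow>\<^sub>L 'v\<close>: the Lie algebra is finite-dimensional, so all its
  linear maps are bounded.\<close>

definition hom_act ::
  "'g monoid \<Rightarrow> ('g, 'e::euclidean_space) chart set \<Rightarrow>
   ('g \<Rightarrow> 'a::euclidean_space \<Rightarrow> 'a) \<Rightarrow> 'g \<Rightarrow> ('e \<Rightarrow>\<^sub>L 'a) \<Rightarrow> ('e \<Rightarrow>\<^sub>L 'a)" where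
  "hom_act G A \<rho> g \<alpha> = Blinfun (\<lambda>y. \<rho> g (blinfun_apply \<alpha> (Ad G A (inv\<^bsub>G\<^esub> g) y)))"

text \<open>The equivariant 1-form of \<open>\<alpha> \<in> Hom(\<gg>, V)\<close>, where \<open>\<rho>\<close> is the action on \<open>V\<close>.\<close>

definition eq_form ::
  "'g monoid \<Rightarrow> ('g, 'e::euclidean_space) chart set \<Rightarrow>
   ('g \<Rightarrow> 'v::real_normed_vector \<Rightarrow> 'v) \<Rightarrow> ('e \<Rightarrow>\<^sub>L 'v) \<Rightarrow> 'g \<Rightarrow> 'e \<Rightarrow> 'v" where
  "eq_form G A \<rho> \<alpha> h m =
     \<rho> h (blinfun_apply \<alpha> (tangent_map A A (\<lambda>k. inv\<^bsub>G\<^esub> h \<otimes>\<^bsub>G\<^esub> k) h m))"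

definition tau2 ::
  "('e::euclidean_space \<Rightarrow> 'e \<Rightarrow> 'a::euclidean_space) \<Rightarrow> ('e \<Rightarrow>\<^sub>L ('e \<Rightarrow>\<^sub>L 'a))" where
  "tau2 \<omega> = Blinfun (\<lambda>x. Blinfun (\<lambda>y. \<omega> x y))"

text \<open>Choice of paths \<open>c g\<close> from \<open>\<one>\<close> to \<open>g\<close>.  Joint smoothness in \<open>(g, t)\<close> is not demanded: it
  would contract the group to a point, which is impossible for, e.g., \<open>SU(2)\<close>.\<close>

definition path_family ::
  "('g::topological_space) monoid \<Rightarrow> ('g, 'e::euclidean_space) chart set \<Rightarrow>
   ('g \<Rightarrow> real \<Rightarrow> 'g) \<Rightarrow> bool" where
  "path_family G A c \<longleftrightarrow>
     (\<forall>g. smooth_path A (c g) \<and> c g 0 = \<one>\<^bsub>G\<^esub> \<and> c g 1 = g) \<and> (\<forall>t\<in>{0..1}. c \<one>\<^bsub>G\<^esub> t = \<one>\<^bsub>G\<^esub>)"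

definition I1 ::
  "'g monoid \<Rightarrow> ('g, 'e::euclidean_space) chart set \<Rightarrow> ('g \<Rightarrow> 'a::euclidean_space \<Rightarrow> 'a) \<Rightarrow>
   ('g \<Rightarrow> real \<Rightarrow> 'g) \<Rightarrow> ('e \<Rightarrow> 'e \<Rightarrow> 'a) \<Rightarrow> 'g \<Rightarrow> ('e \<Rightarrow>\<^sub>L 'a)" where
  "I1 G A \<rho> c \<omega> g = path_integral A (eq_form G A (hom_act G A \<rho>) (tau2 \<omega>)) (c g)"

text \<open>\<open>I2\<close> is meaningful on \<open>U2_loc G U\<close>, where \<open>U \<subseteq> exp D\<close>.\<close>

definition I2 ::
  "('g::topological_space) monoid \<Rightarrow> ('g, 'e::euclidean_space) chart set \<Rightarrow>
   ('g \<Rightarrow> 'a::euclidean_space \<Rightarrow> 'a) \<Rightarrow> ('g \<Rightarrow> real \<Rightarrow> 'g) \<Rightarrow> 'e set \<Rightarrow>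
   ('e \<Rightarrow> 'e \<Rightarrow> 'a) \<Rightarrow> 'g \<Rightarrow> 'g \<Rightarrow> 'a" where
  "I2 G A \<rho> c D \<omega> g h =
     path_integral A (eq_form G A \<rho> (I1 G A \<rho> c \<omega> g))
       (\<lambda>s. lie_exp G A (s *\<^sub>R lie_log G A D (conj_op G g h)))"

end

theory Submission
  imports Defs
begin

text \<open>For \<open>\<omega>\<close> in \<open>ZL2\<close> the map \<open>tau2 \<omega>\<close> is a Lie algebra one-cocycle with values in \<open>Hom(\<gg>, \<aa>)\<close>, so
  its equivariant form is closed: by equivariance this has to be checked at \<open>\<one>\<close> only, where it is the
  cocycle condition.  Hence the form has local primitives, by simple connectedness its integrals
  depend on the end points only, and \<open>c (g \<otimes> h)\<close> may be replaced by \<open>c g\<close> followed by the translate of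
  \<open>c h\<close> by \<open>g\<close>.  This makes \<open>I1\<close> a group cocycle: \<open>I1 (g \<otimes> h) = I1 g + g.I1 h\<close>.

  Let \<open>X\<close> be the logarithm of \<open>h \<rhd> k\<close>, so that \<open>Ad g X\<close> is the logarithm of \<open>g \<rhd> (h \<rhd> k)\<close>.  The
  integrals defining \<open>I2\<close> run along one-parameter subgroups, and
  \<open>I2 (g \<otimes> h) k - I2 g (h \<rhd> k)\<close> is the integral of \<open>(g.I1 h)\<close> along the conjugate by \<open>g\<close> of \<open>exp (s X)\<close>,
  which equals \<open>g.I2 h k\<close> by equivariance.  The rack identity is the difference of this
  identity for \<open>(g, h, k)\<close> and for \<open>(g \<rhd> h, g, k)\<close>, since \<open>(g \<rhd> h) \<otimes> g = g \<otimes> h\<close>.\<close>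

section \<open>Calculus\<close>

text \<open>Simple connectedness supplies only continuous homotopies, along which a form cannot be
  pulled back and integrated. Instead of Stokes' theorem, a primitive is carried along a continuous
  map of the unit square by gluing local ones, and derivatives reappear only on the boundary paths.
  So the concatenated loop may have corners at the joints.

  The second obstacle is that tangent spaces are identified with \<open>'e\<close> by charts chosen
  point by point, with no relation between neighbouring points. Derivatives are therefore moved to
  \<open>\<one>\<close> by left translation and read in the single chart there. Closedness becomes a
  statement about the second-order term of the multiplication in this chart, of which only the
  antisymmetric part, the bracket, enters.

  The exponential map is accessed through one-parameter subgroups alone: their uniqueness yields
  \<open>exp (s X) = \<gamma> s\<close> and the behaviour under conjugation, and the
  \<open>Ad\<close>-invariance of \<open>D\<close> keeps \<open>Ad g X\<close> on the chosen branch
  of the logarithm.\<close>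

lemma second_difference_mvt:
  fixes f :: "'a::real_normed_vector \<Rightarrow> real"
  assumes s: "s > 0"
    and B: "\<And>p q. 0 \<le> p \<Longrightarrow> p \<le> s \<Longrightarrow> 0 \<le> q \<Longrightarrow> q \<le> s \<Longrightarrow> x + p *\<^sub>R u + q *\<^sub>R w \<in> B"
    and f: "\<And>z. z \<in> B \<Longrightarrow> (f has_derivative f1 z) (at z)"
    and f1: "\<And>z. z \<in> B \<Longrightarrow> ((\<lambda>z. f1 z u) has_derivative f2 z) (at z)"
  obtains z where "z \<in> B"
    "f (x + s *\<^sub>R u + s *\<^sub>R w) - f (x + s *\<^sub>R u) - f (x + s *\<^sub>R w) + f x = s * s * f2 z w"
proof -
  \<comment> \<open>The increment in direction \<open>w\<close>, seen from the point
    \<open>x + t u\<close>. The mean value theorem is used twice: for \<open>\<phi>\<close> along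
    \<open>u\<close>, then for the resulting increment of \<open>f1\<close> along
    \<open>w\<close>.\<close>
  define \<phi> where "\<phi> t = f (x + t *\<^sub>R u + s *\<^sub>R w) - f (x + t *\<^sub>R u + 0 *\<^sub>R w)" for t
  have d: "((\<lambda>t. f (x + t *\<^sub>R u + q *\<^sub>R w)) has_real_derivative f1 (x + t *\<^sub>R u + q *\<^sub>R w) u) (at t)"
    if "0 \<le> t" "t \<le> s" "0 \<le> q" "q \<le> s" for t q
  proof -
    have "(f has_derivative f1 (x + t *\<^sub>R u + q *\<^sub>R w)) (at (x + t *\<^sub>R u + q *\<^sub>R w))"
      by (rule f[OF B[OF that]])
    then have "((\<lambda>t. f (x + t *\<^sub>R u + q *\<^sub>R w)) has_derivative
        (\<lambda>h. f1 (x + t *\<^sub>R u + q *\<^sub>R w) (h *\<^sub>R u))) (at t)"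
      by (rule has_derivative_compose[rotated]) (auto intro!: derivative_eq_intros)
    moreover have "f1 (x + t *\<^sub>R u + q *\<^sub>R w) (h *\<^sub>R u) = f1 (x + t *\<^sub>R u + q *\<^sub>R w) u * h" for h
      using linear_scale[OF has_derivative_linear[OF f[OF B[OF that]]]] by simp
    ultimately show ?thesis by (simp add: has_field_derivative_def)
  qed
  obtain p where p: "0 < p" "p < s"
    "\<phi> s - \<phi> 0 = (s - 0) * (f1 (x + p *\<^sub>R u + s *\<^sub>R w) u - f1 (x + p *\<^sub>R u + 0 *\<^sub>R w) u)"
  proof -
    have "(\<phi> has_real_derivative f1 (x + t *\<^sub>R u + s *\<^sub>R w) u - f1 (x + t *\<^sub>R u + 0 *\<^sub>R w) u) (at t)"
      if "0 \<le> t" "t \<le> s" for t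
      unfolding \<phi>_def by (intro DERIV_diff d that) (use s in auto)
    from MVT2[OF s this] show thesis using that by blast
  qed
  have d2: "((\<lambda>q. f1 (x + p *\<^sub>R u + q *\<^sub>R w) u) has_real_derivative f2 (x + p *\<^sub>R u + q *\<^sub>R w) w) (at q)"
    if "0 \<le> q" "q \<le> s" for q
  proof -
    have z: "x + p *\<^sub>R u + q *\<^sub>R w \<in> B" using B that p by simp
    then have "((\<lambda>q. f1 (x + p *\<^sub>R u + q *\<^sub>R w) u) has_derivative
        (\<lambda>h. f2 (x + p *\<^sub>R u + q *\<^sub>R w) (h *\<^sub>R w))) (at q)"
      by (intro has_derivative_compose[OF _ f1]) (auto intro!: derivative_eq_intros)
    moreover have "f2 (x + p *\<^sub>R u + q *\<^sub>R w) (h *\<^sub>R w) = f2 (x + p *\<^sub>R u + q *\<^sub>R w) w * h" for h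
      using linear_scale[OF has_derivative_linear[OF f1[OF z]]] by simp
    ultimately show ?thesis by (simp add: has_field_derivative_def)
  qed
  obtain q where q: "0 < q" "q < s"
    "f1 (x + p *\<^sub>R u + s *\<^sub>R w) u - f1 (x + p *\<^sub>R u + 0 *\<^sub>R w) u
      = (s - 0) * f2 (x + p *\<^sub>R u + q *\<^sub>R w) w"
    using MVT2[OF s, of "\<lambda>q. f1 (x + p *\<^sub>R u + q *\<^sub>R w) u" "\<lambda>q. f2 (x + p *\<^sub>R u + q *\<^sub>R w) w"] d2
    by blast
  show thesis
  proof (rule that)
    show "x + p *\<^sub>R u + q *\<^sub>R w \<in> B" using B p q by simp
    show "f (x + s *\<^sub>R u + s *\<^sub>R w) - f (x + s *\<^sub>R u) - f (x + s *\<^sub>R w) + f x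
        = s * s * f2 (x + p *\<^sub>R u + q *\<^sub>R w) w"
      using p(3) q(3) by (simp add: \<phi>_def)
  qed
qed

text \<open>The second difference over a small parallelogram does not change when \<open>u\<close>
  and \<open>w\<close> are exchanged. Computed in both orders, it forces the two second derivatives
  to agree at a pair of points near \<open>x\<close>, and continuity at \<open>x\<close> does the
  rest.\<close>

lemma second_derivative_symmetric_real:
  fixes f :: "'a::real_normed_vector \<Rightarrow> real"
  assumes S: "open S" "x \<in> S"
    and f: "\<And>z. z \<in> S \<Longrightarrow> (f has_derivative f1 z) (at z)"
    and fu: "\<And>z. z \<in> S \<Longrightarrow> ((\<lambda>z. f1 z u) has_derivative fu z) (at z)"
    and fw: "\<And>z. z \<in> S \<Longrightarrow> ((\<lambda>z. f1 z w) has_derivative fw z) (at z)"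
    and cu: "isCont (\<lambda>z. fu z w) x" and cw: "isCont (\<lambda>z. fw z u) x"
  shows "fu x w = fw x u"
proof (rule ccontr)
  assume ne: "fu x w \<noteq> fw x u"
  define e where "e = \<bar>fu x w - fw x u\<bar> / 2"
  have e: "e > 0" using ne by (simp add: e_def)
  obtain d0 where d0: "d0 > 0" "ball x d0 \<subseteq> S" using S open_contains_ball by blast
  obtain d1 where d1: "d1 > 0" "\<And>z. dist z x < d1 \<Longrightarrow> dist (fu z w) (fu x w) < e"
    using cu e unfolding continuous_at_eps_delta dist_norm by blast
  obtain d2 where d2: "d2 > 0" "\<And>z. dist z x < d2 \<Longrightarrow> dist (fw z u) (fw x u) < e"
    using cw e unfolding continuous_at_eps_delta dist_norm by blast
  define d where "d = min d0 (min d1 d2)"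
  \<comment> \<open>Puts the whole parallelogram within \<open>d / 2\<close> of \<open>x\<close>;
    the summand 1 covers \<open>u = w = 0\<close>.\<close>
  define s where "s = d / (2 * (norm u + norm w + 1))"
  have d: "d > 0" using d0 d1 d2 by (simp add: d_def)
  have n: "norm u + norm w + 1 > 0" by (simp add: add_nonneg_pos)
  have s: "s > 0" using d n by (simp add: s_def)
  have B: "x + p *\<^sub>R u + q *\<^sub>R w \<in> ball x d" if "0 \<le> p" "p \<le> s" "0 \<le> q" "q \<le> s" for p q
  proof -
    have "dist x (x + p *\<^sub>R u + q *\<^sub>R w) = norm (p *\<^sub>R u + q *\<^sub>R w)"
      by (simp add: dist_norm) (metis norm_minus_cancel minus_add_distrib diff_conv_add_uminus)
    also have "\<dots> \<le> p * norm u + q * norm w"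
      using that by (metis abs_of_nonneg norm_scaleR norm_triangle_ineq)
    also have "\<dots> \<le> s * norm u + s * norm w"
      using that by (intro add_mono mult_right_mono) auto
    also have "\<dots> < s * (norm u + norm w + 1)" using s by (simp add: algebra_simps)
    also have "\<dots> = d / 2" using n by (simp add: s_def field_simps)
    finally show ?thesis using d by simp
  qed
  have sub: "ball x d \<subseteq> S" using d0 by (auto simp: d_def)
  obtain z where z: "z \<in> ball x d"
    "f (x + s *\<^sub>R u + s *\<^sub>R w) - f (x + s *\<^sub>R u) - f (x + s *\<^sub>R w) + f x = s * s * fu z w"
    by (rule second_difference_mvt[OF s, of x u w "ball x d" f f1 fu]) (use B f fu sub in auto)
  obtain z' where z': "z' \<in> ball x d"
    "f (x + s *\<^sub>R w + s *\<^sub>R u) - f (x + s *\<^sub>R w) - f (x + s *\<^sub>R u) + f x = s * s * fw z' u"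
  proof (rule second_difference_mvt[OF s, of x w u "ball x d" f f1 fw])
    show "x + p *\<^sub>R w + q *\<^sub>R u \<in> ball x d" if "0 \<le> p" "p \<le> s" "0 \<le> q" "q \<le> s" for p q
      using B[of q p] that by (simp add: algebra_simps)
  qed (use f fw sub in auto)
  have "s * s * fu z w = s * s * fw z' u"
    using z(2) z'(2) by (simp add: algebra_simps)
  then have "fu z w = fw z' u" using s by simp
  moreover have "\<bar>fu z w - fu x w\<bar> < e" "\<bar>fw z' u - fw x u\<bar> < e"
    using d1(2)[of z] d2(2)[of z'] z(1) z'(1) by (auto simp: d_def dist_commute dist_real_def)
  moreover have "\<bar>a - b\<bar> \<le> \<bar>c - a\<bar> + \<bar>c - b\<bar>" for a b c :: real by linarith
  ultimately show False unfolding e_def by (smt (verit) field_sum_of_halves)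
qed

lemma second_derivative_symmetric:
  fixes f :: "'a::real_normed_vector \<Rightarrow> 'b::euclidean_space"
  assumes S: "open S" "x \<in> S"
    and f: "\<And>z. z \<in> S \<Longrightarrow> (f has_derivative f1 z) (at z)"
    and fu: "\<And>z. z \<in> S \<Longrightarrow> ((\<lambda>z. f1 z u) has_derivative fu z) (at z)"
    and fw: "\<And>z. z \<in> S \<Longrightarrow> ((\<lambda>z. f1 z w) has_derivative fw z) (at z)"
    and cu: "isCont (\<lambda>z. fu z w) x" and cw: "isCont (\<lambda>z. fw z u) x"
  shows "fu x w = fw x u"
proof (rule euclidean_eqI)
  fix b :: 'b assume "b \<in> Basis"
  show "fu x w \<bullet> b = fw x u \<bullet> b"
    by (rule second_derivative_symmetric_real[OF S, where f = "\<lambda>z. f z \<bullet> b" and ?f1.0 = "\<lambda>z v. f1 z v \<bullet> b"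
          and fu = "\<lambda>z v. fu z v \<bullet> b" and fw = "\<lambda>z v. fw z v \<bullet> b"])
      (use assms in \<open>auto intro!: has_derivative_inner_left continuous_intros\<close>)
qed

section \<open>Families of linear maps and the Poincare lemma\<close>

lemma linear_derivative_of_linear_family:
  fixes \<theta> :: "'x::real_normed_vector \<Rightarrow> 'e::real_normed_vector \<Rightarrow> 'v::real_normed_vector"
  assumes lin: "\<And>x. x \<in> S \<Longrightarrow> linear (\<theta> x)" and S: "open S" "x0 \<in> S"
    and \<theta>: "\<And>v. ((\<lambda>x. \<theta> x v) has_derivative (\<lambda>u. \<Theta> u v)) (at x0)"
  shows "linear (\<Theta> u)"
proof
  show "\<Theta> u (v + v') = \<Theta> u v + \<Theta> u v'" for v v'
  proof -
    have "((\<lambda>x. \<theta> x (v + v')) has_derivative (\<lambda>u. \<Theta> u v + \<Theta> u v')) (at x0)"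
      by (rule has_derivative_transform_within_open[OF has_derivative_add[OF \<theta> \<theta>] S])
         (simp add: linear_add[OF lin])
    from has_derivative_unique[OF this \<theta>] show ?thesis by metis
  qed
  show "\<Theta> u (r *\<^sub>R v) = r *\<^sub>R \<Theta> u v" for r v
  proof -
    have "((\<lambda>x. \<theta> x (r *\<^sub>R v)) has_derivative (\<lambda>u. r *\<^sub>R \<Theta> u v)) (at x0)"
      by (rule has_derivative_transform_within_open[OF has_derivative_scaleR_right[OF \<theta>] S])
         (simp add: linear_scale[OF lin])
    from has_derivative_unique[OF this \<theta>] show ?thesis by metis
  qed
qed

text \<open>Expansion in the standard basis reduces this to the product rule for finitely many
  terms. So differentiability of \<open>\<theta>\<close> is asked only at each fixed argument
  \<open>v\<close>, never in operator norm.\<close>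

lemma has_derivative_linear_family:
  fixes \<theta> :: "'x::real_normed_vector \<Rightarrow> 'e::euclidean_space \<Rightarrow> 'v::real_normed_vector"
  assumes lin: "\<And>x. x \<in> S \<Longrightarrow> linear (\<theta> x)" and S: "open S" "x0 \<in> S"
    and \<theta>: "\<And>v. ((\<lambda>x. \<theta> x v) has_derivative (\<lambda>u. \<Theta> u v)) (at x0)"
    and w: "(w has_derivative w') (at x0)"
  shows "((\<lambda>x. \<theta> x (w x)) has_derivative (\<lambda>u. \<Theta> u (w x0) + \<theta> x0 (w' u))) (at x0)"
proof -
  have expand: "\<theta> x v = (\<Sum>b\<in>Basis. (v \<bullet> b) *\<^sub>R \<theta> x b)" if "x \<in> S" for x v
    by (subst euclidean_representation[of v, symmetric])
       (simp only: linear_sum[OF lin[OF that]] linear_scale[OF lin[OF that]])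
  have linT: "linear (\<Theta> u)" for u by (rule linear_derivative_of_linear_family[OF lin S \<theta>])
  have expT: "\<Theta> u v = (\<Sum>b\<in>Basis. (v \<bullet> b) *\<^sub>R \<Theta> u b)" for u v
    by (subst euclidean_representation[of v, symmetric])
       (simp only: linear_sum[OF linT] linear_scale[OF linT])
  have "((\<lambda>x. \<Sum>b\<in>Basis. (w x \<bullet> b) *\<^sub>R \<theta> x b) has_derivative
      (\<lambda>u. \<Sum>b\<in>Basis. (w x0 \<bullet> b) *\<^sub>R \<Theta> u b + (w' u \<bullet> b) *\<^sub>R \<theta> x0 b)) (at x0)"
    by (intro has_derivative_sum has_derivative_scaleR \<theta> has_derivative_inner_left w)
  then have "((\<lambda>x. \<theta> x (w x)) has_derivative
      (\<lambda>u. \<Sum>b\<in>Basis. (w x0 \<bullet> b) *\<^sub>R \<Theta> u b + (w' u \<bullet> b) *\<^sub>R \<theta> x0 b)) (at x0)"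
    by (rule has_derivative_transform_within_open[OF _ S]) (simp add: expand[symmetric])
  then show ?thesis
    by (simp add: sum.distrib expT[symmetric] expand[OF S(2), symmetric])
qed

lemma continuous_on_linear_family:
  fixes \<theta> :: "'x::topological_space \<Rightarrow> 'e::euclidean_space \<Rightarrow> 'v::real_normed_vector"
  assumes lin: "\<And>x. x \<in> S \<Longrightarrow> linear (\<theta> x)"
    and \<theta>: "\<And>v. continuous_on S (\<lambda>x. \<theta> x v)" and w: "continuous_on S w"
  shows "continuous_on S (\<lambda>x. \<theta> x (w x))"
proof -
  have expand: "\<theta> x v = (\<Sum>b\<in>Basis. (v \<bullet> b) *\<^sub>R \<theta> x b)" if "x \<in> S" for x v
    by (subst euclidean_representation[of v, symmetric])
       (simp only: linear_sum[OF lin[OF that]] linear_scale[OF lin[OF that]])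
  have "continuous_on S (\<lambda>x. \<Sum>b\<in>Basis. (w x \<bullet> b) *\<^sub>R \<theta> x b)"
    by (intro continuous_intros \<theta> w)
  then show ?thesis using expand by (simp cong: continuous_on_cong)
qed


text \<open>The primitive is the integral of \<open>\<theta>\<close> over the radius from
  \<open>c\<close> to \<open>x\<close>, that is, of \<open>g x t\<close> over \<open>t\<close> in
  \<open>[0, 1]\<close>. It is differentiated under the integral sign.\<close>

lemma poincare_ball:
  fixes \<theta> :: "'e::euclidean_space \<Rightarrow> 'e \<Rightarrow> 'v::banach"
  assumes lin: "\<And>x. x \<in> ball c r \<Longrightarrow> linear (\<theta> x)"
    and \<theta>: "\<And>x v. x \<in> ball c r \<Longrightarrow> ((\<lambda>x. \<theta> x v) has_derivative (\<lambda>u. \<Theta> x u v)) (at x)"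
    and sym: "\<And>x u v. x \<in> ball c r \<Longrightarrow> \<Theta> x u v = \<Theta> x v u"
    and cont: "\<And>u v. continuous_on (ball c r) (\<lambda>x. \<Theta> x u v)"
  shows "\<exists>f. \<forall>x\<in>ball c r. (f has_derivative \<theta> x) (at x)"
proof -
  define p where "p x t = c + t *\<^sub>R (x - c)" for x t
  have p: "p x t \<in> ball c r" if "x \<in> ball c r" "0 \<le> t" "t \<le> 1" for x t
  proof -
    have "t * norm (x - c) \<le> 1 * norm (x - c)" using that by (intro mult_right_mono) auto
    then show ?thesis using that by (simp add: p_def dist_norm norm_minus_commute)
  qed
  have linT: "linear (\<Theta> x u)" if "x \<in> ball c r" for x u
    by (rule linear_derivative_of_linear_family[OF lin open_ball that \<theta>[OF that]]) auto
  define F where "F x t v = t *\<^sub>R \<Theta> (p x t) v (x - c) + \<theta> (p x t) v" for x t v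
  define g where "g x t = \<theta> (p x t) (x - c)" for x t
  have g: "((\<lambda>x. g x t) has_derivative F x t) (at x)" if x: "x \<in> ball c r" and t: "0 \<le> t" "t \<le> 1" for x t
  proof -
    have "((\<lambda>x. \<theta> (p x t) (x - c)) has_derivative
        (\<lambda>u. \<Theta> (p x t) (t *\<^sub>R u) (x - c) + \<theta> (p x t) u)) (at x)"
    proof (rule has_derivative_linear_family[OF _ open_ball x])
      show "linear (\<theta> (p y t))" if "y \<in> ball c r" for y using lin p that t by blast
      show "((\<lambda>y. \<theta> (p y t) v) has_derivative (\<lambda>u. \<Theta> (p x t) (t *\<^sub>R u) v)) (at x)" for v
        by (rule has_derivative_compose[where g = "\<lambda>x. \<theta> x v" and f = "\<lambda>y. p y t", OF _ \<theta>[OF p[OF x t]]])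
           (auto simp: p_def[abs_def] intro!: derivative_eq_intros)
    qed (auto intro!: derivative_eq_intros)
    moreover have "\<Theta> (p x t) (t *\<^sub>R u) v = t *\<^sub>R \<Theta> (p x t) u v" for u v
      using linear_scale[OF has_derivative_linear[OF \<theta>[OF p[OF x t]]]] by blast
    ultimately show ?thesis by (simp add: g_def F_def[abs_def])
  qed
  have blF: "bounded_linear (F x t)" if "x \<in> ball c r" "0 \<le> t" "t \<le> 1" for x t
    using g[OF that] has_derivative_bounded_linear by blast
  have pc: "continuous_on (ball c r \<times> {0..1}) (\<lambda>z. p (fst z) (snd z))"
    unfolding p_def by (intro continuous_intros)
  have pI: "(\<lambda>z. p (fst z) (snd z)) ` (ball c r \<times> {0..1}) \<subseteq> ball c r" using p by auto
  have \<theta>c: "continuous_on (ball c r) (\<lambda>x. \<theta> x v)" for v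
    using \<theta> by (meson continuous_at_imp_continuous_on has_derivative_continuous)
  have cF: "continuous_on (ball c r \<times> {0..1}) (\<lambda>z. F (fst z) (snd z) v)" for v
    unfolding F_def
  proof (intro continuous_intros)
    show "continuous_on (ball c r \<times> {0..1}) (\<lambda>z. \<theta> (p (fst z) (snd z)) v)"
      by (rule continuous_on_compose2[OF \<theta>c pc pI])
    show "continuous_on (ball c r \<times> {0..1}) (\<lambda>z. \<Theta> (p (fst z) (snd z)) v (fst z - c))"
    proof (rule continuous_on_linear_family)
      show "linear (\<Theta> (p (fst z) (snd z)) v)" if "z \<in> ball c r \<times> {0..1}" for z
        using linT p that by auto
      show "continuous_on (ball c r \<times> {0..1}) (\<lambda>z. \<Theta> (p (fst z) (snd z)) v w)" for w
        by (rule continuous_on_compose2[OF cont pc pI])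
    qed (intro continuous_intros)
  qed
  have cg: "continuous_on (ball c r \<times> {0..1}) (\<lambda>z. g (fst z) (snd z))"
    unfolding g_def
  proof (rule continuous_on_linear_family)
    show "linear (\<theta> (p (fst z) (snd z)))" if "z \<in> ball c r \<times> {0..1}" for z
      using lin p that by auto
    show "continuous_on (ball c r \<times> {0..1}) (\<lambda>z. \<theta> (p (fst z) (snd z)) v)" for v
      by (rule continuous_on_compose2[OF \<theta>c pc pI])
  qed (intro continuous_intros)
  have slice: "continuous_on {0..1} (Pair x)" for x :: 'e by (intro continuous_intros)
  show ?thesis
  proof (intro exI ballI)
    fix x assume x: "x \<in> ball c r"
    \<comment> \<open>Differentiation under the integral wants a derivative that is continuous with
      values in the operator space; in finite dimension, continuity at each fixed vector gives
      this.\<close>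
    have cB: "continuous_on (ball c r \<times> {0..1}) (\<lambda>z. Blinfun (F (fst z) (snd z)))"
    proof (rule continuous_on_blinfun_componentwise)
      fix i :: 'e
      show "continuous_on (ball c r \<times> {0..1}) (\<lambda>z. blinfun_apply (Blinfun (F (fst z) (snd z))) i)"
        using cF[of i] by (rule continuous_on_eq) (auto simp: bounded_linear_Blinfun_apply blF)
    qed
    have "((\<lambda>x. integral (cbox 0 1) (g x)) has_derivative
        blinfun_apply (integral (cbox 0 1) (\<lambda>t. Blinfun (F x t)))) (at x within ball c r)"
    proof (rule leibniz_rule[OF _ _ _ x])
      show "((\<lambda>x. g x t) has_derivative blinfun_apply (Blinfun (F y t))) (at y within ball c r)"
        if "y \<in> ball c r" "t \<in> cbox 0 1" for y t
        using g[of y t] blF[of y t] that by (simp add: bounded_linear_Blinfun_apply has_derivative_at_withinI)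
      show "g y integrable_on cbox 0 1" if "y \<in> ball c r" for y
        unfolding interval_cbox[symmetric]
        by (rule integrable_continuous_real)
           (use continuous_on_compose2[OF cg slice, of y] that in \<open>auto simp: image_subset_iff\<close>)
      show "continuous_on (ball c r \<times> cbox 0 1) (\<lambda>(x, t). Blinfun (F x t))"
        using cB by (simp add: case_prod_unfold)
    qed auto
    moreover have "blinfun_apply (integral (cbox 0 1) (\<lambda>t. Blinfun (F x t))) v = \<theta> x v" for v
    proof -
      have "(\<lambda>t. Blinfun (F x t)) integrable_on {0..1}"
        by (rule integrable_continuous_real)
           (use continuous_on_compose2[OF cB slice, of x] x in \<open>auto simp: image_subset_iff\<close>)
      then have "blinfun_apply (integral {0..1} (\<lambda>t. Blinfun (F x t))) v
          = integral {0..1} (\<lambda>t. blinfun_apply (Blinfun (F x t)) v)"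
        by (rule blinfun_apply_integral)
      also have "\<dots> = integral {0..1} (\<lambda>t. F x t v)"
        by (rule integral_cong) (use blF[OF x] in \<open>auto simp: bounded_linear_Blinfun_apply\<close>)
      \<comment> \<open>Closedness enters here: exchanging the arguments of \<open>\<Theta>\<close>
        makes \<open>F x t v\<close> the derivative of \<open>t *\<^sub>R \<theta> (p x t) v\<close>
        in \<open>t\<close>. The factor \<open>t\<close> kills the lower boundary term, and
        \<open>p x 1 = x\<close>.\<close>
      also have "\<dots> = 1 *\<^sub>R \<theta> (p x 1) v - 0 *\<^sub>R \<theta> (p x 0) v"
      proof (rule integral_unique, rule fundamental_theorem_of_calculus)
        fix t :: real assume t: "t \<in> {0..1}"
        then have pt: "p x t \<in> ball c r" using p x by simp
        have "((\<lambda>t. \<theta> (p x t) v) has_derivative (\<lambda>h. \<Theta> (p x t) (h *\<^sub>R (x - c)) v)) (at t)"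
          by (rule has_derivative_compose[where g = "\<lambda>x. \<theta> x v" and f = "p x", OF _ \<theta>[OF pt]])
             (auto simp: p_def[abs_def] intro!: derivative_eq_intros)
        moreover have "\<Theta> (p x t) (h *\<^sub>R (x - c)) v = h *\<^sub>R \<Theta> (p x t) v (x - c)" for h
          using linear_scale[OF has_derivative_linear[OF \<theta>[OF pt]]] sym[OF pt] by metis
        ultimately have "((\<lambda>t. \<theta> (p x t) v) has_vector_derivative \<Theta> (p x t) v (x - c)) (at t)"
          by (simp add: has_vector_derivative_def)
        from has_vector_derivative_scaleR[OF DERIV_ident this]
        have "((\<lambda>t. t *\<^sub>R \<theta> (p x t) v) has_vector_derivative F x t v) (at t)"
          by (simp add: F_def)
        then show "((\<lambda>t. t *\<^sub>R \<theta> (p x t) v) has_vector_derivative F x t v) (at t within {0..1})"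
          by (rule has_vector_derivative_at_within)
      qed simp
      finally show ?thesis by (simp add: p_def)
    qed
    then have "blinfun_apply (integral (cbox 0 1) (\<lambda>t. Blinfun (F x t))) = \<theta> x"
      by (simp add: fun_eq_iff)
    ultimately show "((\<lambda>x. integral (cbox 0 1) (g x)) has_derivative \<theta> x) (at x)"
      using x by (simp add: at_within_open[OF x open_ball])
  qed
qed

text \<open>An operator on a finite-dimensional space is the sum of the rank-one operators
  \<open>v \<mapsto> (v \<bullet> b) g(b)\<close>, and these depend on the values
  \<open>g(b)\<close> through bounded linear maps.\<close>

lemma has_derivative_blinfun_componentwise:
  fixes f :: "'x::real_normed_vector \<Rightarrow> 'e::euclidean_space \<Rightarrow>\<^sub>L 'a::real_normed_vector"
  assumes "\<And>z. ((\<lambda>x. blinfun_apply (f x) z) has_derivative (\<lambda>u. blinfun_apply (D u) z)) (at x within S)"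
  shows "(f has_derivative D) (at x within S)"
proof -
  have e: "g = (\<Sum>b\<in>Basis. blinfun_scaleR_left (blinfun_apply g b) o\<^sub>L blinfun_inner_left b)"
    for g :: "'e \<Rightarrow>\<^sub>L 'a"
  proof (rule blinfun_euclidean_eqI)
    fix i :: 'e assume i: "i \<in> Basis"
    have "(\<Sum>b\<in>Basis. (i \<bullet> b) *\<^sub>R blinfun_apply g b) = (\<Sum>b\<in>Basis. if b = i then blinfun_apply g b else 0)"
      by (rule sum.cong) (auto simp: inner_Basis i)
    then show "blinfun_apply g i =
        blinfun_apply (\<Sum>b\<in>Basis. blinfun_scaleR_left (blinfun_apply g b) o\<^sub>L blinfun_inner_left b) i"
      using i by (simp add: blinfun.sum_left)
  qed
  have "((\<lambda>x. \<Sum>b\<in>Basis. blinfun_scaleR_left (blinfun_apply (f x) b) o\<^sub>L blinfun_inner_left b) has_derivative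
      (\<lambda>u. \<Sum>b\<in>Basis. blinfun_scaleR_left (blinfun_apply (D u) b) o\<^sub>L blinfun_inner_left b)) (at x within S)"
    by (intro has_derivative_sum bounded_linear.has_derivative[OF
          bounded_bilinear.bounded_linear_left[OF bounded_bilinear_blinfun_compose]]
        bounded_linear.has_derivative[OF bounded_linear_blinfun_scaleR_left] assms)
  then show ?thesis using e by simp
qed

lemma blinfun_apply_Blinfun:
  fixes f :: "'x::euclidean_space \<Rightarrow> 'y::real_normed_vector"
  shows "linear f \<Longrightarrow> blinfun_apply (Blinfun f) = f"
  by (simp add: bounded_linear_Blinfun_apply linear_conv_bounded_linear)

section \<open>C^k maps on open sets\<close>

lemma Ck_on_cong:
  assumes "open S" "\<And>x. x \<in> S \<Longrightarrow> f x = g x" "Ck_on k f S"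
  shows "Ck_on k g S"
  using assms
proof (induction k arbitrary: f g)
  case 0
  then show ?case by (simp cong: continuous_on_cong)
next
  case (Suc k)
  have d: "(g has_derivative frechet_derivative f (at x)) (at x)" if "x \<in> S" for x
  proof (rule has_derivative_transform_within_open[OF _ Suc.prems(1) that])
    show "(f has_derivative frechet_derivative f (at x)) (at x)"
      using Suc.prems(3) that by (simp add: frechet_derivative_works)
  qed (use Suc.prems(2) in auto)
  then have e: "frechet_derivative f (at x) = frechet_derivative g (at x)" if "x \<in> S" for x
    using frechet_derivative_at that by blast
  have "Ck_on k (\<lambda>x. frechet_derivative g (at x) v) S" for v
    by (rule Suc.IH[OF Suc.prems(1), of "\<lambda>x. frechet_derivative f (at x) v"])
       (use Suc.prems(3) e in auto)
  then show ?case using d by (auto simp: differentiable_def)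
qed

lemma smooth_on_cong:
  assumes "open S" "\<And>x. x \<in> S \<Longrightarrow> f x = g x" "smooth_on f S"
  shows "smooth_on g S"
  using assms Ck_on_cong unfolding smooth_on_def by blast

lemma smooth_on_has_derivative:
  assumes "smooth_on f S" "x \<in> S"
  shows "(f has_derivative frechet_derivative f (at x)) (at x)"
proof -
  have "Ck_on (Suc 0) f S" using assms(1) by (auto simp only: smooth_on_def)
  then show ?thesis using assms(2) by (simp add: frechet_derivative_works)
qed

lemma smooth_on_frechet_derivative:
  assumes "smooth_on f S"
  shows "smooth_on (\<lambda>x. frechet_derivative f (at x) v) S"
  unfolding smooth_on_def
proof
  fix k
  have "Ck_on (Suc k) f S" using assms by (auto simp only: smooth_on_def)
  then show "Ck_on k (\<lambda>x. frechet_derivative f (at x) v) S" by simp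
qed

lemma smooth_on_continuous_on: "smooth_on f S \<Longrightarrow> continuous_on S f"
  using Ck_on.simps(1) smooth_on_def by blast

lemma Ck_on_const: "Ck_on k (\<lambda>x. c) S"
  by (induction k arbitrary: c) (auto simp: frechet_derivative_const)

text \<open>The factor \<open>r\<close> of the chain rule is absorbed into the direction,
  \<open>r * v\<close> in place of \<open>v\<close>, so the induction hypothesis applies directly to
  the directional derivative.\<close>

lemma Ck_on_scale:
  fixes f :: "real \<Rightarrow> 'b::real_normed_vector"
  assumes S: "open S" and "Ck_on k f S"
  shows "Ck_on k (\<lambda>t. f (r * t)) ((\<lambda>t. r * t) -` S)"
  using assms(2)
proof (induction k arbitrary: f)
  case 0
  then show ?case by (auto intro!: continuous_on_compose2[of S f] continuous_intros)
next
  case (Suc k)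
  have d: "((\<lambda>t. f (r * t)) has_derivative (\<lambda>v. frechet_derivative f (at (r * t)) (r * v))) (at t)"
    if "r * t \<in> S" for t
  proof (rule has_derivative_compose[of "\<lambda>t. r * t" "\<lambda>t. r * t" _ _ f])
    show "(f has_derivative frechet_derivative f (at (r * t))) (at (r * t))"
      using Suc.prems that by (simp add: frechet_derivative_works)
  qed (auto intro!: derivative_eq_intros)
  have e: "frechet_derivative (\<lambda>t. f (r * t)) (at t) v = frechet_derivative f (at (r * t)) (r * v)"
    if "r * t \<in> S" for t v
    using frechet_derivative_at[OF d[OF that]] by (simp add: fun_eq_iff)
  have "Ck_on k (\<lambda>t. frechet_derivative (\<lambda>t. f (r * t)) (at t) v) ((\<lambda>t. r * t) -` S)" for v
  proof (rule Ck_on_cong)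
    show "open ((\<lambda>t. r * t) -` S)"
      by (rule open_vimage[OF S]) (intro continuous_intros)
    show "Ck_on k (\<lambda>t. frechet_derivative f (at (r * t)) (r * v)) ((\<lambda>t. r * t) -` S)"
      by (rule Suc.IH[of "\<lambda>s. frechet_derivative f (at s) (r * v)"]) (use Suc.prems in auto)
  qed (simp add: e)
  then show ?case using d by (auto simp: differentiable_def)
qed

lemma smooth_on_second_derivative_symmetric:
  fixes f :: "'a::euclidean_space \<Rightarrow> 'b::euclidean_space"
  assumes f: "smooth_on f S" and S: "open S" "z \<in> S"
  shows "frechet_derivative (\<lambda>z. frechet_derivative f (at z) u) (at z) w
       = frechet_derivative (\<lambda>z. frechet_derivative f (at z) w) (at z) u"
proof (rule second_derivative_symmetric[OF S, where ?f1.0 = "\<lambda>z. frechet_derivative f (at z)"])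
  note f1 = smooth_on_frechet_derivative[OF f]
  have c: "isCont (\<lambda>z. frechet_derivative (\<lambda>z. frechet_derivative f (at z) u) (at z) w) z" for u w
    using smooth_on_continuous_on[OF smooth_on_frechet_derivative[OF f1]] S
    by (simp add: continuous_on_eq_continuous_at)
  show "isCont (\<lambda>z. frechet_derivative (\<lambda>z. frechet_derivative f (at z) u) (at z) w) z"
    "isCont (\<lambda>z. frechet_derivative (\<lambda>z. frechet_derivative f (at z) w) (at z) u) z"
    by (rule c)+
  show "(f has_derivative frechet_derivative f (at z)) (at z)" if "z \<in> S" for z
    by (rule smooth_on_has_derivative[OF f that])
  show "((\<lambda>z. frechet_derivative f (at z) u) has_derivative
      frechet_derivative (\<lambda>z. frechet_derivative f (at z) u) (at z)) (at z)"
    "((\<lambda>z. frechet_derivative f (at z) w) has_derivative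
      frechet_derivative (\<lambda>z. frechet_derivative f (at z) w) (at z)) (at z)" if "z \<in> S" for z
    by (rule smooth_on_has_derivative[OF f1 that])+
qed

section \<open>Primitives of locally exact forms along maps\<close>

lemma eventually_constant_imp_constant:
  fixes d :: "'x::topological_space \<Rightarrow> 'w"
  assumes K: "connected K" and d: "\<And>x. x \<in> K \<Longrightarrow> \<forall>\<^sub>F y in at x within K. d y = d x"
    and xy: "x \<in> K" "y \<in> K"
  shows "d x = d y"
proof -
  have "d constant_on K"
  proof (rule locally_constant_imp_constant[OF K])
    show "\<exists>T. openin (top_of_set K) T \<and> x \<in> T \<and> (\<forall>y\<in>T. d y = d x)" if x: "x \<in> K" for x
    proof -
      obtain N where N: "open N" "x \<in> N" "\<And>y. y \<in> N \<Longrightarrow> y \<noteq> x \<Longrightarrow> y \<in> K \<Longrightarrow> d y = d x"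
        using d[OF x] unfolding eventually_at_topological by blast
      then show ?thesis using x by (intro exI[of _ "K \<inter> N"]) (auto simp: openin_open)
    qed
  qed
  then show ?thesis using xy unfolding constant_on_def by metis
qed

text \<open>\<open>F i\<close> stands for a primitive on \<open>W i\<close> of one and the same closed form; \<open>u\<close> is a primitive of the
  pullback of that form under \<open>H\<close>, which need only be continuous.\<close>

definition primitive_along ::
  "('i \<Rightarrow> 'g::topological_space set) \<Rightarrow> ('i \<Rightarrow> 'g \<Rightarrow> 'v) \<Rightarrow> ('x::topological_space \<Rightarrow> 'g) \<Rightarrow> ('x \<Rightarrow> 'v::ab_group_add) \<Rightarrow> 'x set \<Rightarrow> bool"
  where "primitive_along W F H u K \<longleftrightarrow>
    (\<forall>x\<in>K. \<exists>i. H x \<in> W i \<and> (\<forall>\<^sub>F y in at x within K. u y - F i (H y) = u x - F i (H x)))"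

text \<open>Two primitives of one form differ by a constant only near each point, since
  \<open>W i \<inter> W j\<close> may be disconnected; hence the local form of
  \<open>compatible\<close>. Values in an abelian group suffice because the gluing is purely
  topological.\<close>

locale local_primitives =
  fixes W :: "'i \<Rightarrow> 'g::topological_space set" and F :: "'i \<Rightarrow> 'g \<Rightarrow> 'v::ab_group_add"
  assumes open_W: "open (W i)"
    and cover: "\<exists>i. p \<in> W i"
    and compatible: "p \<in> W i \<Longrightarrow> p \<in> W j \<Longrightarrow>
      \<exists>N. open N \<and> p \<in> N \<and> (\<forall>q\<in>N. F i q - F j q = F i p - F j p)"
begin

text \<open>Lets later arguments choose the index at \<open>x\<close>, in particular one index for
  two primitives. Continuity of \<open>H\<close> pulls the neighbourhood on which
  \<open>F i - F j\<close> is constant back to the parameter space.\<close>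

lemma primitive_along_any:
  assumes u: "primitive_along W F H u K" and H: "continuous_on K H" and x: "x \<in> K" "H x \<in> W j"
  shows "\<forall>\<^sub>F y in at x within K. u y - F j (H y) = u x - F j (H x)"
proof -
  obtain i where i: "H x \<in> W i" "\<forall>\<^sub>F y in at x within K. u y - F i (H y) = u x - F i (H x)"
    using u x unfolding primitive_along_def by blast
  obtain N where N: "open N" "H x \<in> N" "\<And>q. q \<in> N \<Longrightarrow> F i q - F j q = F i (H x) - F j (H x)"
    using compatible[OF i(1) x(2)] by blast
  have "(H \<longlongrightarrow> H x) (at x within K)" using H x by (simp add: continuous_on_def)
  then have "\<forall>\<^sub>F y in at x within K. H y \<in> N" using N by (simp add: topological_tendstoD)
  with i(2) show ?thesis
  proof eventually_elim
    case (elim y)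
    have "u y - F j (H y) = (u y - F i (H y)) + (F i (H y) - F j (H y))" by simp
    also have "\<dots> = u x - F j (H x)" using elim N(3)[of "H y"] by simp
    finally show ?case .
  qed
qed

lemma primitive_along_subset:
  assumes "primitive_along W F H u K" "L \<subseteq> K"
  shows "primitive_along W F H u L"
  using assms unfolding primitive_along_def
  by (blast intro: filter_leD[OF at_le])

lemma primitive_along_compose:
  assumes u: "primitive_along W F H u K" and a: "continuous_on L a" "a ` L \<subseteq> K"
  shows "primitive_along W F (\<lambda>x. H (a x)) (\<lambda>x. u (a x)) L"
  unfolding primitive_along_def
proof
  fix x assume x: "x \<in> L"
  then obtain i where i: "H (a x) \<in> W i"
      "\<forall>\<^sub>F y in at (a x) within K. u y - F i (H y) = u (a x) - F i (H (a x))"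
    using u a unfolding primitive_along_def by blast
  obtain N where N: "open N" "a x \<in> N" "\<And>y. y \<in> N \<Longrightarrow> y \<noteq> a x \<Longrightarrow> y \<in> K \<Longrightarrow>
      u y - F i (H y) = u (a x) - F i (H (a x))"
    using i(2) unfolding eventually_at_topological by blast
  have "\<forall>\<^sub>F y in at x within L. a y \<in> N"
    using a(1) x N by (auto simp: continuous_on_def intro: topological_tendstoD)
  moreover have "\<forall>\<^sub>F y in at x within L. y \<in> L" by (simp add: eventually_at_filter)
  ultimately have "\<forall>\<^sub>F y in at x within L. u (a y) - F i (H (a y)) = u (a x) - F i (H (a x))"
  proof eventually_elim
    case (elim y)
    \<comment> \<open>\<open>a\<close> may take the value \<open>a x\<close> at other points
      \<open>y\<close>; there the punctured filter says nothing, but the equation is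
      trivial.\<close>
    then show ?case using N(3)[of "a y"] a by (cases "a y = a x") auto
  qed
  then show "\<exists>i. H (a x) \<in> W i \<and>
      (\<forall>\<^sub>F y in at x within L. u (a y) - F i (H (a y)) = u (a x) - F i (H (a x)))"
    using i by blast
qed

lemma primitive_along_unique:
  assumes u: "primitive_along W F H u K" and v: "primitive_along W F H v K"
    and H: "continuous_on K H" and K: "connected K" and xy: "x \<in> K" "y \<in> K"
  shows "u x - v x = u y - v y"
proof (rule eventually_constant_imp_constant[OF K _ xy])
  fix x assume x: "x \<in> K"
  obtain i where i: "H x \<in> W i" using cover by blast
  show "\<forall>\<^sub>F y in at x within K. u y - v y = u x - v x"
    using primitive_along_any[OF u H x i] primitive_along_any[OF v H x i]
  proof eventually_elim
    case (elim y)
    have "u y - v y = (u y - F i (H y)) - (v y - F i (H y))" by simp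
    also have "\<dots> = u x - v x" unfolding elim by simp
    finally show ?case .
  qed
qed

text \<open>Along a constant map the zero function is a primitive, so uniqueness up to a constant
  applies.\<close>

lemma primitive_along_const:
  assumes u: "primitive_along W F H u K" and H: "\<And>x. x \<in> K \<Longrightarrow> H x = p"
    and K: "connected K" and xy: "x \<in> K" "y \<in> K"
  shows "u x = u y"
proof -
  have "primitive_along W F H (\<lambda>_. 0) K"
    unfolding primitive_along_def
  proof
    fix x assume x: "x \<in> K"
    obtain i where i: "H x \<in> W i" using cover by blast
    have "\<forall>\<^sub>F y in at x within K. y \<in> K" by (simp add: eventually_at_filter)
    then have "\<forall>\<^sub>F y in at x within K. 0 - F i (H y) = 0 - F i (H x)"
      by eventually_elim (simp add: H x)
    with i show "\<exists>i. H x \<in> W i \<and> (\<forall>\<^sub>F y in at x within K. 0 - F i (H y) = 0 - F i (H x))" by blast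
  qed
  moreover have "continuous_on K H" using H by (simp cong: continuous_on_cong)
  ultimately have "u x - 0 = u y - 0" using primitive_along_unique[OF u] K xy by blast
  then show ?thesis by simp
qed

text \<open>On the connected intersection the two primitives differ by one constant
  \<open>e\<close>, by which \<open>v\<close> is shifted. Closedness handles points of only one of
  the sets: they are not limit points of the other, which therefore imposes no condition
  there.\<close>

lemma primitive_along_glue:
  assumes u: "primitive_along W F H u K" and v: "primitive_along W F H v L"
    and H: "continuous_on (K \<union> L) H" and KL: "connected (K \<inter> L)" "closed K" "closed L"
  shows "\<exists>w. primitive_along W F H w (K \<union> L)"
proof -
  have "\<exists>e. \<forall>x\<in>K \<inter> L. u x - v x = e"
  proof (cases "K \<inter> L = {}")
    case False
    then obtain y where y: "y \<in> K \<inter> L" by blast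
    have "u x - v x = u y - v y" if "x \<in> K \<inter> L" for x
    proof (rule primitive_along_unique[OF _ _ _ KL(1) that y])
      show "primitive_along W F H u (K \<inter> L)" "primitive_along W F H v (K \<inter> L)"
        using primitive_along_subset u v by blast+
      show "continuous_on (K \<inter> L) H" by (rule continuous_on_subset[OF H]) auto
    qed
    then show ?thesis by blast
  qed auto
  then obtain e where e: "\<And>x. x \<in> K \<Longrightarrow> x \<in> L \<Longrightarrow> u x = v x + e" by (auto simp: algebra_simps)
  define w where "w x = (if x \<in> K then u x else v x + e)" for x
  have wL: "w x = v x + e" if "x \<in> L" for x using e that by (simp add: w_def)
  have wK: "w x = u x" if "x \<in> K" for x using that by (simp add: w_def)
  have HK: "continuous_on K H" and HL: "continuous_on L H"
    by (rule continuous_on_subset[OF H], simp)+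
  have "primitive_along W F H w (K \<union> L)"
    unfolding primitive_along_def
  proof
    fix x assume x: "x \<in> K \<union> L"
    obtain i where i: "H x \<in> W i" using cover by blast
    have "\<forall>\<^sub>F y in at x within K. w y - F i (H y) = w x - F i (H x)"
    proof (cases "x \<in> K")
      case True
      have "\<forall>\<^sub>F y in at x within K. y \<in> K" by (simp add: eventually_at_filter)
      with primitive_along_any[OF u HK True i] show ?thesis
        by eventually_elim (simp add: wK True)
    next
      case False
      then have "at x within K = bot" using KL(2) by (auto simp: closed_limpt trivial_limit_within)
      then show ?thesis by simp
    qed
    moreover have "\<forall>\<^sub>F y in at x within L. w y - F i (H y) = w x - F i (H x)"
    proof (cases "x \<in> L")
      case True
      have "\<forall>\<^sub>F y in at x within L. y \<in> L" by (simp add: eventually_at_filter)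
      with primitive_along_any[OF v HL True i] show ?thesis
        by eventually_elim (simp add: wL True algebra_simps)
    next
      case False
      then have "at x within L = bot" using KL(3) by (auto simp: closed_limpt trivial_limit_within)
      then show ?thesis by simp
    qed
    ultimately have "\<forall>\<^sub>F y in at x within (K \<union> L). w y - F i (H y) = w x - F i (H x)"
      by (simp add: at_within_union eventually_sup)
    with i show "\<exists>i. H x \<in> W i \<and> (\<forall>\<^sub>F y in at x within (K \<union> L). w y - F i (H y) = w x - F i (H x))"
      by blast
  qed
  then show ?thesis by blast
qed

text \<open>Compactness by bisection, one coordinate at a time: around each height \<open>t\<close>,
  small rectangles are glued to a strip across the square, and then the strips are glued. All
  intersections met are products of intervals, hence connected.\<close>

lemma primitive_along_square:
  fixes H :: "real \<times> real \<Rightarrow> 'g"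
  assumes H: "continuous_on ({0..1} \<times> {0..1}) H"
  shows "\<exists>u. primitive_along W F H u ({0..1} \<times> {0..1})"
proof -
  \<comment> \<open>Clipping lets strips protrude beyond the square, so heights near 0 and 1 need no
    separate treatment.\<close>
  define I where "I a b = {a..b} \<inter> {0..1::real}" for a b
  have I01: "I 0 1 = {0..1}" by (simp add: I_def)
  have Iu: "I a b \<union> I b c = I a c" "I a b \<inter> I b c = I b b" if "a \<le> b" "b \<le> c" for a b c
    using that by (auto simp: I_def)
  have Icl: "closed (I a b)" "connected (I a b)" for a b
    by (auto simp: I_def Int_atLeastAtMost)
  have strip: "\<exists>e>0. \<exists>u. primitive_along W F H u (I 0 1 \<times> I (t - e) (t + e))"
    if t: "0 \<le> t" "t \<le> 1" for t
  proof (rule Bolzano[of 0 1 "\<lambda>a b. \<exists>e>0. \<exists>u. primitive_along W F H u (I a b \<times> I (t - e) (t + e))"])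
    fix a b c :: real
    assume ab: "\<exists>e>0. \<exists>u. primitive_along W F H u (I a b \<times> I (t - e) (t + e))"
      and bc: "\<exists>e>0. \<exists>u. primitive_along W F H u (I b c \<times> I (t - e) (t + e))" and le: "a \<le> b" "b \<le> c"
    then obtain e u e' v where e: "e > 0" "primitive_along W F H u (I a b \<times> I (t - e) (t + e))"
      "e' > 0" "primitive_along W F H v (I b c \<times> I (t - e') (t + e'))" by blast
    \<comment> \<open>The two rectangles may have different heights; both primitives are defined
      over the smaller one.\<close>
    define J where "J = I (t - min e e') (t + min e e')"
    have "\<exists>w. primitive_along W F H w (I a b \<times> J \<union> I b c \<times> J)"
    proof (rule primitive_along_glue)
      show "primitive_along W F H u (I a b \<times> J)"
        by (rule primitive_along_subset[OF e(2)]) (auto simp: J_def I_def)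
      show "primitive_along W F H v (I b c \<times> J)"
        by (rule primitive_along_subset[OF e(4)]) (auto simp: J_def I_def)
      show "continuous_on (I a b \<times> J \<union> I b c \<times> J) H"
        by (rule continuous_on_subset[OF H]) (auto simp: J_def I_def)
      have "I a b \<times> J \<inter> I b c \<times> J = I b b \<times> J" using Iu(2)[OF le] by blast
      then show "connected (I a b \<times> J \<inter> I b c \<times> J)" by (simp add: connected_Times Icl J_def)
    qed (auto intro!: closed_Times Icl simp: J_def)
    moreover have "I a b \<times> J \<union> I b c \<times> J = I a c \<times> J" using Iu(1)[OF le] by blast
    ultimately show "\<exists>e>0. \<exists>u. primitive_along W F H u (I a c \<times> I (t - e) (t + e))"
      using e(1,3) unfolding J_def by (intro exI[of _ "min e e'"]) auto
  next
    fix s :: real assume s: "0 \<le> s" "s \<le> 1"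
    obtain i where i: "H (s, t) \<in> W i" using cover by blast
    obtain N where N: "open N" "(s, t) \<in> N" "\<And>z. z \<in> N \<inter> ({0..1} \<times> {0..1}) \<Longrightarrow> H z \<in> W i"
    proof -
      obtain N where "open N" "N \<inter> ({0..1} \<times> {0..1}) = H -` W i \<inter> ({0..1} \<times> {0..1})"
        using H open_W continuous_on_open_invariant by metis
      moreover have "(s, t) \<in> H -` W i \<inter> ({0..1} \<times> {0..1})" using i s t by simp
      ultimately show thesis using that by blast
    qed
    obtain d where d: "d > 0" "ball (s, t) d \<subseteq> N" using N open_contains_ball by blast
    \<comment> \<open>Width below \<open>d / 2\<close> and half-height \<open>d / 4\<close> keep the
      rectangle inside the ball of radius \<open>d\<close>, where \<open>H\<close> stays in the
      single set \<open>W i\<close>.\<close>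
    have "primitive_along W F H (\<lambda>z. F i (H z)) (I a b \<times> I (t - d/4) (t + d/4))"
      if ab: "a \<le> s" "s \<le> b" "b - a < d / 2" for a b
      unfolding primitive_along_def
    proof
      fix z assume z: "z \<in> I a b \<times> I (t - d/4) (t + d/4)"
      obtain p q where pq: "z = (p, q)" by (cases z)
      have "\<bar>s - p\<bar> < d/2" "\<bar>t - q\<bar> < d/2" using z pq ab d(1) by (auto simp: I_def abs_real_def)
      then have "dist (s, t) z < d"
        unfolding pq dist_Pair_Pair dist_real_def
        using sqrt_sum_squares_le_sum_abs[of "\<bar>s - p\<bar>" "\<bar>t - q\<bar>"] by simp
      then have "H z \<in> W i" using d N(3) z by (auto simp: I_def)
      then show "\<exists>i'. H z \<in> W i' \<and> (\<forall>\<^sub>F y in at z within I a b \<times> I (t - d/4) (t + d/4).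
          F i (H y) - F i' (H y) = F i (H z) - F i' (H z))"
        by (intro exI[of _ i]) simp
    qed
    moreover have "d / 2 > 0" "d / 4 > 0" using d(1) by auto
    ultimately show "\<exists>d>0. \<forall>a b. a \<le> s \<and> s \<le> b \<and> b - a < d \<longrightarrow>
        (\<exists>e>0. \<exists>u. primitive_along W F H u (I a b \<times> I (t - e) (t + e)))"
      by meson
  qed simp
  have "\<exists>u. primitive_along W F H u (I 0 1 \<times> I 0 1)"
  proof (rule Bolzano[of 0 1 "\<lambda>c d. \<exists>u. primitive_along W F H u (I 0 1 \<times> I c d)"])
    fix a b c :: real
    assume ab: "\<exists>u. primitive_along W F H u (I 0 1 \<times> I a b)"
      and bc: "\<exists>u. primitive_along W F H u (I 0 1 \<times> I b c)" and le: "a \<le> b" "b \<le> c"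
    then obtain u v where uv: "primitive_along W F H u (I 0 1 \<times> I a b)"
       "primitive_along W F H v (I 0 1 \<times> I b c)" by blast
    have eq: "I 0 1 \<times> I a b \<inter> I 0 1 \<times> I b c = I 0 1 \<times> I b b"
      "I 0 1 \<times> I a b \<union> I 0 1 \<times> I b c = I 0 1 \<times> I a c" using Iu[OF le] by blast+
    have "\<exists>w. primitive_along W F H w (I 0 1 \<times> I a b \<union> I 0 1 \<times> I b c)"
    proof (rule primitive_along_glue[OF uv])
      show "continuous_on (I 0 1 \<times> I a b \<union> I 0 1 \<times> I b c) H"
        by (rule continuous_on_subset[OF H]) (auto simp: I_def)
      show "connected (I 0 1 \<times> I a b \<inter> I 0 1 \<times> I b c)"
        unfolding eq by (simp add: connected_Times Icl)
    qed (auto intro!: closed_Times Icl)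
    then show "\<exists>u. primitive_along W F H u (I 0 1 \<times> I a c)" unfolding eq .
  next
    fix t :: real assume t: "0 \<le> t" "t \<le> 1"
    obtain e u where e: "e > 0" and u: "primitive_along W F H u (I 0 1 \<times> I (t - e) (t + e))"
      using strip[OF t] by blast
    have "\<exists>u. primitive_along W F H u (I 0 1 \<times> I a b)" if "a \<le> t" "t \<le> b" "b - a < e" for a b
      using primitive_along_subset[OF u, of "I 0 1 \<times> I a b"] that by (force simp: I_def)
    then show "\<exists>d>0. \<forall>a b. a \<le> t \<and> t \<le> b \<and> b - a < d \<longrightarrow>
        (\<exists>u. primitive_along W F H u (I 0 1 \<times> I a b))"
      using e by blast
  qed simp
  then show ?thesis by (simp add: I01)
qed

lemma primitive_along_cong:
  assumes "primitive_along W F H u K" "\<And>x. x \<in> K \<Longrightarrow> H x = H' x"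
  shows "primitive_along W F H' u K"
  unfolding primitive_along_def
proof
  fix x assume x: "x \<in> K"
  then obtain i where i: "H x \<in> W i" "\<forall>\<^sub>F y in at x within K. u y - F i (H y) = u x - F i (H x)"
    using assms unfolding primitive_along_def by blast
  have "\<forall>\<^sub>F y in at x within K. y \<in> K" by (simp add: eventually_at_filter)
  with i(2) have "\<forall>\<^sub>F y in at x within K. u y - F i (H' y) = u x - F i (H' x)"
    by eventually_elim (use assms(2) x in auto)
  then show "\<exists>i. H' x \<in> W i \<and> (\<forall>\<^sub>F y in at x within K. u y - F i (H' y) = u x - F i (H' x))"
    using i(1) assms(2)[OF x] by auto
qed

text \<open>A contraction of the loop is a square with \<open>p\<close> on one side and a constant
  on the opposite one. The two remaining sides carry the same path because all intermediate loops
  are closed. Their increments cancel, so the increment along \<open>p\<close> vanishes.\<close>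

lemma primitive_along_loop:
  assumes sc: "simply_connected (UNIV :: 'g set)" and p: "path p" "pathfinish p = pathstart p"
  obtains u where "primitive_along W F p u {0..1}" "u 1 = u 0"
proof -
  have "homotopic_loops UNIV p (\<lambda>t. p 0)"
    using sc p unfolding simply_connected_def
    by (simp add: path_def pathfinish_def pathstart_def)
  then have "\<exists>h :: real \<times> real \<Rightarrow> 'g. continuous_on ({0..1} \<times> {0..1}) h \<and> (\<forall>x\<in>{0..1}. h (0, x) = p x) \<and>
      (\<forall>x\<in>{0..1}. h (1, x) = p 0) \<and> (\<forall>t\<in>{0..1}. h (t, 1) = h (t, 0 :: real))"
    unfolding homotopic_loops by (auto simp: pathfinish_def pathstart_def)
  then obtain h :: "real \<times> real \<Rightarrow> 'g" where h: "continuous_on ({0..1} \<times> {0..1}) h"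
    "\<And>x. x \<in> {0..1} \<Longrightarrow> h (0, x) = p x" "\<And>x. x \<in> {0..1} \<Longrightarrow> h (1, x) = p 0"
    "\<And>t. t \<in> {0..1} \<Longrightarrow> h (t, 1) = h (t, 0 :: real)"
    by metis
  obtain u where u: "primitive_along W F h u ({0..1} \<times> {0..1})"
    using primitive_along_square[OF h(1)] by blast
  have edge: "primitive_along W F (\<lambda>x. h (a x)) (\<lambda>x. u (a x)) {0..1}"
    if "continuous_on {0..1} a" "a ` {0..1} \<subseteq> {0..1} \<times> {0..1}" for a
    by (rule primitive_along_compose[OF u that])
  have cI: "connected {0..1::real}" by simp
  \<comment> \<open>Both lateral edges are expressed over the path \<open>h (t, 0)\<close>, which
    makes \<open>u (t, 1)\<close> and \<open>u (t, 0)\<close> two primitives along the same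
    map.\<close>
  have right: "primitive_along W F (\<lambda>t. h (t, 0)) (\<lambda>t. u (t, 1)) {0..1}"
    by (rule primitive_along_cong[OF edge]) (auto intro!: continuous_intros simp: h(4))
  have left: "primitive_along W F (\<lambda>t. h (t, 0)) (\<lambda>t. u (t, 0)) {0..1}"
    by (rule edge) (auto intro!: continuous_intros)
  have cl: "continuous_on {0..1} (\<lambda>t. h (t, 0))"
    by (rule continuous_on_compose2[OF h(1)]) (auto intro!: continuous_intros)
  have top: "primitive_along W F (\<lambda>x. h (1, x)) (\<lambda>x. u (1, x)) {0..1}"
    by (rule edge) (auto intro!: continuous_intros)
  have bottom: "primitive_along W F p (\<lambda>x. u (0, x)) {0..1}"
    by (rule primitive_along_cong[OF edge]) (auto intro!: continuous_intros simp: h(2))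
  have "u (0, 1) - u (0, 0) = u (1, 1) - u (1, 0)"
    by (rule primitive_along_unique[OF right left cl cI]) auto
  moreover have "u (1, 1) = u (1, 0)"
    by (rule primitive_along_const[OF top h(3) cI]) auto
  ultimately show thesis using that[OF bottom] by simp
qed

end

section \<open>Lie groups in the identity chart\<close>

lemma tangent_map_eq:
  "tangent_map A B f p = frechet_derivative
     (\<lambda>x. snd (chart_at B (f p)) (f (inv_into (fst (chart_at A p)) (snd (chart_at A p)) x)))
     (at (snd (chart_at A p) p))"
  by (auto simp: tangent_map_def Let_def case_prod_unfold o_def fun_eq_iff)

lemma chart_at_std_atlas [simp]: "chart_at std_atlas p = (UNIV, id)"
  by (auto simp: chart_at_def std_atlas_def intro!: some_equality)

lemma inv_into_UNIV_id [simp]: "inv_into UNIV id = id"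
  by (auto simp: inv_into_def)

context lie_group
begin

declare carrier_UNIV [simp]

lemma cancel_left [simp]: "inv g \<otimes> (g \<otimes> h) = h" "g \<otimes> (inv g \<otimes> h) = h"
  by (simp_all add: m_assoc[symmetric])

lemma chart_props:
  assumes "(V, \<xi>) \<in> A"
  shows "open V" "open (\<xi> ` V)" "continuous_on V \<xi>" "continuous_on (\<xi> ` V) (inv_into V \<xi>)"
    "inj_on \<xi> V"
proof -
  have "open V \<and> open (\<xi> ` V) \<and> homeomorphism V (\<xi> ` V) \<xi> (inv_into V \<xi>)"
    using smooth_atlas assms unfolding smooth_atlas_def by blast
  then show "open V" "open (\<xi> ` V)" "continuous_on V \<xi>" "continuous_on (\<xi> ` V) (inv_into V \<xi>)"
    "inj_on \<xi> V"
    unfolding homeomorphism_def by (auto intro: inj_on_inverseI)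
qed

lemma chart_inverse [simp]:
  assumes "(V, \<xi>) \<in> A"
  shows "p \<in> V \<Longrightarrow> inv_into V \<xi> (\<xi> p) = p"
    "x \<in> \<xi> ` V \<Longrightarrow> \<xi> (inv_into V \<xi> x) = x" "x \<in> \<xi> ` V \<Longrightarrow> inv_into V \<xi> x \<in> V"
  using chart_props(5)[OF assms] by (auto simp: f_inv_into_f inv_into_into)

lemma chart_tendsto:
  assumes "(V, \<xi>) \<in> A" "p \<in> V" "(f \<longlongrightarrow> p) F"
  shows "((\<lambda>x. \<xi> (f x)) \<longlongrightarrow> \<xi> p) F"
proof -
  have "isCont \<xi> p" using chart_props[OF assms(1)] assms(2) by (simp add: continuous_on_eq_continuous_at)
  from isCont_tendsto_compose[OF this assms(3)] show ?thesis .
qed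

lemma param_tendsto:
  assumes "(V, \<xi>) \<in> A" "x \<in> \<xi> ` V" "(f \<longlongrightarrow> x) F"
  shows "((\<lambda>y. inv_into V \<xi> (f y)) \<longlongrightarrow> inv_into V \<xi> x) F"
proof -
  have "isCont (inv_into V \<xi>) x"
    using chart_props[OF assms(1)] assms(2) by (auto simp: continuous_on_eq_continuous_at)
  from isCont_tendsto_compose[OF this assms(3)] show ?thesis .
qed

lemma chart_at_in: "chart_at A p \<in> A" "p \<in> fst (chart_at A p)"
proof -
  have "\<exists>\<kappa>. \<kappa> \<in> A \<and> p \<in> fst \<kappa>"
    using smooth_atlas unfolding smooth_atlas_def by (force simp: set_eq_iff)
  from someI_ex[OF this] show "chart_at A p \<in> A" "p \<in> fst (chart_at A p)"
    unfolding chart_at_def by blast+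
qed

lemma mult_tendsto:
  assumes "(f \<longlongrightarrow> a) F" "(g \<longlongrightarrow> b) F"
  shows "((\<lambda>x. f x \<otimes> g x) \<longlongrightarrow> a \<otimes> b) F"
proof -
  have "isCont (\<lambda>(g, h). g \<otimes> h) (a, b)"
    using smooth_mult unfolding smooth_map_def by (simp add: continuous_on_eq_continuous_at)
  from isCont_tendsto_compose[OF this tendsto_Pair[OF assms]] show ?thesis by simp
qed

lemma inv_tendsto:
  assumes "(f \<longlongrightarrow> a) F"
  shows "((\<lambda>x. inv (f x)) \<longlongrightarrow> inv a) F"
proof -
  have "isCont (\<lambda>g. inv g) a"
    using smooth_inv unfolding smooth_map_def by (simp add: continuous_on_eq_continuous_at)
  from isCont_tendsto_compose[OF this assms] show ?thesis by simp
qed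

text \<open>Smoothness for the product atlas involves \<open>inv_into\<close> of a product map; on
  \<open>S\<close> this agrees with the pair of the separate inverses, which is the form usable for
  partial derivatives.\<close>

lemma smooth_mult_charts:
  assumes c: "(U, \<phi>) \<in> A" "(V, \<xi>) \<in> A" "(W, \<omega>) \<in> A"
  defines "S \<equiv> {z. fst z \<in> \<phi> ` U \<and> snd z \<in> \<xi> ` V \<and> inv_into U \<phi> (fst z) \<otimes> inv_into V \<xi> (snd z) \<in> W}"
  shows "open S" "smooth_on (\<lambda>z. \<omega> (inv_into U \<phi> (fst z) \<otimes> inv_into V \<xi> (snd z))) S"
proof -
  have "continuous_on (\<phi> ` U \<times> \<xi> ` V) (\<lambda>z. inv_into U \<phi> (fst z) \<otimes> inv_into V \<xi> (snd z))"
    unfolding continuous_on_def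
  proof
    fix z assume z: "z \<in> \<phi> ` U \<times> \<xi> ` V"
    show "((\<lambda>z. inv_into U \<phi> (fst z) \<otimes> inv_into V \<xi> (snd z)) \<longlongrightarrow>
        inv_into U \<phi> (fst z) \<otimes> inv_into V \<xi> (snd z)) (at z within \<phi> ` U \<times> \<xi> ` V)"
      using z by (intro mult_tendsto param_tendsto c tendsto_intros) auto
  qed
  then have "open ((\<lambda>z. inv_into U \<phi> (fst z) \<otimes> inv_into V \<xi> (snd z)) -` W \<inter> (\<phi> ` U \<times> \<xi> ` V))"
    using chart_props c by (simp add: continuous_on_open_vimage open_Times)
  moreover have "(\<lambda>z. inv_into U \<phi> (fst z) \<otimes> inv_into V \<xi> (snd z)) -` W \<inter> (\<phi> ` U \<times> \<xi> ` V) = S"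
    by (auto simp: S_def)
  ultimately show S: "open S" by simp
  have inj: "inj_on (map_prod \<phi> \<xi>) (U \<times> V)"
    using map_prod_inj_on chart_props(5) c by blast
  have im: "inv_into (U \<times> V) (map_prod \<phi> \<xi>) z = (inv_into U \<phi> (fst z), inv_into V \<xi> (snd z))"
    if "z \<in> S" for z
    by (rule inv_into_f_eq[OF inj]) (use that c in \<open>auto simp: S_def\<close>)
  have eq: "map_prod \<phi> \<xi> ` (UNIV \<inter> (U \<times> V) \<inter> (\<lambda>(g, h). g \<otimes> h) -` W) = S"
  proof
    show "map_prod \<phi> \<xi> ` (UNIV \<inter> (U \<times> V) \<inter> (\<lambda>(g, h). g \<otimes> h) -` W) \<subseteq> S"
      using c by (auto simp: S_def)
    show "S \<subseteq> map_prod \<phi> \<xi> ` (UNIV \<inter> (U \<times> V) \<inter> (\<lambda>(g, h). g \<otimes> h) -` W)"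
    proof
      fix z assume z: "z \<in> S"
      then have "z = map_prod \<phi> \<xi> (inv_into U \<phi> (fst z), inv_into V \<xi> (snd z))"
        using c by (cases z) (auto simp: S_def)
      then show "z \<in> map_prod \<phi> \<xi> ` (UNIV \<inter> (U \<times> V) \<inter> (\<lambda>(g, h). g \<otimes> h) -` W)"
        using z c by (intro image_eqI[of z _ "(inv_into U \<phi> (fst z), inv_into V \<xi> (snd z))"]) (auto simp: S_def)
    qed
  qed
  have "(U \<times> V, map_prod \<phi> \<xi>) \<in> prod_atlas A A"
    unfolding prod_atlas_def using c by (intro image_eqI[of _ _ "((U, \<phi>), (V, \<xi>))"]) auto
  then have "smooth_on (\<omega> \<circ> (\<lambda>(g, h). g \<otimes> h) \<circ> inv_into (U \<times> V) (map_prod \<phi> \<xi>)) S"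
    using smooth_mult c(3) unfolding smooth_map_def eq[symmetric] by blast
  then show "smooth_on (\<lambda>z. \<omega> (inv_into U \<phi> (fst z) \<otimes> inv_into V \<xi> (snd z))) S"
    by (rule smooth_on_cong[OF S, rotated]) (simp add: im)
qed

lemma left_mult_differentiable:
  assumes c: "(V, \<xi>) \<in> A" "(W, \<omega>) \<in> A" and b: "b \<in> V" "a \<otimes> b \<in> W"
  shows "(\<lambda>y. \<omega> (a \<otimes> inv_into V \<xi> y)) differentiable (at (\<xi> b))"
proof -
  obtain U \<phi> where U: "(U, \<phi>) \<in> A" "a \<in> U" using chart_at_in by (metis prod.collapse)
  have z: "(\<lambda>z. \<omega> (inv_into U \<phi> (fst z) \<otimes> inv_into V \<xi> (snd z))) differentiable (at (\<phi> a, \<xi> b))"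
    unfolding differentiable_def
    by (rule exI, rule smooth_on_has_derivative[OF smooth_mult_charts(2)[OF U(1) c]])
       (use U c b in auto)
  have "(\<lambda>y. (\<phi> a, y)) differentiable (at (\<xi> b))"
    unfolding differentiable_def by (rule exI) (auto intro!: derivative_eq_intros)
  from differentiable_chain_at[OF this z] show ?thesis using U by (simp add: o_def)
qed

lemma right_mult_differentiable:
  assumes c: "(V, \<xi>) \<in> A" "(W, \<omega>) \<in> A" and b: "b \<in> V" "b \<otimes> a \<in> W"
  shows "(\<lambda>y. \<omega> (inv_into V \<xi> y \<otimes> a)) differentiable (at (\<xi> b))"
proof -
  obtain U \<phi> where U: "(U, \<phi>) \<in> A" "a \<in> U" using chart_at_in by (metis prod.collapse)
  have z: "(\<lambda>z. \<omega> (inv_into V \<xi> (fst z) \<otimes> inv_into U \<phi> (snd z))) differentiable (at (\<xi> b, \<phi> a))"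
    unfolding differentiable_def
    by (rule exI, rule smooth_on_has_derivative[OF smooth_mult_charts(2)[OF c(1) U(1) c(2)]])
       (use U c b in auto)
  have "(\<lambda>y. (y, \<phi> a)) differentiable (at (\<xi> b))"
    unfolding differentiable_def by (rule exI) (auto intro!: derivative_eq_intros)
  from differentiable_chain_at[OF this z] show ?thesis using U by (simp add: o_def)
qed

section \<open>Multiplication and inversion in the chart at the identity\<close>

definition unit_nbhd where "unit_nbhd = fst (chart_at A \<one>)"
definition lcoord where "lcoord = snd (chart_at A \<one>)"
definition lparam where "lparam = inv_into unit_nbhd lcoord"
text \<open>The chart need not send \<open>\<one>\<close> to 0, so this is the base point of all
  expansions.\<close>

abbreviation origin where "origin \<equiv> lcoord \<one>"
definition lmult where "lmult z = lcoord (lparam (fst z) \<otimes> lparam (snd z))"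
definition lmult_dom where
  "lmult_dom = {z. fst z \<in> lcoord ` unit_nbhd \<and> snd z \<in> lcoord ` unit_nbhd \<and>
     lparam (fst z) \<otimes> lparam (snd z) \<in> unit_nbhd}"
definition linverse where "linverse x = lcoord (inv (lparam x))"
definition lmult1 where "lmult1 z v = frechet_derivative lmult (at z) (v, 0)"
definition lmult2 where "lmult2 z v = frechet_derivative lmult (at z) (0, v)"

lemma unit_chart: "(unit_nbhd, lcoord) \<in> A"
  using chart_at_in[of \<one>] by (simp add: unit_nbhd_def lcoord_def)

lemma one_unit_nbhd [simp]: "\<one> \<in> unit_nbhd"
  using chart_at_in[of \<one>] by (simp add: unit_nbhd_def)

lemma open_unit_nbhd: "open unit_nbhd" and open_lcoord_image: "open (lcoord ` unit_nbhd)"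
  using chart_props[OF unit_chart] by auto

lemma lparam_simps [simp]:
  "p \<in> unit_nbhd \<Longrightarrow> lparam (lcoord p) = p" "x \<in> lcoord ` unit_nbhd \<Longrightarrow> lcoord (lparam x) = x"
  "x \<in> lcoord ` unit_nbhd \<Longrightarrow> lparam x \<in> unit_nbhd"
  unfolding lparam_def using chart_inverse[OF unit_chart] by auto

lemma lcoord_tendsto: "p \<in> unit_nbhd \<Longrightarrow> (f \<longlongrightarrow> p) F \<Longrightarrow> ((\<lambda>x. lcoord (f x)) \<longlongrightarrow> lcoord p) F"
  by (rule chart_tendsto[OF unit_chart])

lemma lparam_tendsto:
  "x \<in> lcoord ` unit_nbhd \<Longrightarrow> (f \<longlongrightarrow> x) F \<Longrightarrow> ((\<lambda>y. lparam (f y)) \<longlongrightarrow> lparam x) F"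
  unfolding lparam_def by (rule param_tendsto[OF unit_chart])

lemma eventually_unit_nbhd: "p \<in> unit_nbhd \<Longrightarrow> (f \<longlongrightarrow> p) F \<Longrightarrow> \<forall>\<^sub>F x in F. f x \<in> unit_nbhd"
  by (rule topological_tendstoD[OF _ open_unit_nbhd])

lemma open_lmult_dom: "open lmult_dom" and lmult_smooth: "smooth_on lmult lmult_dom"
  using smooth_mult_charts[OF unit_chart unit_chart unit_chart]
  by (simp_all add: lmult_dom_def lmult_def[abs_def] lparam_def)

lemma lmult_dom_unit [simp]:
  "x \<in> lcoord ` unit_nbhd \<Longrightarrow> (x, origin) \<in> lmult_dom" "x \<in> lcoord ` unit_nbhd \<Longrightarrow> (origin, x) \<in> lmult_dom"
  by (auto simp: lmult_dom_def)

lemma lmult_has_derivative: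
  assumes "z \<in> lmult_dom"
  shows "(lmult has_derivative (\<lambda>w. lmult1 z (fst w) + lmult2 z (snd w))) (at z)"
proof -
  have d: "(lmult has_derivative frechet_derivative lmult (at z)) (at z)"
    by (rule smooth_on_has_derivative[OF lmult_smooth assms])
  have "lmult1 z (fst w) + lmult2 z (snd w) = frechet_derivative lmult (at z) w" for w
    unfolding lmult1_def lmult2_def linear_add[OF has_derivative_linear[OF d], symmetric] by simp
  with d show ?thesis by simp
qed

lemma lmult_compose_has_derivative:
  assumes "(f has_derivative f') (at x within S)" "(g has_derivative g') (at x within S)"
    and "(f x, g x) \<in> lmult_dom"
  shows "((\<lambda>y. lmult (f y, g y)) has_derivative
     (\<lambda>u. lmult1 (f x, g x) (f' u) + lmult2 (f x, g x) (g' u))) (at x within S)"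
  using has_derivative_compose[OF has_derivative_Pair[OF assms(1,2)] lmult_has_derivative[OF assms(3)]]
  by simp

lemma linear_lmult1: "z \<in> lmult_dom \<Longrightarrow> linear (lmult1 z)"
  and linear_lmult2: "z \<in> lmult_dom \<Longrightarrow> linear (lmult2 z)"
proof -
  assume z: "z \<in> lmult_dom"
  have l: "linear (frechet_derivative lmult (at z))"
    using smooth_on_has_derivative[OF lmult_smooth z] by (rule has_derivative_linear)
  have "linear (frechet_derivative lmult (at z) \<circ> (\<lambda>v. (v, 0)))"
    by (rule linear_compose[OF _ l]) (auto intro!: linearI)
  then show "linear (lmult1 z)" by (simp add: o_def lmult1_def[abs_def])
  have "linear (frechet_derivative lmult (at z) \<circ> (\<lambda>v. (0, v)))"
    by (rule linear_compose[OF _ l]) (auto intro!: linearI)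
  then show "linear (lmult2 z)" by (simp add: o_def lmult2_def[abs_def])
qed

lemma lmult2_origin_left [simp]:
  assumes y: "y \<in> lcoord ` unit_nbhd"
  shows "lmult2 (origin, y) v = v"
proof -
  have "((\<lambda>y. lmult (origin, y)) has_derivative (\<lambda>u. lmult1 (origin, y) 0 + lmult2 (origin, y) u)) (at y)"
    using y by (intro lmult_compose_has_derivative) (auto intro!: derivative_eq_intros)
  moreover have "((\<lambda>y. lmult (origin, y)) has_derivative (\<lambda>u. u)) (at y)"
    by (rule has_derivative_transform_within_open[OF has_derivative_ident open_lcoord_image y])
       (simp add: lmult_def)
  ultimately have "(\<lambda>u. lmult1 (origin, y) 0 + lmult2 (origin, y) u) = (\<lambda>u. u)"
    by (rule has_derivative_unique)
  then show ?thesis using linear_0[OF linear_lmult1, of "(origin, y)"] y by (simp add: fun_eq_iff)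
qed

lemma lmult1_origin_right [simp]:
  assumes y: "y \<in> lcoord ` unit_nbhd"
  shows "lmult1 (y, origin) v = v"
proof -
  have "((\<lambda>y. lmult (y, origin)) has_derivative (\<lambda>u. lmult1 (y, origin) u + lmult2 (y, origin) 0)) (at y)"
    using y by (intro lmult_compose_has_derivative) (auto intro!: derivative_eq_intros)
  moreover have "((\<lambda>y. lmult (y, origin)) has_derivative (\<lambda>u. u)) (at y)"
    by (rule has_derivative_transform_within_open[OF has_derivative_ident open_lcoord_image y])
       (simp add: lmult_def)
  ultimately have "(\<lambda>u. lmult1 (y, origin) u + lmult2 (y, origin) 0) = (\<lambda>u. u)"
    by (rule has_derivative_unique)
  then show ?thesis using linear_0[OF linear_lmult2, of "(y, origin)"] y by (simp add: fun_eq_iff)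
qed

text \<open>The neighbourhood of \<open>origin\<close> on which the adjoint action and the
  Maurer-Cartan form get explicit coordinate formulas.\<close>

definition linverse_dom where
  "linverse_dom = {x \<in> lcoord ` unit_nbhd. inv (lparam x) \<in> unit_nbhd}"

lemma open_linverse_dom: "open linverse_dom"
proof -
  have "continuous_on (lcoord ` unit_nbhd) (\<lambda>x. inv (lparam x))"
    unfolding continuous_on_def by (auto intro!: inv_tendsto lparam_tendsto simp del: lparam_simps)
  then have "open ((\<lambda>x. inv (lparam x)) -` unit_nbhd \<inter> lcoord ` unit_nbhd)"
    using open_unit_nbhd open_lcoord_image continuous_on_open_vimage by blast
  moreover have "(\<lambda>x. inv (lparam x)) -` unit_nbhd \<inter> lcoord ` unit_nbhd = linverse_dom"
    by (auto simp: linverse_dom_def)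
  ultimately show ?thesis by simp
qed

lemma origin_linverse_dom [simp]: "origin \<in> linverse_dom"
  by (auto simp: linverse_dom_def)

lemma linverse_simps [simp]:
  assumes "x \<in> linverse_dom"
  shows "x \<in> lcoord ` unit_nbhd" "linverse x \<in> lcoord ` unit_nbhd"
    "lparam (linverse x) = inv (lparam x)" "(x, linverse x) \<in> lmult_dom" "(linverse x, x) \<in> lmult_dom"
    "lmult (x, linverse x) = origin"
  using assms by (auto simp: linverse_dom_def linverse_def lmult_dom_def lmult_def)

lemma linverse_origin [simp]: "linverse origin = origin"
  by (simp add: linverse_def)

lemma linverse_continuous: "continuous_on linverse_dom linverse"
  unfolding continuous_on_def
proof
  fix x assume x: "x \<in> linverse_dom"
  have "((\<lambda>y. inv (lparam y)) \<longlongrightarrow> inv (lparam x)) (at x within linverse_dom)"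
    using x by (intro inv_tendsto lparam_tendsto tendsto_ident_at) simp
  moreover have "inv (lparam x) \<in> unit_nbhd" using x unfolding linverse_dom_def by blast
  ultimately show "(linverse \<longlongrightarrow> linverse x) (at x within linverse_dom)"
    unfolding linverse_def by (rule lcoord_tendsto[rotated])
qed

text \<open>Differentiate \<open>lmult (x, linverse x) = origin\<close>, both partial derivatives of
  the multiplication being the identity at the origin. Smoothness of inversion supplies the
  existence of \<open>D\<close>.\<close>

lemma linverse_has_derivative: "(linverse has_derivative (\<lambda>u. - u)) (at origin)"
proof -
  have "smooth_on (lcoord \<circ> (\<lambda>g. inv g) \<circ> lparam) (lcoord ` (UNIV \<inter> unit_nbhd \<inter> (\<lambda>g. inv g) -` unit_nbhd))"
    using smooth_inv unit_chart unfolding smooth_map_def lparam_def by blast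
  moreover have "origin \<in> lcoord ` (UNIV \<inter> unit_nbhd \<inter> (\<lambda>g. inv g) -` unit_nbhd)" by auto
  ultimately obtain D where D: "(linverse has_derivative D) (at origin)"
    using smooth_on_has_derivative unfolding o_def linverse_def[abs_def] by blast
  have "((\<lambda>x. lmult (x, linverse x)) has_derivative
      (\<lambda>u. lmult1 (origin, linverse origin) u + lmult2 (origin, linverse origin) (D u))) (at origin)"
    by (rule lmult_compose_has_derivative[OF _ D]) auto
  then have "((\<lambda>x. lmult (x, linverse x)) has_derivative (\<lambda>u. u + D u)) (at origin)" by simp
  moreover have "((\<lambda>x. lmult (x, linverse x)) has_derivative (\<lambda>u. 0)) (at origin)"
    by (rule has_derivative_transform_within_open[OF has_derivative_const open_linverse_dom]) auto
  ultimately have "(\<lambda>u. u + D u) = (\<lambda>u. 0)" by (rule has_derivative_unique)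
  then have "D u = - u" for u by (simp add: fun_eq_iff add_eq_0_iff)
  then have "D = (\<lambda>u. - u)" by (simp add: fun_eq_iff)
  with D show ?thesis by simp
qed

text \<open>The derivative of \<open>s\<close> at \<open>x\<close>, moved to the tangent space at \<open>\<one>\<close> by left translation.\<close>

definition left_deriv :: "('x::real_normed_vector \<Rightarrow> 'g) \<Rightarrow> ('x \<Rightarrow> 'e) \<Rightarrow> 'x \<Rightarrow> 'x set \<Rightarrow> bool" where
  "left_deriv s L x S \<longleftrightarrow>
     (s \<longlongrightarrow> s x) (at x within S) \<and> ((\<lambda>y. lcoord (inv (s x) \<otimes> s y)) has_derivative L) (at x within S)"

lemma left_deriv_translate: "left_deriv s L x S \<Longrightarrow> left_deriv (\<lambda>y. g \<otimes> s y) L x S"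
  unfolding left_deriv_def by (simp add: inv_mult_group m_assoc mult_tendsto)

lemma left_deriv_shift_tendsto:
  "left_deriv s L x S \<Longrightarrow> ((\<lambda>y. inv h \<otimes> s y) \<longlongrightarrow> inv h \<otimes> s x) (at x within S)"
  unfolding left_deriv_def by (simp add: mult_tendsto)

text \<open>Changes the reference point from \<open>s x\<close> to a nearby \<open>h\<close>. Left
  translation by \<open>inv h \<otimes> s x\<close>, with coordinate \<open>b\<close>, contributes
  the partial derivative of the multiplication at \<open>(b, origin)\<close>.\<close>

lemma left_deriv_lcoord:
  assumes s: "left_deriv s L x S" and x: "x \<in> S" and b: "inv h \<otimes> s x \<in> unit_nbhd"
  shows "((\<lambda>y. lcoord (inv h \<otimes> s y)) has_derivative
    (\<lambda>u. lmult2 (lcoord (inv h \<otimes> s x), origin) (L u))) (at x within S)"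
proof -
  let ?b = "lcoord (inv h \<otimes> s x)"
  have "((\<lambda>y. lmult (?b, lcoord (inv (s x) \<otimes> s y))) has_derivative
      (\<lambda>u. lmult1 (?b, lcoord (inv (s x) \<otimes> s x)) 0 + lmult2 (?b, lcoord (inv (s x) \<otimes> s x)) (L u))) (at x within S)"
    using s b unfolding left_deriv_def by (intro lmult_compose_has_derivative) auto
  then have "((\<lambda>y. lmult (?b, lcoord (inv (s x) \<otimes> s y))) has_derivative
      (\<lambda>u. lmult2 (?b, origin) (L u))) (at x within S)"
    using linear_0[OF linear_lmult1, of "(?b, origin)"] b by simp
  then show ?thesis
  proof (rule has_derivative_transform_eventually[OF _ _ _ x])
    have "((\<lambda>y. inv (s x) \<otimes> s y) \<longlongrightarrow> \<one>) (at x within S)"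
      using left_deriv_shift_tendsto[OF s, of "s x"] by simp
    then have "\<forall>\<^sub>F y in at x within S. inv (s x) \<otimes> s y \<in> unit_nbhd"
      by (rule eventually_unit_nbhd[rotated]) simp
    then show "\<forall>\<^sub>F y in at x within S. lmult (?b, lcoord (inv (s x) \<otimes> s y)) = lcoord (inv h \<otimes> s y)"
      by eventually_elim (use b in \<open>simp add: lmult_def m_assoc\<close>)
    show "lmult (?b, lcoord (inv (s x) \<otimes> s x)) = ?b"
      using b by (simp add: lmult_def)
  qed
qed

section \<open>The adjoint representation\<close>

lemma conj_op_one [simp]: "conj_op G g \<one> = \<one>"
  by (simp add: conj_op_def)

text \<open>For \<open>g\<close> far from \<open>\<one>\<close> the product
  \<open>g \<otimes> lparam x\<close> leaves the unit chart. Conjugation is therefore factored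
  through a chart around \<open>g\<close>: left multiplication into it, right multiplication by
  \<open>inv g\<close> back.\<close>

lemma Ad_has_derivative: "((\<lambda>x. lcoord (g \<otimes> lparam x \<otimes> inv g)) has_derivative Ad G A g) (at origin)"
proof -
  obtain V \<xi> where V: "(V, \<xi>) \<in> A" "g \<in> V" using chart_at_in by (metis prod.collapse)
  have "(\<lambda>y. \<xi> (g \<otimes> inv_into unit_nbhd lcoord y)) differentiable (at origin)"
    by (rule left_mult_differentiable[OF unit_chart V(1)]) (use V in auto)
  then have l: "(\<lambda>y. \<xi> (g \<otimes> lparam y)) differentiable (at origin)" by (simp add: lparam_def)
  have r: "(\<lambda>y. lcoord (inv_into V \<xi> y \<otimes> inv g)) differentiable (at (\<xi> g))"
    by (rule right_mult_differentiable[OF V(1) unit_chart V(2)]) simp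
  have "((\<lambda>y. lcoord (inv_into V \<xi> y \<otimes> inv g)) \<circ> (\<lambda>y. \<xi> (g \<otimes> lparam y))) differentiable (at origin)"
    by (rule differentiable_chain_at[OF l]) (use r in simp)
  then obtain D where D: "((\<lambda>y. lcoord (inv_into V \<xi> (\<xi> (g \<otimes> lparam y)) \<otimes> inv g)) has_derivative D) (at origin)"
    by (auto simp: differentiable_def o_def)
  have "((\<lambda>y. g \<otimes> lparam y) \<longlongrightarrow> g \<otimes> lparam origin) (at origin)"
    by (intro mult_tendsto lparam_tendsto tendsto_intros) auto
  then have "\<forall>\<^sub>F y in at origin. g \<otimes> lparam y \<in> V"
    using topological_tendstoD[of "\<lambda>y. g \<otimes> lparam y" g] chart_props(1)[OF V(1)] V(2) by simp
  then have "\<forall>\<^sub>F y in at origin. lcoord (inv_into V \<xi> (\<xi> (g \<otimes> lparam y)) \<otimes> inv g) = lcoord (g \<otimes> lparam y \<otimes> inv g)"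
    by eventually_elim (use V in simp)
  from has_derivative_transform_eventually[OF D this]
  have "((\<lambda>x. lcoord (g \<otimes> lparam x \<otimes> inv g)) has_derivative D) (at origin)" using V by simp
  moreover have "Ad G A g = frechet_derivative (\<lambda>x. lcoord (g \<otimes> lparam x \<otimes> inv g)) (at origin)"
    unfolding Ad_def tangent_map_eq conj_op_one unfolding conj_op_def lparam_def unit_nbhd_def lcoord_def ..
  ultimately show ?thesis using frechet_derivative_at[of "\<lambda>x. lcoord (g \<otimes> lparam x \<otimes> inv g)" D] by simp
qed

lemma conj_has_derivative:
  assumes t: "(z \<longlongrightarrow> \<one>) (at x within S)" and z: "z x = \<one>" and x: "x \<in> S"
    and L: "((\<lambda>y. lcoord (z y)) has_derivative L) (at x within S)"
  shows "((\<lambda>y. lcoord (g \<otimes> z y \<otimes> inv g)) has_derivative (\<lambda>u. Ad G A g (L u))) (at x within S)"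
proof -
  have "((\<lambda>y. lcoord (g \<otimes> lparam (lcoord (z y)) \<otimes> inv g)) has_derivative (\<lambda>u. Ad G A g (L u))) (at x within S)"
    by (rule has_derivative_compose[OF L, of "\<lambda>x. lcoord (g \<otimes> lparam x \<otimes> inv g)"])
       (simp add: z Ad_has_derivative)
  then show ?thesis
  proof (rule has_derivative_transform_eventually[OF _ _ _ x])
    have "\<forall>\<^sub>F y in at x within S. z y \<in> unit_nbhd" by (rule eventually_unit_nbhd[OF _ t]) simp
    then show "\<forall>\<^sub>F y in at x within S. lcoord (g \<otimes> lparam (lcoord (z y)) \<otimes> inv g) = lcoord (g \<otimes> z y \<otimes> inv g)"
      by eventually_elim simp
  qed (simp add: z)
qed

lemma linear_Ad: "linear (Ad G A g)"
  using Ad_has_derivative has_derivative_linear by blast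

lemma lcoord_lparam_has_derivative: "((\<lambda>x. lcoord (lparam x)) has_derivative (\<lambda>u. u)) (at origin)"
  by (rule has_derivative_transform_within_open[OF has_derivative_ident open_lcoord_image]) simp_all

lemma Ad_one: "Ad G A \<one> = id"
proof -
  have "((\<lambda>x. lcoord (lparam x)) has_derivative Ad G A \<one>) (at origin)"
    using Ad_has_derivative[of \<one>] by simp
  then have "Ad G A \<one> = (\<lambda>u. u)" using lcoord_lparam_has_derivative by (rule has_derivative_unique)
  then show ?thesis by (simp add: id_def)
qed

lemma Ad_mult: "Ad G A (g \<otimes> h) v = Ad G A g (Ad G A h v)"
proof -
  have "((\<lambda>x. lcoord (g \<otimes> (h \<otimes> lparam x \<otimes> inv h) \<otimes> inv g)) has_derivative (\<lambda>u. Ad G A g (Ad G A h u))) (at origin)"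
  proof (rule conj_has_derivative[OF _ _ _ Ad_has_derivative])
    have "((\<lambda>x. h \<otimes> lparam x \<otimes> inv h) \<longlongrightarrow> h \<otimes> lparam origin \<otimes> inv h) (at origin)"
      by (intro mult_tendsto lparam_tendsto tendsto_intros) auto
    then show "((\<lambda>x. h \<otimes> lparam x \<otimes> inv h) \<longlongrightarrow> \<one>) (at origin)" by simp
  qed auto
  then have "((\<lambda>x. lcoord (g \<otimes> h \<otimes> lparam x \<otimes> inv (g \<otimes> h))) has_derivative
      (\<lambda>u. Ad G A g (Ad G A h u))) (at origin)"
    by (simp add: inv_mult_group m_assoc)
  from has_derivative_unique[OF Ad_has_derivative this] show ?thesis by (simp add: fun_eq_iff)
qed

lemma Ad_inverse [simp]: "Ad G A (inv g) (Ad G A g v) = v" "Ad G A g (Ad G A (inv g) v) = v"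
  by (simp_all add: Ad_mult[symmetric] Ad_one)

section \<open>Second derivatives of the multiplication and the Lie bracket\<close>

definition lmult_second where
  "lmult_second z p q = frechet_derivative (\<lambda>z. frechet_derivative lmult (at z) q) (at z) p"

lemma lmult1_has_derivative:
  "z \<in> lmult_dom \<Longrightarrow> ((\<lambda>z. lmult1 z v) has_derivative (\<lambda>p. lmult_second z p (v, 0))) (at z)"
  and lmult2_has_derivative:
  "z \<in> lmult_dom \<Longrightarrow> ((\<lambda>z. lmult2 z v) has_derivative (\<lambda>p. lmult_second z p (0, v))) (at z)"
  unfolding lmult1_def lmult2_def lmult_second_def
  by (auto intro!: smooth_on_has_derivative[where S = lmult_dom] smooth_on_frechet_derivative lmult_smooth)

lemma lmult_second_sym: "z \<in> lmult_dom \<Longrightarrow> lmult_second z p q = lmult_second z q p"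
  unfolding lmult_second_def
  by (rule smooth_on_second_derivative_symmetric[OF lmult_smooth open_lmult_dom])

lemma continuous_on_lmult_second: "continuous_on lmult_dom (\<lambda>z. lmult_second z p q)"
  unfolding lmult_second_def
  by (intro smooth_on_continuous_on smooth_on_frechet_derivative lmult_smooth)

lemma continuous_on_lmult2: "continuous_on lmult_dom (\<lambda>z. lmult2 z v)"
  unfolding lmult2_def
  by (intro smooth_on_continuous_on smooth_on_frechet_derivative lmult_smooth)

lemma linear_lmult_second: "z \<in> lmult_dom \<Longrightarrow> linear (\<lambda>p. lmult_second z p q)"
  unfolding lmult_second_def
  by (rule has_derivative_linear, rule smooth_on_has_derivative[where S = lmult_dom])
     (auto intro!: smooth_on_frechet_derivative lmult_smooth)

text \<open>Both \<open>lmult1 (x, origin)\<close> and \<open>lmult2 (origin, x)\<close> are the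
  identity for all \<open>x\<close> in the chart, so they do not vary. What survives is the mixed
  part \<open>B u v = lmult_second (origin, origin) (u, 0) (0, v)\<close>.\<close>

lemma lmult_second_pure [simp]:
  "lmult_second (origin, origin) (u, 0) (v, 0) = 0"
  "lmult_second (origin, origin) (0, u) (0, v) = 0"
proof -
  have o: "origin \<in> lcoord ` unit_nbhd" by simp
  have "((\<lambda>x. lmult1 (x, origin) v) has_derivative (\<lambda>u. lmult_second (origin, origin) (u, 0) (v, 0))) (at origin)"
    by (rule has_derivative_compose[of "\<lambda>x. (x, origin)" "\<lambda>u. (u, 0)" _ _ "\<lambda>z. lmult1 z v"])
       (auto intro!: derivative_eq_intros lmult1_has_derivative)
  moreover have "((\<lambda>x. lmult1 (x, origin) v) has_derivative (\<lambda>u. 0)) (at origin)"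
    by (rule has_derivative_transform_within_open[OF has_derivative_const open_lcoord_image o]) simp
  ultimately have "(\<lambda>u. lmult_second (origin, origin) (u, 0) (v, 0)) = (\<lambda>u. 0)"
    by (rule has_derivative_unique)
  then show "lmult_second (origin, origin) (u, 0) (v, 0) = 0" by (rule fun_cong)
  have "((\<lambda>x. lmult2 (origin, x) v) has_derivative (\<lambda>u. lmult_second (origin, origin) (0, u) (0, v))) (at origin)"
    by (rule has_derivative_compose[of "\<lambda>x. (origin, x)" "\<lambda>u. (0, u)" _ _ "\<lambda>z. lmult2 z v"])
       (auto intro!: derivative_eq_intros lmult2_has_derivative)
  moreover have "((\<lambda>x. lmult2 (origin, x) v) has_derivative (\<lambda>u. 0)) (at origin)"
    by (rule has_derivative_transform_within_open[OF has_derivative_const open_lcoord_image o]) simp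
  ultimately have "(\<lambda>u. lmult_second (origin, origin) (0, u) (0, v)) = (\<lambda>u. 0)"
    by (rule has_derivative_unique)
  then show "lmult_second (origin, origin) (0, u) (0, v) = 0" by (rule fun_cong)
qed

lemma lmult_second_split:
  "lmult_second (origin, origin) (u, u') (v, 0) = lmult_second (origin, origin) (0, u') (v, 0)"
  "lmult_second (origin, origin) (u, u') (0, v) = lmult_second (origin, origin) (u, 0) (0, v)"
proof -
  have o: "(origin, origin) \<in> lmult_dom" by simp
  have e: "(u, u') = (u, 0) + (0, u')" by simp
  show "lmult_second (origin, origin) (u, u') (v, 0) = lmult_second (origin, origin) (0, u') (v, 0)"
    "lmult_second (origin, origin) (u, u') (0, v) = lmult_second (origin, origin) (u, 0) (0, v)"
    unfolding e linear_add[OF linear_lmult_second[OF o]] by simp_all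
qed

text \<open>Near the identity, conjugation is \<open>y \<mapsto> (x y) x^-1\<close> inside the
  chart. The chain rule gives a formula that can in turn be differentiated in
  \<open>x\<close>.\<close>

lemma Ad_lparam:
  assumes x: "x \<in> linverse_dom"
  shows "Ad G A (lparam x) v = lmult1 (x, linverse x) (lmult2 (x, origin) v)"
proof -
  have xU: "x \<in> lcoord ` unit_nbhd" and l: "lmult (x, origin) = x" using x by (simp_all add: lmult_def)
  have 1: "((\<lambda>y. lmult (x, y)) has_derivative (\<lambda>u. lmult1 (x, origin) 0 + lmult2 (x, origin) u)) (at origin)"
    using xU by (intro lmult_compose_has_derivative) (auto intro!: derivative_eq_intros)
  have "((\<lambda>y. lmult (lmult (x, y), linverse x)) has_derivative
     (\<lambda>u. lmult1 (lmult (x, origin), linverse x) (lmult1 (x, origin) 0 + lmult2 (x, origin) u) +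
        lmult2 (lmult (x, origin), linverse x) 0)) (at origin)"
    by (rule lmult_compose_has_derivative[OF 1]) (use x l in \<open>auto intro!: derivative_eq_intros\<close>)
  then have "((\<lambda>y. lmult (lmult (x, y), linverse x)) has_derivative
     (\<lambda>u. lmult1 (x, linverse x) (lmult2 (x, origin) u))) (at origin)"
    using linear_0[OF linear_lmult2, of "(x, linverse x)"] linear_0[OF linear_lmult1, of "(x, origin)"] x xU
    by (simp add: l)
  moreover have "\<forall>\<^sub>F y in at origin.
      lmult (lmult (x, y), linverse x) = lcoord (lparam x \<otimes> lparam y \<otimes> inv (lparam x))"
  proof -
    have "((\<lambda>y. lparam x \<otimes> lparam y) \<longlongrightarrow> lparam x \<otimes> lparam origin) (at origin)"
      by (intro mult_tendsto lparam_tendsto tendsto_intros) auto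
    then have "\<forall>\<^sub>F y in at origin. lparam x \<otimes> lparam y \<in> unit_nbhd"
      by (rule eventually_unit_nbhd[rotated]) (use xU in simp)
    then show ?thesis
      by eventually_elim (simp add: lmult_def[of "(x, _)"] lmult_def[of "(_, linverse x)"] x)
  qed
  ultimately have "((\<lambda>y. lcoord (lparam x \<otimes> lparam y \<otimes> inv (lparam x))) has_derivative
     (\<lambda>u. lmult1 (x, linverse x) (lmult2 (x, origin) u))) (at origin)"
    by (rule has_derivative_transform_eventually) (use x l in \<open>simp_all\<close>)
  from has_derivative_unique[OF Ad_has_derivative this] show ?thesis by (simp add: fun_eq_iff)
qed

text \<open>The pair \<open>(x, linverse x)\<close> moves in direction \<open>(u, - u)\<close>, of
  which the derivative of \<open>lmult1\<close> feels only the second component; symmetry turns this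
  into the negative term. With the mixed part \<open>B\<close>, the result is the classical
  \<open>[u, v] = B u v - B v u\<close>.\<close>

lemma Ad_lparam_has_derivative:
  "((\<lambda>x. Ad G A (lparam x) v) has_derivative
     (\<lambda>u. lmult_second (origin, origin) (u, 0) (0, v) - lmult_second (origin, origin) (v, 0) (0, u))) (at origin)"
proof -
  have "((\<lambda>x. lmult1 (x, linverse x) (lmult2 (x, origin) v)) has_derivative
     (\<lambda>u. lmult_second (origin, origin) (u, - u) (lmult2 (origin, origin) v, 0)
        + lmult1 (origin, linverse origin) (lmult_second (origin, origin) (u, 0) (0, v)))) (at origin)"
  proof (rule has_derivative_linear_family[where \<theta> = "\<lambda>x. lmult1 (x, linverse x)"
        and \<Theta> = "\<lambda>u w. lmult_second (origin, origin) (u, - u) (w, 0)",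
        OF _ open_linverse_dom origin_linverse_dom])
    show "linear (lmult1 (x, linverse x))" if "x \<in> linverse_dom" for x
      using that by (intro linear_lmult1) simp
    show "((\<lambda>x. lmult1 (x, linverse x) w) has_derivative
        (\<lambda>u. lmult_second (origin, origin) (u, - u) (w, 0))) (at origin)" for w
      by (rule has_derivative_compose[of "\<lambda>x. (x, linverse x)" "\<lambda>u. (u, - u)" _ _ "\<lambda>z. lmult1 z w"])
         (auto intro!: has_derivative_Pair linverse_has_derivative lmult1_has_derivative)
    show "((\<lambda>x. lmult2 (x, origin) v) has_derivative (\<lambda>u. lmult_second (origin, origin) (u, 0) (0, v))) (at origin)"
      by (rule has_derivative_compose[of "\<lambda>x. (x, origin)" "\<lambda>u. (u, 0)" _ _ "\<lambda>z. lmult2 z v"])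
         (auto intro!: derivative_eq_intros lmult2_has_derivative)
  qed
  moreover have "lmult_second (origin, origin) (u, - u) (v, 0) = - lmult_second (origin, origin) (v, 0) (0, u)" for u
  proof -
    have "lmult_second (origin, origin) (u, - u) (v, 0) = lmult_second (origin, origin) (- (0, u)) (v, 0)"
      by (simp add: lmult_second_split(1)[of u])
    also have "\<dots> = - lmult_second (origin, origin) (0, u) (v, 0)"
      by (rule linear_neg[OF linear_lmult_second]) simp
    finally show ?thesis using lmult_second_sym[of "(origin, origin)" "(0, u)" "(v, 0)"] by simp
  qed
  ultimately have "((\<lambda>x. lmult1 (x, linverse x) (lmult2 (x, origin) v)) has_derivative
     (\<lambda>u. lmult_second (origin, origin) (u, 0) (0, v) - lmult_second (origin, origin) (v, 0) (0, u))) (at origin)"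
    by simp
  then show ?thesis
    by (rule has_derivative_transform_within_open[OF _ open_linverse_dom]) (simp_all add: Ad_lparam)
qed

lemma lie_bracket_eq:
  "lie_bracket G A u v =
     lmult_second (origin, origin) (u, 0) (0, v) - lmult_second (origin, origin) (v, 0) (0, u)"
  using frechet_derivative_at[OF Ad_lparam_has_derivative[of v]]
  by (simp add: lie_bracket_def tangent_map_eq fun_eq_iff lparam_def unit_nbhd_def lcoord_def)

lemma Ad_lparam_lie_bracket:
  "((\<lambda>x. Ad G A (lparam x) v) has_derivative (\<lambda>u. lie_bracket G A u v)) (at origin)"
  using Ad_lparam_has_derivative by (simp add: lie_bracket_eq)

lemma linear_lie_bracket: "linear (lie_bracket G A u)" "linear (\<lambda>u. lie_bracket G A u v)"
proof -
  show "linear (lie_bracket G A u)"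
    by (rule linear_derivative_of_linear_family[OF _ open_UNIV UNIV_I Ad_lparam_lie_bracket]) (rule linear_Ad)
  show "linear (\<lambda>u. lie_bracket G A u v)"
    by (rule has_derivative_linear[OF Ad_lparam_lie_bracket])
qed

text \<open>The left Maurer-Cartan form, read in the identity chart.\<close>

definition lmc where "lmc x v = lmult2 (linverse x, x) v"

lemma linear_lmc: "x \<in> linverse_dom \<Longrightarrow> linear (lmc x)"
  unfolding lmc_def using linear_lmult2 by simp

text \<open>Left invariance of the Maurer-Cartan form, from differentiating
  \<open>(a x)^-1 (a y) = x^-1 y\<close> at \<open>y = x\<close>.\<close>

lemma lmc_lmult:
  assumes ax: "(a, x) \<in> lmult_dom" and x: "x \<in> linverse_dom" and lx: "lmult (a, x) \<in> linverse_dom"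
  shows "lmc (lmult (a, x)) (lmult2 (a, x) v) = lmc x v"
proof -
  define b where "b = linverse (lmult (a, x))"
  have aU: "a \<in> lcoord ` unit_nbhd" using ax by (simp add: lmult_dom_def)
  have la: "lparam (lmult (a, y)) = lparam a \<otimes> lparam y" if "(a, y) \<in> lmult_dom" for y
    using that by (simp add: lmult_def lmult_dom_def)
  have "((\<lambda>y. lmult (a, y)) has_derivative (\<lambda>u. lmult1 (a, x) 0 + lmult2 (a, x) u)) (at x)"
    using ax by (intro lmult_compose_has_derivative) (auto intro!: derivative_eq_intros)
  then have "((\<lambda>y. lmult (b, lmult (a, y))) has_derivative
     (\<lambda>u. lmult1 (b, lmult (a, x)) 0 + lmult2 (b, lmult (a, x)) (lmult1 (a, x) 0 + lmult2 (a, x) u))) (at x)"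
    by (rule lmult_compose_has_derivative[OF has_derivative_const]) (use lx in \<open>simp add: b_def\<close>)
  then have 1: "((\<lambda>y. lmult (b, lmult (a, y))) has_derivative (\<lambda>u. lmc (lmult (a, x)) (lmult2 (a, x) u))) (at x)"
    using linear_0[OF linear_lmult1, of "(b, lmult (a, x))"] linear_0[OF linear_lmult1 [OF ax]] lx
    by (simp add: lmc_def b_def)
  have "((\<lambda>y. lmult (linverse x, y)) has_derivative (\<lambda>u. lmult1 (linverse x, x) 0 + lmult2 (linverse x, x) u)) (at x)"
    using x by (intro lmult_compose_has_derivative) (auto intro!: derivative_eq_intros)
  then have 2: "((\<lambda>y. lmult (linverse x, y)) has_derivative lmc x) (at x)"
    using linear_0[OF linear_lmult1, of "(linverse x, x)"] x by (simp add: lmc_def[abs_def])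
  have "((\<lambda>y. (a, y)) \<longlongrightarrow> (a, x)) (at x)" by (intro tendsto_intros)
  from topological_tendstoD[OF this open_lmult_dom ax]
  have "\<forall>\<^sub>F y in at x. lmult (linverse x, y) = lmult (b, lmult (a, y))"
  proof eventually_elim
    case (elim y)
    have "lparam b = inv (lparam a \<otimes> lparam x)" using lx la[OF ax] by (simp add: b_def)
    then show ?case using la[OF elim] x
      by (simp add: lmult_def[of "(b, _)"] lmult_def[of "(linverse x, _)"] inv_mult_group m_assoc)
  qed
  from has_derivative_transform_eventually[OF 2 this]
  have "((\<lambda>y. lmult (b, lmult (a, y))) has_derivative lmc x) (at x)" using x lx by (simp add: b_def lmult_def la ax inv_mult_group m_assoc)
  from has_derivative_unique[OF 1 this] show ?thesis by (rule fun_cong)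
qed

lemma lmc_origin [simp]: "lmc origin v = v"
  by (simp add: lmc_def)

lemma lmc_lmult2: "x \<in> linverse_dom \<Longrightarrow> lmc x (lmult2 (x, origin) v) = v"
  using lmc_lmult[of x origin v] by (simp add: lmult_def)

text \<open>Antisymmetrised in \<open>u\<close> and \<open>v\<close>, this is the Maurer-Cartan
  equation at the identity, with value minus the bracket.\<close>

lemma lmc_has_derivative:
  "((\<lambda>x. lmc x v) has_derivative (\<lambda>u. - lmult_second (origin, origin) (u, 0) (0, v))) (at origin)"
proof -
  have "((\<lambda>x. lmc x v) has_derivative (\<lambda>u. lmult_second (origin, origin) (- u, u) (0, v))) (at origin)"
    unfolding lmc_def
    by (rule has_derivative_compose[of "\<lambda>x. (linverse x, x)" "\<lambda>u. (- u, u)" _ _ "\<lambda>z. lmult2 z v"])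
       (auto intro!: has_derivative_Pair linverse_has_derivative lmult2_has_derivative)
  moreover have "lmult_second (origin, origin) (- u, u) (0, v) = - lmult_second (origin, origin) (u, 0) (0, v)" for u
  proof -
    have "lmult_second (origin, origin) (- u, u) (0, v) = lmult_second (origin, origin) (- (u, 0)) (0, v)"
      by (simp add: lmult_second_split(2)[of "- u" u])
    also have "\<dots> = - lmult_second (origin, origin) (u, 0) (0, v)"
      by (rule linear_neg[OF linear_lmult_second]) simp
    finally show ?thesis .
  qed
  ultimately show ?thesis by simp
qed

lemma continuous_on_lmc: "continuous_on linverse_dom (\<lambda>x. lmc x v)"
  unfolding lmc_def
  by (rule continuous_on_compose2[OF continuous_on_lmult2])
     (auto intro!: continuous_intros linverse_continuous)

lemma left_deriv_lparam:
  assumes x: "x \<in> linverse_dom"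
  shows "left_deriv (\<lambda>y. p \<otimes> lparam y) (lmc x) x UNIV"
proof (rule left_deriv_translate)
  have "((\<lambda>y. lmult (linverse x, y)) has_derivative (\<lambda>u. lmult1 (linverse x, x) 0 + lmult2 (linverse x, x) u)) (at x)"
    using x by (intro lmult_compose_has_derivative) (auto intro!: derivative_eq_intros)
  then have "((\<lambda>y. lmult (linverse x, y)) has_derivative lmc x) (at x)"
    using linear_0[OF linear_lmult1, of "(linverse x, x)"] x by (simp add: lmc_def[abs_def])
  then show "left_deriv lparam (lmc x) x UNIV"
    using x by (simp add: left_deriv_def lmult_def lparam_tendsto)
qed

text \<open>Left translates of one coordinate ball at the identity. They cover the group and will
  carry the translates of a single primitive.\<close>

definition shifted_ball where
  "shifted_ball h r = {p. inv h \<otimes> p \<in> unit_nbhd \<and> lcoord (inv h \<otimes> p) \<in> ball origin r}"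

lemma open_shifted_ball: "open (shifted_ball h r)"
proof -
  have "continuous_on unit_nbhd lcoord" using chart_props[OF unit_chart] by simp
  then have o: "open (lcoord -` ball origin r \<inter> unit_nbhd)"
    using continuous_on_open_vimage[OF open_unit_nbhd] open_ball by blast
  have "continuous_on UNIV (\<lambda>p. inv h \<otimes> p)"
    unfolding continuous_on_def by (intro ballI mult_tendsto tendsto_intros)
  from open_vimage[OF o this] show ?thesis
    by (simp add: shifted_ball_def vimage_def Int_def conj_commute)
qed

lemma shifted_ball_self: "r > 0 \<Longrightarrow> p \<in> shifted_ball p r"
  by (simp add: shifted_ball_def)

end

section \<open>Integration of Lie algebra one-cocycles\<close>

text \<open>The coefficients form a Banach space because they will be the operators
  \<open>'e \<Rightarrow>\<^sub>L 'a\<close>. \<open>d\<pi> \<beta> u\<close> is the infinitesimal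
  action \<open>u.\<beta>\<close>, with the vector first; differentiability is asked at the identity
  only, on each vector separately.\<close>

locale lie_group_one_cocycle = lie_group G A
  for G :: "('g::{t2_space, second_countable_topology}) monoid" (structure)
    and A :: "('g, 'e::euclidean_space) chart set" +
  fixes \<pi> :: "'g \<Rightarrow> 'v::banach \<Rightarrow> 'v" and d\<pi> :: "'v \<Rightarrow> 'e \<Rightarrow> 'v" and \<tau> :: "'e \<Rightarrow> 'v"
  assumes bounded_linear_pi: "bounded_linear (\<pi> g)"
    and pi_mult: "\<pi> (g \<otimes> h) \<beta> = \<pi> g (\<pi> h \<beta>)"
    and pi_one: "\<pi> \<one> \<beta> = \<beta>"
    and pi_has_derivative: "((\<lambda>x. \<pi> (lparam x) \<beta>) has_derivative d\<pi> \<beta>) (at origin)"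
    and linear_tau: "linear \<tau>"
    and cocycle: "d\<pi> (\<tau> v) u - d\<pi> (\<tau> u) v = \<tau> (lie_bracket G A u v)"
begin

lemma linear_pi: "linear (\<pi> g)"
  using bounded_linear_pi bounded_linear.linear by blast

text \<open>Translation by \<open>inv g\<close> reduces continuity at \<open>g\<close> to continuity
  at the identity, which differentiability provides.\<close>

lemma pi_tendsto:
  assumes "(f \<longlongrightarrow> g) F"
  shows "((\<lambda>x. \<pi> (f x) \<beta>) \<longlongrightarrow> \<pi> g \<beta>) F"
proof -
  have z: "((\<lambda>x. inv g \<otimes> f x) \<longlongrightarrow> \<one>) F"
    using mult_tendsto[OF tendsto_const[of "inv g"] assms] by simp
  have c: "isCont (\<lambda>x. \<pi> (lparam x) \<beta>) origin"
    using pi_has_derivative has_derivative_continuous by blast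
  have "((\<lambda>x. \<pi> (lparam (lcoord (inv g \<otimes> f x))) \<beta>) \<longlongrightarrow> \<pi> (lparam origin) \<beta>) F"
    by (rule isCont_tendsto_compose[OF c lcoord_tendsto[OF _ z]]) simp
  moreover have "\<forall>\<^sub>F x in F. \<pi> (lparam (lcoord (inv g \<otimes> f x))) \<beta> = \<pi> (inv g \<otimes> f x) \<beta>"
    using eventually_unit_nbhd[OF one_unit_nbhd z] by eventually_elim simp
  ultimately have "((\<lambda>x. \<pi> (inv g \<otimes> f x) \<beta>) \<longlongrightarrow> \<beta>) F"
    by (simp add: pi_one tendsto_cong)
  from bounded_linear.tendsto[OF bounded_linear_pi[of g] this] show ?thesis
    by (simp add: pi_mult[symmetric])
qed

text \<open>The equivariant form of \<open>\<tau>\<close>, read in the identity chart.\<close>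

definition cocycle_form where "cocycle_form x v = \<pi> (lparam x) (\<tau> (lmc x v))"

definition cocycle_form_deriv where
  "cocycle_form_deriv u v = d\<pi> (\<tau> v) u - \<tau> (lmult_second (origin, origin) (u, 0) (0, v))"

lemma linear_cocycle_form: "x \<in> linverse_dom \<Longrightarrow> linear (cocycle_form x)"
  using linear_compose[OF linear_compose[OF linear_lmc linear_tau] linear_pi]
  by (simp add: cocycle_form_def[abs_def] o_def)

lemma cocycle_form_origin: "cocycle_form origin v = \<tau> v"
  by (simp add: cocycle_form_def pi_one)

text \<open>Closedness at the identity: the antisymmetric part of the second-order term of the
  multiplication is the bracket, so symmetry is precisely the cocycle condition.\<close>

lemma cocycle_form_deriv_sym: "cocycle_form_deriv u v = cocycle_form_deriv v u"
  using cocycle[of v u] unfolding lie_bracket_eq linear_diff[OF linear_tau] cocycle_form_deriv_def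
  by (simp add: algebra_simps)

lemma cocycle_form_has_derivative_origin:
  "((\<lambda>x. cocycle_form x v) has_derivative (\<lambda>u. cocycle_form_deriv u v)) (at origin)"
proof -
  have "((\<lambda>x. \<pi> (lparam x) (\<tau> (lmc x v))) has_derivative
    (\<lambda>u. d\<pi> (\<tau> (lmc origin v)) u + \<pi> (lparam origin) (\<tau> (- lmult_second (origin, origin) (u, 0) (0, v))))) (at origin)"
  proof (rule has_derivative_linear_family[where \<theta> = "\<lambda>x w. \<pi> (lparam x) (\<tau> w)"
        and \<Theta> = "\<lambda>u w. d\<pi> (\<tau> w) u", OF _ open_UNIV UNIV_I])
    show "linear (\<lambda>w. \<pi> (lparam x) (\<tau> w))" for x
      using linear_compose[OF linear_tau linear_pi] by (simp add: o_def)
  qed (rule pi_has_derivative lmc_has_derivative)+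
  then show ?thesis
    by (simp add: cocycle_form_def cocycle_form_deriv_def pi_one linear_neg[OF linear_tau])
qed

lemma linear_cocycle_form_deriv: "linear (cocycle_form_deriv u)" "linear (\<lambda>u. cocycle_form_deriv u v)"
proof -
  show "linear (cocycle_form_deriv u)"
    by (rule linear_derivative_of_linear_family[OF linear_cocycle_form open_linverse_dom
          origin_linverse_dom cocycle_form_has_derivative_origin])
  show "linear (\<lambda>u. cocycle_form_deriv u v)"
    by (rule has_derivative_linear[OF cocycle_form_has_derivative_origin])
qed

text \<open>Equivariance reduces the derivative at \<open>x\<close> to the one at the origin: left translation by the
  inverse of \<open>x\<close> contributes only its second derivative, which is symmetric.\<close>

lemma cocycle_form_has_derivative:
  assumes x: "x \<in> linverse_dom"
  shows "((\<lambda>x. cocycle_form x v) has_derivative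
    (\<lambda>u. \<pi> (lparam x) (cocycle_form_deriv (lmc x u) (lmc x v)
      + \<tau> (lmult_second (linverse x, x) (0, u) (0, v))))) (at x)"
proof -
  define a where "a = linverse x"
  \<comment> \<open>Points \<open>y\<close> for which both \<open>y\<close> and its translate by
    \<open>a\<close> stay where \<open>lmc\<close> has its coordinate formula.\<close>
  define S where "S = linverse_dom \<inter> (\<lambda>y. (a, y)) -` (lmult -` linverse_dom \<inter> lmult_dom)"
  have ax: "(a, x) \<in> lmult_dom" and lx: "lmult (a, x) = origin"
    using x by (simp_all add: a_def) (simp add: lmult_def)
  have lmc_eq: "lmc x w = lmult2 (a, x) w" for w by (simp add: lmc_def a_def)
  have "open (lmult -` linverse_dom \<inter> lmult_dom)"
    using continuous_on_open_vimage[OF open_lmult_dom] smooth_on_continuous_on[OF lmult_smooth]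
      open_linverse_dom by blast
  moreover have "continuous_on UNIV (\<lambda>y. (a, y))" by (intro continuous_intros)
  ultimately have "open ((\<lambda>y. (a, y)) -` (lmult -` linverse_dom \<inter> lmult_dom))" by (rule open_vimage)
  then have S: "open S" unfolding S_def by (rule open_Int[OF open_linverse_dom])
  have xS: "x \<in> S" using x ax lx by (simp add: S_def)
  have D: "((\<lambda>y. lmult (a, y)) has_derivative lmc x) (at x)"
  proof -
    have "((\<lambda>y. lmult (a, y)) has_derivative (\<lambda>u. lmult1 (a, x) 0 + lmult2 (a, x) u)) (at x)"
      using ax by (intro lmult_compose_has_derivative) (auto intro!: derivative_eq_intros)
    then show ?thesis using linear_0[OF linear_lmult1[OF ax]] by (simp add: lmc_def[abs_def] a_def)
  qed
  \<comment> \<open>Applying \<open>\<pi> (lparam x)\<close> to this expression gives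
    \<open>cocycle_form y v\<close>, by left invariance of \<open>lmc\<close>. Its base point is the
    origin at \<open>y = x\<close>, where the derivative is already known.\<close>
  have "((\<lambda>y. cocycle_form (lmult (a, y)) (lmult2 (a, y) v)) has_derivative
      (\<lambda>u. cocycle_form_deriv (lmc x u) (lmult2 (a, x) v) +
        cocycle_form (lmult (a, x)) (lmult_second (a, x) (0, u) (0, v)))) (at x)"
  proof (rule has_derivative_linear_family[where \<theta> = "\<lambda>y. cocycle_form (lmult (a, y))"
        and \<Theta> = "\<lambda>u. cocycle_form_deriv (lmc x u)", OF _ S xS])
    show "linear (cocycle_form (lmult (a, y)))" if "y \<in> S" for y
      using that by (intro linear_cocycle_form) (simp add: S_def)
    show "((\<lambda>y. cocycle_form (lmult (a, y)) w) has_derivative (\<lambda>u. cocycle_form_deriv (lmc x u) w)) (at x)" for w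
      by (rule has_derivative_compose[OF D, of "\<lambda>y. cocycle_form y w"])
         (simp add: lx cocycle_form_has_derivative_origin)
    show "((\<lambda>y. lmult2 (a, y) v) has_derivative (\<lambda>u. lmult_second (a, x) (0, u) (0, v))) (at x)"
      by (rule has_derivative_compose[of "\<lambda>x. (a, x)" "\<lambda>u. (0, u)" _ _ "\<lambda>z. lmult2 z v"])
         (auto intro!: derivative_eq_intros lmult2_has_derivative ax)
  qed
  then have "((\<lambda>y. cocycle_form (lmult (a, y)) (lmult2 (a, y) v)) has_derivative
      (\<lambda>u. cocycle_form_deriv (lmc x u) (lmc x v) + \<tau> (lmult_second (a, x) (0, u) (0, v)))) (at x)"
    by (simp add: lx cocycle_form_origin lmc_eq)
  from bounded_linear.has_derivative[OF bounded_linear_pi this]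
  show ?thesis unfolding a_def[symmetric]
  proof (rule has_derivative_transform_within_open[OF _ S xS])
    fix y assume y: "y \<in> S"
    have "lparam (lmult (a, y)) = inv (lparam x) \<otimes> lparam y"
      using y x by (auto simp: S_def lmult_def lmult_dom_def a_def)
    moreover have "lmc (lmult (a, y)) (lmult2 (a, y) v) = lmc y v"
      using y by (intro lmc_lmult) (auto simp: S_def)
    ultimately show "\<pi> (lparam x) (cocycle_form (lmult (a, y)) (lmult2 (a, y) v)) = cocycle_form y v"
      by (simp add: cocycle_form_def pi_mult[symmetric])
  qed
qed

lemma continuous_on_pi: "continuous_on linverse_dom (\<lambda>x. \<pi> (lparam x) \<beta>)"
  unfolding continuous_on_def
  by (intro ballI pi_tendsto lparam_tendsto tendsto_ident_at) simp

lemma continuous_on_cocycle_form_deriv: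
  "continuous_on linverse_dom (\<lambda>x. \<pi> (lparam x) (cocycle_form_deriv (lmc x u) (lmc x v)
      + \<tau> (lmult_second (linverse x, x) (0, u) (0, v))))"
  unfolding linear_add[OF linear_pi]
proof (rule continuous_on_add)
  have lin2: "linear (\<lambda>w. \<pi> g (cocycle_form_deriv u' w))" for g u'
    using linear_compose[OF linear_cocycle_form_deriv(1) linear_pi] by (simp add: o_def)
  have lin1: "linear (\<lambda>u'. \<pi> g (cocycle_form_deriv u' w))" for g w
    using linear_compose[OF linear_cocycle_form_deriv(2) linear_pi] by (simp add: o_def)
  have "continuous_on linverse_dom (\<lambda>x. \<pi> (lparam x) (cocycle_form_deriv (lmc x u) w))" for w
    by (rule continuous_on_linear_family[where \<theta> = "\<lambda>x u'. \<pi> (lparam x) (cocycle_form_deriv u' w)",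
          OF lin1 continuous_on_pi continuous_on_lmc])
  then show "continuous_on linverse_dom (\<lambda>x. \<pi> (lparam x) (cocycle_form_deriv (lmc x u) (lmc x v)))"
    by (rule continuous_on_linear_family[where \<theta> = "\<lambda>x w. \<pi> (lparam x) (cocycle_form_deriv (lmc x u) w)",
          OF lin2 _ continuous_on_lmc])
  have lint: "linear (\<lambda>w. \<pi> g (\<tau> w))" for g
    using linear_compose[OF linear_tau linear_pi] by (simp add: o_def)
  have "continuous_on linverse_dom (\<lambda>x. lmult_second (linverse x, x) (0, u) (0, v))"
    by (rule continuous_on_compose2[OF continuous_on_lmult_second])
       (auto intro!: continuous_intros linverse_continuous)
  then show "continuous_on linverse_dom (\<lambda>x. \<pi> (lparam x) (\<tau> (lmult_second (linverse x, x) (0, u) (0, v))))"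
    by (rule continuous_on_linear_family[where \<theta> = "\<lambda>x w. \<pi> (lparam x) (\<tau> w)", OF lint continuous_on_pi])
qed

lemma local_primitive:
  "\<exists>r>0. ball origin r \<subseteq> linverse_dom \<and>
     (\<exists>f. \<forall>x\<in>ball origin r. (f has_derivative cocycle_form x) (at x))"
proof -
  obtain r where r: "r > 0" "ball origin r \<subseteq> linverse_dom"
    using open_linverse_dom origin_linverse_dom open_contains_ball by blast
  have "\<exists>f. \<forall>x\<in>ball origin r. (f has_derivative cocycle_form x) (at x)"
  proof (rule poincare_ball[of origin r cocycle_form "\<lambda>x u v. \<pi> (lparam x)
      (cocycle_form_deriv (lmc x u) (lmc x v) + \<tau> (lmult_second (linverse x, x) (0, u) (0, v)))"])
    show "linear (cocycle_form x)" if "x \<in> ball origin r" for x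
      using linear_cocycle_form that r by blast
    show "((\<lambda>x. cocycle_form x v) has_derivative (\<lambda>u. \<pi> (lparam x)
      (cocycle_form_deriv (lmc x u) (lmc x v) + \<tau> (lmult_second (linverse x, x) (0, u) (0, v))))) (at x)"
      if "x \<in> ball origin r" for x v
      using cocycle_form_has_derivative that r by blast
    show "\<pi> (lparam x) (cocycle_form_deriv (lmc x u) (lmc x v) + \<tau> (lmult_second (linverse x, x) (0, u) (0, v)))
      = \<pi> (lparam x) (cocycle_form_deriv (lmc x v) (lmc x u) + \<tau> (lmult_second (linverse x, x) (0, v) (0, u)))"
      if "x \<in> ball origin r" for x u v
    proof -
      have "x \<in> linverse_dom" using that r by blast
      then show ?thesis
        using cocycle_form_deriv_sym[of "lmc x u" "lmc x v"]
          lmult_second_sym[of "(linverse x, x)" "(0, u)" "(0, v)"] by simp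
    qed
    show "continuous_on (ball origin r) (\<lambda>x. \<pi> (lparam x)
      (cocycle_form_deriv (lmc x u) (lmc x v) + \<tau> (lmult_second (linverse x, x) (0, u) (0, v))))" for u v
      by (rule continuous_on_subset[OF continuous_on_cocycle_form_deriv r(2)])
  qed
  with r show ?thesis by blast
qed

text \<open>By equivariance one primitive \<open>f\<close> near the identity serves around every
  \<open>h\<close>: \<open>\<pi> h\<close> and \<open>\<pi> (inv h \<otimes> s x)\<close> compose to
  \<open>\<pi> (s x)\<close>, while \<open>lmc_lmult2\<close> undoes the change of reference point
  in the left derivative.\<close>

lemma shifted_primitive_has_derivative:
  assumes f: "\<And>x. x \<in> ball origin r \<Longrightarrow> (f has_derivative cocycle_form x) (at x)"
    and r: "ball origin r \<subseteq> linverse_dom"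
    and s: "left_deriv s L x S" and x: "x \<in> S" and h: "s x \<in> shifted_ball h r"
  shows "((\<lambda>y. \<pi> h (f (lcoord (inv h \<otimes> s y)))) has_derivative (\<lambda>u. \<pi> (s x) (\<tau> (L u)))) (at x within S)"
proof -
  define b where "b = lcoord (inv h \<otimes> s x)"
  have b: "b \<in> ball origin r" "b \<in> linverse_dom" "lparam b = inv h \<otimes> s x"
    using h r by (auto simp: shifted_ball_def b_def)
  have "((\<lambda>y. lcoord (inv h \<otimes> s y)) has_derivative (\<lambda>u. lmult2 (b, origin) (L u))) (at x within S)"
    unfolding b_def by (rule left_deriv_lcoord[OF s x]) (use h in \<open>simp add: shifted_ball_def\<close>)
  from has_derivative_compose[OF this, of f "cocycle_form b"]
  have "((\<lambda>y. f (lcoord (inv h \<otimes> s y))) has_derivative (\<lambda>u. cocycle_form b (lmult2 (b, origin) (L u)))) (at x within S)"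
    using f[OF b(1)] by (simp add: b_def)
  from bounded_linear.has_derivative[OF bounded_linear_pi this, of h]
  show ?thesis
    by (simp add: cocycle_form_def lmc_lmult2 b pi_mult[symmetric])
qed

text \<open>Paths enter only through their left derivatives, which translation by \<open>g\<close>
  does not change. The loop consisting of \<open>p\<close>, the translate of \<open>q\<close>, and
  \<open>c\<close> backwards has total increment zero.\<close>

lemma cocycle_integral_mult:
  assumes sc: "simply_connected (UNIV :: 'g set)"
    and p: "\<And>t. t \<in> {0..1} \<Longrightarrow> left_deriv p (\<lambda>r. r *\<^sub>R k t) t {0..1}" "p 0 = \<one>" "p 1 = g"
    and q: "\<And>t. t \<in> {0..1} \<Longrightarrow> left_deriv q (\<lambda>r. r *\<^sub>R l t) t {0..1}" "q 0 = \<one>" "q 1 = h"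
    and c: "\<And>t. t \<in> {0..1} \<Longrightarrow> left_deriv c (\<lambda>r. r *\<^sub>R m t) t {0..1}" "c 0 = \<one>" "c 1 = g \<otimes> h"
  shows "integral {0..1} (\<lambda>t. \<pi> (c t) (\<tau> (m t))) =
    integral {0..1} (\<lambda>t. \<pi> (p t) (\<tau> (k t))) + \<pi> g (integral {0..1} (\<lambda>t. \<pi> (q t) (\<tau> (l t))))"
proof -
  obtain r f where r: "r > 0" "ball origin r \<subseteq> linverse_dom"
    and f: "\<And>x. x \<in> ball origin r \<Longrightarrow> (f has_derivative cocycle_form x) (at x)"
    using local_primitive by blast
  define W where "W h = shifted_ball h r" for h
  define F where "F h p = \<pi> h (f (lcoord (inv h \<otimes> p)))" for h p
  have Fd: "((\<lambda>y. F h (s y)) has_derivative (\<lambda>u. \<pi> (s x) (\<tau> (L u)))) (at x within S)"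
    if "left_deriv s L x S" "x \<in> S" "s x \<in> W h" for s :: "'y::real_normed_vector \<Rightarrow> 'g" and L x S h
    unfolding F_def by (rule shifted_primitive_has_derivative[OF f r(2)]) (use that in \<open>auto simp: W_def\<close>)
  interpret local_primitives W F
  proof
    show "open (W i)" for i by (simp add: W_def open_shifted_ball)
    show "\<exists>i. x \<in> W i" for x using shifted_ball_self[OF r(1)] W_def by blast
    fix x i j assume x: "x \<in> W i" "x \<in> W j"
    have ct: "isCont (\<lambda>y. x \<otimes> lparam y) origin"
      unfolding isCont_def by (intro mult_tendsto lparam_tendsto tendsto_intros) auto
    have "open (W i \<inter> W j)" "x \<otimes> lparam origin \<in> W i \<inter> W j"
      using x by (auto simp: W_def open_shifted_ball)
    then have "\<exists>T. open T \<and> origin \<in> T \<and> (\<forall>y\<in>T. x \<otimes> lparam y \<in> W i \<inter> W j)"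
      by (intro ct[unfolded continuous_at_open, rule_format] conjI)
    then obtain T where T: "open T" "origin \<in> T" "\<And>y. y \<in> T \<Longrightarrow> x \<otimes> lparam y \<in> W i \<inter> W j"
      by metis
    have "open (T \<inter> linverse_dom)" "origin \<in> T \<inter> linverse_dom"
      using T open_linverse_dom by auto
    then obtain e where e: "e > 0" "ball origin e \<subseteq> T \<inter> linverse_dom"
      using open_contains_ball by metis
    \<comment> \<open>Both derivatives are given by the form itself and involve neither
      \<open>i\<close> nor \<open>j\<close>, so the difference is constant on the convex
      ball.\<close>
    have "((\<lambda>y. F i (x \<otimes> lparam y) - F j (x \<otimes> lparam y)) has_derivative (\<lambda>u. 0)) (at y within ball origin e)"
      if y: "y \<in> ball origin e" for y
    proof -
      have "left_deriv (\<lambda>y. x \<otimes> lparam y) (lmc y) y UNIV" using y e by (intro left_deriv_lparam) auto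
      then have "((\<lambda>z. F i (x \<otimes> lparam z)) has_derivative (\<lambda>u. \<pi> (x \<otimes> lparam y) (\<tau> (lmc y u)))) (at y)"
        "((\<lambda>z. F j (x \<otimes> lparam z)) has_derivative (\<lambda>u. \<pi> (x \<otimes> lparam y) (\<tau> (lmc y u)))) (at y)"
        using Fd[of "\<lambda>y. x \<otimes> lparam y" "lmc y" y UNIV] T(3)[of y] y e by auto
      from has_derivative_diff[OF this] show ?thesis by (simp add: has_derivative_at_withinI)
    qed
    then have "\<exists>C. \<forall>y\<in>ball origin e. F i (x \<otimes> lparam y) - F j (x \<otimes> lparam y) = C"
      by (intro has_derivative_zero_constant) auto
    then obtain C where C: "\<And>y. y \<in> ball origin e \<Longrightarrow> F i (x \<otimes> lparam y) - F j (x \<otimes> lparam y) = C" by blast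
    have "F i q - F j q = C" if "q \<in> shifted_ball x e" for q
      using C[of "lcoord (inv x \<otimes> q)"] that by (simp add: shifted_ball_def)
    then show "\<exists>N. open N \<and> x \<in> N \<and> (\<forall>q\<in>N. F i q - F j q = F i x - F j x)"
      using shifted_ball_self[OF e(1)] open_shifted_ball by (metis (no_types, lifting))
  qed
  \<comment> \<open>Along the path, \<open>u\<close> differs locally from the differentiable
    \<open>F i (s y)\<close> by a constant. It is thus an antiderivative in the usual sense, and
    integrability comes with the fundamental theorem.\<close>
  have ftc: "((\<lambda>t. \<pi> (s t) (\<tau> (n t))) has_integral u 1 - u 0) {0..1}"
    if u: "primitive_along W F s u {0..1}"
      and s: "\<And>t. t \<in> {0..1} \<Longrightarrow> left_deriv s (\<lambda>r. r *\<^sub>R n t) t {0..1}" for s n u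
  proof (rule fundamental_theorem_of_calculus)
    fix t :: real assume t: "t \<in> {0..1}"
    obtain i where i: "s t \<in> W i" "\<forall>\<^sub>F y in at t within {0..1}. u y - F i (s y) = u t - F i (s t)"
      using u t unfolding primitive_along_def by blast
    have "((\<lambda>y. F i (s y) + (u t - F i (s t))) has_derivative (\<lambda>r. \<pi> (s t) (\<tau> (r *\<^sub>R n t)))) (at t within {0..1})"
      using has_derivative_add[OF Fd[OF s[OF t] t i(1)] has_derivative_const] by simp
    then have "(u has_derivative (\<lambda>r. \<pi> (s t) (\<tau> (r *\<^sub>R n t)))) (at t within {0..1})"
      by (rule has_derivative_transform_eventually)
         (use i(2) t in \<open>auto elim!: eventually_mono simp: algebra_simps\<close>)
    then show "(u has_vector_derivative \<pi> (s t) (\<tau> (n t))) (at t within {0..1})"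
      by (simp add: has_vector_derivative_def linear_scale[OF linear_tau] linear_scale[OF linear_pi])
  qed simp
  have pathI: "path s" if "\<And>t. t \<in> {0..1} \<Longrightarrow> left_deriv s (\<lambda>r. r *\<^sub>R n t) t {0..1}" for s n
    using that by (simp add: path_def continuous_on_def left_deriv_def)
  define gq where "gq t = g \<otimes> q t" for t
  have gq: "left_deriv gq (\<lambda>r. r *\<^sub>R l t) t {0..1}" if "t \<in> {0..1}" for t
    unfolding gq_def by (rule left_deriv_translate[OF q(1)[OF that]])
  \<comment> \<open>Each join halves the parameter: \<open>p\<close> occupies
    \<open>[0, 1/4]\<close>, \<open>gq\<close> occupies \<open>[1/4, 1/2]\<close>, and
    \<open>c\<close> runs backwards over \<open>[1/2, 1]\<close>. The reparametrisations below
    invert this.\<close>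
  define w where "w = (p +++ gq) +++ reversepath c"
  have ends: "pathfinish p = pathstart gq" "pathfinish (p +++ gq) = pathstart (reversepath c)"
    using p q c by (simp_all add: pathfinish_def pathstart_def gq_def reversepath_def joinpaths_def)
  have "path w" unfolding w_def
    using ends pathI[OF p(1)] pathI[OF gq] pathI[OF c(1)] by (intro path_join_imp) auto
  moreover have "pathfinish w = pathstart w"
    using p c by (simp add: w_def pathfinish_def pathstart_def reversepath_def joinpaths_def)
  ultimately obtain u where u: "primitive_along W F w u {0..1}" "u 1 = u 0"
    using primitive_along_loop[OF sc] by blast
  have "primitive_along W F p (\<lambda>t. u (t / 4)) {0..1}"
  proof (rule primitive_along_cong[OF primitive_along_compose[OF u(1)]])
    show "w (t / 4) = p t" if "t \<in> {0..1}" for t using that by (simp add: w_def joinpaths_def)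
  qed (auto intro!: continuous_intros)
  from ftc[OF this p(1)] have P: "((\<lambda>t. \<pi> (p t) (\<tau> (k t))) has_integral u (1/4) - u 0) {0..1}" by simp
  have "primitive_along W F gq (\<lambda>t. u ((1 + t) / 4)) {0..1}"
  proof (rule primitive_along_cong[OF primitive_along_compose[OF u(1)]])
    show "w ((1 + t) / 4) = gq t" if "t \<in> {0..1}" for t
      \<comment> \<open>A join assigns the common point to its earlier piece, so the value at
        \<open>t = 0\<close> is \<open>p 1\<close>, which equals \<open>gq 0\<close>.\<close>
      using that p q by (cases "t = 0") (auto simp: w_def joinpaths_def gq_def field_simps)
  qed (auto intro!: continuous_intros)
  from ftc[OF this gq] have GQ: "((\<lambda>t. \<pi> (gq t) (\<tau> (l t))) has_integral u (1/2) - u (1/4)) {0..1}" by simp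
  have "primitive_along W F c (\<lambda>t. u (1 - t / 2)) {0..1}"
  proof (rule primitive_along_cong[OF primitive_along_compose[OF u(1)]])
    show "w (1 - t / 2) = c t" if "t \<in> {0..1}" for t
      using that p q c by (cases "t = 1") (auto simp: w_def joinpaths_def gq_def reversepath_def field_simps)
  qed (auto intro!: continuous_intros)
  from ftc[OF this c(1)] have C: "((\<lambda>t. \<pi> (c t) (\<tau> (m t))) has_integral u (1/2) - u 1) {0..1}" by simp
  \<comment> \<open>Undoing the translation first makes the integrand of \<open>q\<close>
    integrable; \<open>\<pi> g\<close> is then applied to the value of its integral.\<close>
  have "((\<lambda>t. \<pi> (inv g) (\<pi> (gq t) (\<tau> (l t)))) has_integral \<pi> (inv g) (u (1/2) - u (1/4))) {0..1}"
    using has_integral_linear[OF GQ bounded_linear_pi[of "inv g"]] by (simp add: o_def)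
  then have "((\<lambda>t. \<pi> (q t) (\<tau> (l t))) has_integral \<pi> (inv g) (u (1/2) - u (1/4))) {0..1}"
    by (simp add: gq_def pi_mult[symmetric])
  then have "\<pi> g (integral {0..1} (\<lambda>t. \<pi> (q t) (\<tau> (l t)))) = u (1/2) - u (1/4)"
    by (simp add: integral_unique pi_mult[symmetric] pi_one)
  with P C u(2) show ?thesis by (simp add: integral_unique)
qed

end

section \<open>Smooth paths and one-parameter subgroups\<close>

context lie_group
begin

definition left_velocity :: "(real \<Rightarrow> 'g) \<Rightarrow> real \<Rightarrow> 'e" where
  "left_velocity p t = tangent_map A A (\<lambda>k. inv (p t) \<otimes> k) (p t) (velocity A p t)"

lemma path_integral_eq_form:
  "path_integral A (eq_form G A \<rho> \<alpha>) p
     = integral {0..1} (\<lambda>t. \<rho> (p t) (blinfun_apply \<alpha> (left_velocity p t)))"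
  by (simp add: path_integral_def eq_form_def left_velocity_def)

text \<open>Connects the chosen charts with the left derivative: \<open>velocity\<close> and
  \<open>tangent_map\<close> use the same chart at \<open>p t\<close>, which cancels in the chain
  rule. At the end points the derivative is one-sided on both sides of the comparison.\<close>

lemma smooth_path_left_deriv:
  assumes p: "smooth_path A p" and t: "t \<in> {0..1}"
  shows "left_deriv p (\<lambda>r. r *\<^sub>R left_velocity p t) t {0..1}"
proof -
  obtain q J where J: "open J" "{0..1} \<subseteq> J" and q: "smooth_map std_atlas A J q"
    and pq: "\<And>t. t \<in> {0..1} \<Longrightarrow> p t = q t"
    using p unfolding smooth_path_def by blast
  define h where "h = p t"
  define V \<xi> where "V = fst (chart_at A h)" and "\<xi> = snd (chart_at A h)"
  have V: "(V, \<xi>) \<in> A" "h \<in> V" using chart_at_in[of h] by (simp_all add: V_def \<xi>_def)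
  have ev: "\<forall>\<^sub>F s in at t within {0..1}. s \<in> {0..1}" by (simp add: eventually_at_filter)
  have "isCont q t"
    using q J t unfolding smooth_map_def by (auto simp: continuous_on_eq_continuous_at)
  then have "(q \<longlongrightarrow> h) (at t within {0..1})"
    using t by (simp add: isCont_def h_def pq tendsto_within_subset[of _ _ _ UNIV])
  then have pt: "(p \<longlongrightarrow> h) (at t within {0..1})"
    by (rule Lim_transform_eventually) (use ev in \<open>auto elim!: eventually_mono simp: pq\<close>)
  have "smooth_on (\<xi> \<circ> q \<circ> inv_into UNIV id) (id ` (J \<inter> UNIV \<inter> q -` V))"
    using q V unfolding smooth_map_def std_atlas_def by blast
  then have "((\<lambda>s. \<xi> (q s)) has_derivative frechet_derivative (\<lambda>s. \<xi> (q s)) (at t)) (at t)"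
    using smooth_on_has_derivative[of "\<lambda>s. \<xi> (q s)" "J \<inter> q -` V" t] t J V pq[OF t]
    by (auto simp: o_def h_def)
  then have "((\<lambda>s. \<xi> (q s)) has_derivative frechet_derivative (\<lambda>s. \<xi> (q s)) (at t)) (at t within {0..1})"
    by (rule has_derivative_at_withinI)
  then have pd: "((\<lambda>s. \<xi> (p s)) has_derivative frechet_derivative (\<lambda>s. \<xi> (q s)) (at t)) (at t within {0..1})"
    by (rule has_derivative_transform_eventually)
       (use ev t in \<open>auto elim!: eventually_mono simp: pq\<close>)
  then have "(\<lambda>s. \<xi> (p s)) differentiable (at t within {0..1})" by (auto simp: differentiable_def)
  then have "((\<lambda>s. \<xi> (p s)) has_vector_derivative velocity A p t) (at t within {0..1})"
    unfolding velocity_def o_def h_def[symmetric] \<xi>_def[symmetric]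
    by (simp add: vector_derivative_works)
  then have vd: "((\<lambda>s. \<xi> (p s)) has_derivative (\<lambda>r. r *\<^sub>R velocity A p t)) (at t within {0..1})"
    by (simp add: has_vector_derivative_def)
  define D where "D = frechet_derivative (\<lambda>y. lcoord (inv h \<otimes> inv_into V \<xi> y)) (at (\<xi> h))"
  have D: "((\<lambda>y. lcoord (inv h \<otimes> inv_into V \<xi> y)) has_derivative D) (at (\<xi> h))"
    unfolding D_def using left_mult_differentiable[OF V(1) unit_chart V(2)]
    by (simp add: frechet_derivative_works)
  \<comment> \<open>The target chart of this tangent map sits at
    \<open>inv h \<otimes> h = \<one>\<close>, so it is the unit chart.\<close>
  have lv: "left_velocity p t = D (velocity A p t)"
    by (simp add: left_velocity_def tangent_map_eq D_def h_def[symmetric] V_def \<xi>_def lcoord_def)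
  have "((\<lambda>s. lcoord (inv h \<otimes> inv_into V \<xi> (\<xi> (p s)))) has_derivative (\<lambda>r. D (r *\<^sub>R velocity A p t)))
      (at t within {0..1})"
    by (rule has_derivative_compose[OF vd, of "\<lambda>y. lcoord (inv h \<otimes> inv_into V \<xi> y)"])
       (use D in \<open>simp add: h_def\<close>)
  then have "((\<lambda>s. lcoord (inv h \<otimes> p s)) has_derivative (\<lambda>r. D (r *\<^sub>R velocity A p t))) (at t within {0..1})"
  proof (rule has_derivative_transform_eventually[OF _ _ _ t])
    from topological_tendstoD[OF pt chart_props(1)[OF V(1)] V(2)]
    show "\<forall>\<^sub>F s in at t within {0..1}. lcoord (inv h \<otimes> inv_into V \<xi> (\<xi> (p s))) = lcoord (inv h \<otimes> p s)"
      by eventually_elim (use V in simp)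
  qed (use V in \<open>simp add: h_def\<close>)
  then show ?thesis
    using pt by (simp add: left_deriv_def h_def lv linear_scale[OF has_derivative_linear[OF D]])
qed

lemma left_velocity_unique:
  assumes p: "smooth_path A p" and t: "t \<in> {0..1}" and X: "left_deriv p (\<lambda>r. r *\<^sub>R X) t {0..1}"
  shows "left_velocity p t = X"
proof (rule vector_derivative_unique_within)
  show "at t within {0..1} \<noteq> bot" using t by (simp add: trivial_limit_within islimpt_Icc)
  show "((\<lambda>y. lcoord (inv (p t) \<otimes> p y)) has_vector_derivative left_velocity p t) (at t within {0..1})"
    "((\<lambda>y. lcoord (inv (p t) \<otimes> p y)) has_vector_derivative X) (at t within {0..1})"
    using smooth_path_left_deriv[OF p t] X by (simp_all add: left_deriv_def has_vector_derivative_def)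
qed

section \<open>One-parameter subgroups and the exponential map\<close>

definition generates where
  "generates X \<gamma> \<longleftrightarrow> one_parameter_subgroup G A \<gamma> \<and> tangent_map std_atlas A \<gamma> 0 1 = X"

lemma lie_exp_eq: "lie_exp G A X = (THE \<gamma>. generates X \<gamma>) 1"
  by (simp add: lie_exp_def generates_def)

lemma hom_real_props:
  assumes m: "\<And>s t :: real. \<gamma> (s + t) = \<gamma> s \<otimes> \<gamma> t"
  shows "\<gamma> 0 = \<one>" "inv (\<gamma> s) = \<gamma> (- s)" "inv (\<gamma> s) \<otimes> \<gamma> t = \<gamma> (t - s)"
proof -
  have "\<gamma> 0 \<otimes> \<gamma> 0 = \<gamma> 0" using m[of 0 0] by simp
  then show z: "\<gamma> 0 = \<one>" by (metis cancel_left(1) l_inv carrier_UNIV UNIV_I)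
  have "\<gamma> (- s) \<otimes> \<gamma> s = \<one>" using m[of "- s" s] z by simp
  then show i: "inv (\<gamma> s) = \<gamma> (- s)" by (intro inv_equality) auto
  show "inv (\<gamma> s) \<otimes> \<gamma> t = \<gamma> (t - s)" using m[of "- s" t] i by simp
qed

lemma one_parameter_subgroup_props:
  assumes "one_parameter_subgroup G A \<gamma>"
  shows "\<gamma> (s + t) = \<gamma> s \<otimes> \<gamma> t" "\<gamma> 0 = \<one>" "isCont \<gamma> s" "smooth_path A \<gamma>"
proof -
  show m: "\<gamma> (s + t) = \<gamma> s \<otimes> \<gamma> t" for s t
    using assms unfolding one_parameter_subgroup_def by blast
  show "\<gamma> 0 = \<one>" by (rule hom_real_props(1)[OF m])
  have sm: "smooth_map std_atlas A UNIV \<gamma>" using assms unfolding one_parameter_subgroup_def by blast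
  then show "isCont \<gamma> s" unfolding smooth_map_def by (simp add: continuous_on_eq_continuous_at)
  show "smooth_path A \<gamma>" unfolding smooth_path_def using sm by blast
qed

lemma generates_has_derivative:
  assumes "generates X \<gamma>"
  shows "((\<lambda>t. lcoord (\<gamma> t)) has_derivative (\<lambda>r. r *\<^sub>R X)) (at 0)"
proof -
  have ops: "one_parameter_subgroup G A \<gamma>" and X: "tangent_map std_atlas A \<gamma> 0 1 = X"
    using assms by (auto simp: generates_def)
  have z: "\<gamma> 0 = \<one>" by (rule one_parameter_subgroup_props(2)[OF ops])
  have "smooth_on (lcoord \<circ> \<gamma> \<circ> inv_into UNIV id) (id ` (UNIV \<inter> UNIV \<inter> \<gamma> -` unit_nbhd))"
    using ops unit_chart unfolding one_parameter_subgroup_def smooth_map_def std_atlas_def by blast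
  then have d: "((\<lambda>t. lcoord (\<gamma> t)) has_derivative frechet_derivative (\<lambda>t. lcoord (\<gamma> t)) (at 0)) (at 0)"
    using smooth_on_has_derivative[of "\<lambda>t. lcoord (\<gamma> t)" "\<gamma> -` unit_nbhd" 0] z by (simp add: o_def)
  have "frechet_derivative (\<lambda>t. lcoord (\<gamma> t)) (at 0) 1 = X"
    using X by (simp add: tangent_map_eq z lcoord_def)
  then have "frechet_derivative (\<lambda>t. lcoord (\<gamma> t)) (at 0) r = r *\<^sub>R X" for r
    using linear_scale[OF has_derivative_linear[OF d], of r 1] by simp
  then have "frechet_derivative (\<lambda>t. lcoord (\<gamma> t)) (at 0) = (\<lambda>r. r *\<^sub>R X)" by (simp add: fun_eq_iff)
  with d show ?thesis by simp
qed

lemma generates_tangent: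
  assumes "one_parameter_subgroup G A \<gamma>" "((\<lambda>t. lcoord (\<gamma> t)) has_derivative (\<lambda>r. r *\<^sub>R X)) (at 0)"
  shows "generates X \<gamma>"
proof -
  have "frechet_derivative (\<lambda>t. lcoord (\<gamma> t)) (at 0) 1 = X"
    using fun_cong[OF frechet_derivative_at[OF assms(2)], of 1] by simp
  then show ?thesis
    using assms(1) by (simp add: generates_def tangent_map_eq one_parameter_subgroup_props(2) lcoord_def)
qed

text \<open>Since \<open>inv (\<gamma> t) \<otimes> \<gamma> s = \<gamma> (s - t)\<close>, the left
  derivative at \<open>t\<close> is the derivative at 0.\<close>

lemma generates_left_deriv:
  assumes "generates X \<gamma>"
  shows "left_deriv \<gamma> (\<lambda>r. r *\<^sub>R X) t S"
proof -
  have ops: "one_parameter_subgroup G A \<gamma>" using assms by (simp add: generates_def)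
  have "((\<lambda>s. s - t) has_derivative (\<lambda>r. r)) (at t)" by (auto intro!: derivative_eq_intros)
  from has_derivative_compose[OF this, of "\<lambda>t. lcoord (\<gamma> t)" "\<lambda>r. r *\<^sub>R X"]
  have "((\<lambda>s. lcoord (\<gamma> (s - t))) has_derivative (\<lambda>r. r *\<^sub>R X)) (at t)"
    using generates_has_derivative[OF assms] by simp
  moreover have "inv (\<gamma> t) \<otimes> \<gamma> s = \<gamma> (s - t)" for s
    by (rule hom_real_props(3)[OF one_parameter_subgroup_props(1)[OF ops]])
  moreover have "(\<gamma> \<longlongrightarrow> \<gamma> t) (at t within S)"
    using one_parameter_subgroup_props(3)[OF ops, of t]
    by (auto simp: isCont_def intro: tendsto_within_subset)
  ultimately show ?thesis by (simp add: left_deriv_def has_derivative_at_withinI)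
qed

text \<open>In the chart translated to \<open>s a\<close> the derivative vanishes, so the path is
  constant near \<open>a\<close>; connectedness of the line makes this global.\<close>

lemma left_deriv_zero_constant:
  fixes s :: "real \<Rightarrow> 'g"
  assumes s: "\<And>t. left_deriv s (\<lambda>r. 0) t UNIV"
  shows "s t = s t'"
proof (rule eventually_constant_imp_constant[OF connected_UNIV _ UNIV_I UNIV_I])
  fix a
  have "\<forall>\<^sub>F t in at a. inv (s a) \<otimes> s t \<in> unit_nbhd"
    by (rule eventually_unit_nbhd[OF _ left_deriv_shift_tendsto[OF s]]) simp
  then obtain e where e: "e > 0" "\<And>t. t \<noteq> a \<Longrightarrow> dist t a < e \<Longrightarrow> inv (s a) \<otimes> s t \<in> unit_nbhd"
    unfolding eventually_at by blast
  have nb: "inv (s a) \<otimes> s t \<in> unit_nbhd" if "t \<in> ball a e" for t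
    using e(2)[of t] that by (cases "t = a") (auto simp: dist_commute)
  have "((\<lambda>t. lcoord (inv (s a) \<otimes> s t)) has_derivative (\<lambda>r. 0)) (at t within ball a e)" if t: "t \<in> ball a e" for t
    using left_deriv_lcoord[OF s _ nb[OF t]] nb[OF t] linear_0[OF linear_lmult2, of "(lcoord (inv (s a) \<otimes> s t), origin)"]
    by (simp add: has_derivative_at_withinI)
  then have "\<exists>C. \<forall>t\<in>ball a e. lcoord (inv (s a) \<otimes> s t) = C"
    by (intro has_derivative_zero_constant) auto
  then obtain C where C: "\<And>t. t \<in> ball a e \<Longrightarrow> lcoord (inv (s a) \<otimes> s t) = C" by blast
  have "s t = s a" if t: "t \<in> ball a e" for t
  proof -
    have "lcoord (inv (s a) \<otimes> s t) = lcoord \<one>" using C[OF t] C[of a] e(1) by simp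
    then have "inv (s a) \<otimes> s t = \<one>" using nb[OF t] by (metis lparam_simps(1) one_unit_nbhd)
    then have "s a \<otimes> (inv (s a) \<otimes> s t) = s a" by simp
    then show ?thesis by (simp only: cancel_left)
  qed
  then show "\<forall>\<^sub>F t in at a. s t = s a"
    unfolding eventually_at using e(1) by (metis dist_commute mem_ball)
qed

text \<open>The product \<open>\<gamma> s \<otimes> \<delta> (- s)\<close> has left derivative zero.
  Stated for continuous homomorphisms with a derivative at 0, the result applies to a conjugated
  subgroup without a check of its smoothness in all charts.\<close>

lemma hom_real_unique:
  assumes \<gamma>: "\<And>s t :: real. \<gamma> (s + t) = \<gamma> s \<otimes> \<gamma> t" "\<And>t. isCont \<gamma> t"
      "((\<lambda>t. lcoord (\<gamma> t)) has_derivative L) (at 0)"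
    and \<delta>: "\<And>s t :: real. \<delta> (s + t) = \<delta> s \<otimes> \<delta> t" "\<And>t. isCont \<delta> t"
      "((\<lambda>t. lcoord (\<delta> t)) has_derivative L) (at 0)"
  shows "\<gamma> = \<delta>"
proof
  fix t
  note g = hom_real_props[of \<gamma>, OF \<gamma>(1)] and d = hom_real_props[of \<delta>, OF \<delta>(1)]
  define \<beta> where "\<beta> s = \<gamma> s \<otimes> \<delta> (- s)" for s
  have "left_deriv \<beta> (\<lambda>r. 0) s UNIV" for s
  proof -
    \<comment> \<open>The left quotient of \<open>\<beta>\<close> at \<open>s\<close> is
      \<open>z\<close> conjugated by \<open>\<delta> s\<close>. The derivative of \<open>z\<close>
      at \<open>s\<close> is \<open>L r + L (- r) = 0\<close>, and conjugation preserves
      this.\<close>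
    define z where "z y = \<gamma> (y - s) \<otimes> \<delta> (s - y)" for y
    have iz: "inv (\<beta> s) \<otimes> \<beta> y = \<delta> s \<otimes> z y \<otimes> inv (\<delta> s)" for y
    proof -
      have "inv (\<beta> s) \<otimes> \<beta> y = \<delta> s \<otimes> (inv (\<gamma> s) \<otimes> \<gamma> y) \<otimes> \<delta> (- y)"
        by (simp add: \<beta>_def inv_mult_group d(2) m_assoc)
      also have "\<dots> = \<delta> s \<otimes> \<gamma> (y - s) \<otimes> \<delta> (- y)" by (simp add: g(3))
      also have "\<delta> (- y) = \<delta> (s - y) \<otimes> inv (\<delta> s)" using \<delta>(1)[of "s - y" "- s"] by (simp add: d(2))
      finally show ?thesis by (simp add: z_def m_assoc)
    qed
    have g0: "((\<lambda>y. \<gamma> (y - s)) \<longlongrightarrow> \<one>) (at s)" "((\<lambda>y. \<delta> (s - y)) \<longlongrightarrow> \<one>) (at s)"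
    proof -
      have "((\<lambda>y. \<gamma> (y - s)) \<longlongrightarrow> \<gamma> (s - s)) (at s)" "((\<lambda>y. \<delta> (s - y)) \<longlongrightarrow> \<delta> (s - s)) (at s)"
        by (intro isCont_tendsto_compose[OF \<gamma>(2)] isCont_tendsto_compose[OF \<delta>(2)] tendsto_intros)+
      then show "((\<lambda>y. \<gamma> (y - s)) \<longlongrightarrow> \<one>) (at s)" "((\<lambda>y. \<delta> (s - y)) \<longlongrightarrow> \<one>) (at s)"
        by (simp_all add: g(1) d(1))
    qed
    then have z0: "(z \<longlongrightarrow> \<one>) (at s)" unfolding z_def using mult_tendsto[OF g0] by simp
    have 1: "((\<lambda>y. lcoord (\<gamma> (y - s))) has_derivative L) (at s)"
      by (rule has_derivative_compose[of "\<lambda>y. y - s" "\<lambda>r. r" s UNIV "\<lambda>t. lcoord (\<gamma> t)" L])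
         (use \<gamma>(3) in \<open>auto intro!: derivative_eq_intros\<close>)
    have 2: "((\<lambda>y. lcoord (\<delta> (s - y))) has_derivative (\<lambda>r. L (- r))) (at s)"
      by (rule has_derivative_compose[of "\<lambda>y. s - y" "\<lambda>r. - r" s UNIV "\<lambda>t. lcoord (\<delta> t)" L])
         (use \<delta>(3) in \<open>auto intro!: derivative_eq_intros\<close>)
    have "((\<lambda>y. lmult (lcoord (\<gamma> (y - s)), lcoord (\<delta> (s - y)))) has_derivative
       (\<lambda>r. lmult1 (lcoord (\<gamma> (s - s)), lcoord (\<delta> (s - s))) (L r)
          + lmult2 (lcoord (\<gamma> (s - s)), lcoord (\<delta> (s - s))) (L (- r)))) (at s)"
      by (rule lmult_compose_has_derivative[OF 1 2]) (simp add: g(1) d(1))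
    then have "((\<lambda>y. lmult (lcoord (\<gamma> (y - s)), lcoord (\<delta> (s - y)))) has_derivative (\<lambda>r. 0)) (at s)"
      using linear_neg[OF has_derivative_linear[OF \<gamma>(3)]] by (simp add: g(1) d(1))
    moreover have "\<forall>\<^sub>F y in at s. lmult (lcoord (\<gamma> (y - s)), lcoord (\<delta> (s - y))) = lcoord (z y)"
      using eventually_unit_nbhd[OF one_unit_nbhd g0(1)] eventually_unit_nbhd[OF one_unit_nbhd g0(2)]
      by eventually_elim (simp add: lmult_def z_def)
    ultimately have "((\<lambda>y. lcoord (z y)) has_derivative (\<lambda>r. 0)) (at s)"
      by (rule has_derivative_transform_eventually) (simp_all add: lmult_def z_def g(1) d(1))
    from conj_has_derivative[OF z0 _ _ this, of "\<delta> s"]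
    have "((\<lambda>y. lcoord (inv (\<beta> s) \<otimes> \<beta> y)) has_derivative (\<lambda>r. 0)) (at s)"
      by (simp add: iz z_def g(1) d(1) linear_0[OF linear_Ad])
    moreover have "(\<beta> \<longlongrightarrow> \<beta> s) (at s)"
      unfolding \<beta>_def
      by (rule mult_tendsto[OF isCont_tendsto_compose[OF \<gamma>(2)] isCont_tendsto_compose[OF \<delta>(2)]])
         (auto intro!: tendsto_intros)
    ultimately show ?thesis by (simp add: left_deriv_def)
  qed
  then have "\<beta> t = \<beta> 0" by (rule left_deriv_zero_constant)
  then have "\<gamma> t \<otimes> inv (\<delta> t) = \<one>" by (simp add: \<beta>_def g(1) d(1) d(2))
  then show "\<gamma> t = \<delta> t" by (metis cancel_left(2) inv_inv inv_solve_right l_one UNIV_I carrier_UNIV)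
qed

lemma generates_unique:
  assumes "generates X \<gamma>" "generates X \<delta>"
  shows "\<gamma> = \<delta>"
  by (rule hom_real_unique[OF _ _ generates_has_derivative[OF assms(1)] _ _ generates_has_derivative[OF assms(2)]])
     (use assms in \<open>simp_all add: generates_def one_parameter_subgroup_props\<close>)

lemma lie_exp_generates: "generates X \<gamma> \<Longrightarrow> lie_exp G A X = \<gamma> 1"
  unfolding lie_exp_eq using generates_unique by (metis the_equality)

text \<open>Evaluated at 1, this turns the integration paths \<open>exp (s X)\<close> of
  \<open>I2\<close> into one-parameter subgroups; it also carries generation from one multiple of
  \<open>X\<close> to another.\<close>

lemma generates_scale:
  assumes X: "generates X \<gamma>"
  shows "generates (r *\<^sub>R X) (\<lambda>t. \<gamma> (r * t))"
proof (rule generates_tangent)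
  have ops: "one_parameter_subgroup G A \<gamma>" using X by (simp add: generates_def)
  have cont: "continuous_on UNIV \<gamma>"
    using one_parameter_subgroup_props(3)[OF ops] by (simp add: continuous_on_eq_continuous_at)
  show "one_parameter_subgroup G A (\<lambda>t. \<gamma> (r * t))"
    unfolding one_parameter_subgroup_def
  proof
    show "smooth_map std_atlas A UNIV (\<lambda>t. \<gamma> (r * t))"
      unfolding smooth_map_def std_atlas_def
    proof (clarsimp, intro conjI ballI)
      show "continuous_on UNIV (\<lambda>t. \<gamma> (r * t))"
        by (rule continuous_on_compose2[OF cont]) (auto intro!: continuous_intros)
      fix c assume c: "c \<in> A"
      obtain V \<xi> where V: "c = (V, \<xi>)" by (cases c)
      have o: "open (\<gamma> -` V)" using cont chart_props(1) c V open_vimage by blast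
      have "smooth_on (\<xi> \<circ> \<gamma> \<circ> inv_into UNIV id) (id ` (UNIV \<inter> UNIV \<inter> \<gamma> -` V))"
        using ops c V unfolding one_parameter_subgroup_def smooth_map_def std_atlas_def by blast
      then have "smooth_on (\<lambda>t. \<xi> (\<gamma> t)) (\<gamma> -` V)" by (simp add: o_def)
      then have "smooth_on (\<lambda>t. \<xi> (\<gamma> (r * t))) ((\<lambda>t. r * t) -` (\<gamma> -` V))"
        unfolding smooth_on_def using Ck_on_scale[OF o, of _ "\<lambda>t. \<xi> (\<gamma> t)"] by blast
      then show "case c of (V, \<psi>) \<Rightarrow> smooth_on (\<psi> \<circ> (\<lambda>t. \<gamma> (r * t))) ((\<lambda>t. \<gamma> (r * t)) -` V)"
        by (simp add: V o_def vimage_def)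
    qed
    show "\<forall>s t. \<gamma> (r * (s + t)) = \<gamma> (r * s) \<otimes> \<gamma> (r * t)"
      by (simp add: one_parameter_subgroup_props(1)[OF ops] distrib_left)
  qed
  show "((\<lambda>t. lcoord (\<gamma> (r * t))) has_derivative (\<lambda>h. h *\<^sub>R r *\<^sub>R X)) (at 0)"
    using has_derivative_compose[of "\<lambda>t. r * t" "\<lambda>t. r * t" 0 UNIV "\<lambda>t. lcoord (\<gamma> t)" "\<lambda>h. h *\<^sub>R X"]
      generates_has_derivative[OF X]
    by (simp add: mult.commute) (use has_derivative_mult_left[OF has_derivative_ident] in blast)
qed

lemma lie_exp_scale: "generates X \<gamma> \<Longrightarrow> lie_exp G A (s *\<^sub>R X) = \<gamma> s"
  using lie_exp_generates[OF generates_scale, of X \<gamma> s] by simp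

lemma generates_zero: "generates 0 (\<lambda>t. \<one>)"
proof (rule generates_tangent)
  have "Ck_on k (\<lambda>t::real. c :: 'e) S" for k c S by (rule Ck_on_const)
  then show "one_parameter_subgroup G A (\<lambda>t. \<one>)"
    by (auto simp: one_parameter_subgroup_def smooth_map_def std_atlas_def smooth_on_def o_def)
qed simp

text \<open>No existence theorem for differential equations is needed.  All elements without a one-parameter
  subgroup share the junk value of the definite description in \<open>lie_exp\<close>, and with \<open>X\<close> all its
  non-zero multiples are of this kind; this contradicts injectivity on the open set \<open>D\<close>.\<close>

lemma generates_exists:
  assumes D: "log_domain G A D" and X: "X \<in> D"
  shows "\<exists>\<gamma>. generates X \<gamma>"
proof (rule ccontr)
  assume no: "\<nexists>\<gamma>. generates X \<gamma>"
  then have X0: "X \<noteq> 0" using generates_zero by blast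
  have "open D" "inj_on (lie_exp G A) D" using D by (auto simp: log_domain_def)
  have "((\<lambda>r. r *\<^sub>R X) \<longlongrightarrow> 1 *\<^sub>R X) (at 1)" by (intro tendsto_intros)
  then have "\<forall>\<^sub>F r in at (1::real). r *\<^sub>R X \<in> D"
    using topological_tendstoD[OF _ \<open>open D\<close>] X by simp
  moreover have "\<forall>\<^sub>F r in at (1::real). r \<noteq> 0"
    by (rule tendsto_imp_eventually_ne[OF tendsto_ident_at]) simp
  moreover have "\<forall>\<^sub>F r in at (1::real). r \<noteq> 1" by (simp add: eventually_at_filter)
  ultimately have "\<forall>\<^sub>F r in at (1::real). r *\<^sub>R X \<in> D \<and> r \<noteq> 0 \<and> r \<noteq> 1"
    by eventually_elim simp
  then obtain r :: real where r: "r *\<^sub>R X \<in> D" "r \<noteq> 0" "r \<noteq> 1"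
    using eventually_happens'[OF at_neq_bot] by blast
  have "\<nexists>\<gamma>. generates (r *\<^sub>R X) \<gamma>"
  proof
    assume "\<exists>\<gamma>. generates (r *\<^sub>R X) \<gamma>"
    then obtain \<gamma> where "generates (r *\<^sub>R X) \<gamma>" ..
    from generates_scale[OF this, of "1 / r"] r no show False by auto
  qed
  then have "generates (r *\<^sub>R X) = generates X" using no by (simp add: fun_eq_iff)
  then have "lie_exp G A (r *\<^sub>R X) = lie_exp G A X" by (simp add: lie_exp_eq)
  then have "r *\<^sub>R X = X" using \<open>inj_on (lie_exp G A) D\<close> r X by (auto dest: inj_onD)
  then show False using X0 r by (metis scaleR_one scaleR_right_imp_eq)
qed

text \<open>Both sides are continuous homomorphisms with derivative \<open>Ad G A g X\<close> at 0.
  The existence of \<open>\<delta>\<close> will come from the \<open>Ad\<close>-invariance of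
  \<open>D\<close>.\<close>

lemma generates_conj:
  assumes X: "generates X \<gamma>" and Y: "generates (Ad G A g X) \<delta>"
  shows "\<delta> t = conj_op G g (\<gamma> t)"
proof -
  have ops: "one_parameter_subgroup G A \<gamma>" "one_parameter_subgroup G A \<delta>"
    using X Y by (auto simp: generates_def)
  note \<gamma> = one_parameter_subgroup_props[OF ops(1)] and \<delta> = one_parameter_subgroup_props[OF ops(2)]
  have "\<delta> = (\<lambda>t. g \<otimes> \<gamma> t \<otimes> inv g)"
  proof (rule hom_real_unique[OF \<delta>(1,3) generates_has_derivative[OF Y]])
    show "g \<otimes> \<gamma> (s + t) \<otimes> inv g = g \<otimes> \<gamma> s \<otimes> inv g \<otimes> (g \<otimes> \<gamma> t \<otimes> inv g)" for s t
      by (simp add: \<gamma>(1) m_assoc)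
    show "isCont (\<lambda>t. g \<otimes> \<gamma> t \<otimes> inv g) t" for t
      using \<gamma>(3) unfolding isCont_def by (intro mult_tendsto tendsto_intros)
    have "(\<gamma> \<longlongrightarrow> \<one>) (at 0)" using \<gamma>(3)[of 0] \<gamma>(2) by (simp add: isCont_def)
    from conj_has_derivative[OF this \<gamma>(2) UNIV_I generates_has_derivative[OF X], of g]
    show "((\<lambda>t. lcoord (g \<otimes> \<gamma> t \<otimes> inv g)) has_derivative (\<lambda>r. r *\<^sub>R Ad G A g X)) (at 0)"
      by (simp add: linear_scale[OF linear_Ad])
  qed
  then show ?thesis by (simp add: conj_op_def)
qed

end

section \<open>Representations and Leibniz cocycles\<close>

locale lie_group_representation = lie_group G A
  for G :: "('g::{t2_space, second_countable_topology}) monoid" (structure)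
    and A :: "('g, 'e::euclidean_space) chart set" +
  fixes \<rho> :: "'g \<Rightarrow> 'a::euclidean_space \<Rightarrow> 'a"
  assumes rep: "lie_group_rep G A \<rho>"
begin

lemma rho_simps: "linear (\<rho> g)" "\<rho> \<one> v = v" "\<rho> (g \<otimes> h) v = \<rho> g (\<rho> h v)"
  using rep by (simp_all add: lie_group_rep_def)

lemma bounded_linear_rho: "bounded_linear (\<rho> g)"
  using rho_simps(1) linear_conv_bounded_linear by blast

lemma rho_isCont: "isCont (\<lambda>g. \<rho> g v) g"
proof -
  have "isCont (\<lambda>(g, v). \<rho> g v) (g, v)"
    using rep unfolding lie_group_rep_def smooth_map_def by (simp add: continuous_on_eq_continuous_at)
  moreover have "((\<lambda>g. (g, v)) \<longlongrightarrow> (g, v)) (at g)" by (intro tendsto_intros)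
  ultimately have "((\<lambda>g. case (g, v) of (g, v) \<Rightarrow> \<rho> g v) \<longlongrightarrow> (case (g, v) of (g, v) \<Rightarrow> \<rho> g v)) (at g)"
    by (rule isCont_tendsto_compose)
  then show ?thesis by (simp add: isCont_def)
qed

text \<open>Joint smoothness is given in a product chart; restricting its derivative at
  \<open>(origin, v)\<close> to directions \<open>(u, 0)\<close> yields the infinitesimal
  action.\<close>

lemma rho_has_derivative:
  "((\<lambda>x. \<rho> (lparam x) v) has_derivative (\<lambda>u. lie_alg_act G A \<rho> u v)) (at origin)"
proof -
  define T where "T = unit_nbhd \<times> (UNIV :: 'a set)"
  have inj: "inj_on (map_prod lcoord id) T"
    using chart_props(5)[OF unit_chart] by (auto simp: T_def inj_on_def)
  have "(T, map_prod lcoord id) \<in> prod_atlas A std_atlas"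
    unfolding prod_atlas_def std_atlas_def T_def using unit_chart
    by (intro image_eqI[of _ _ "((unit_nbhd, lcoord), (UNIV, id))"]) auto
  moreover have "smooth_map (prod_atlas A std_atlas) std_atlas UNIV (\<lambda>(g, v). \<rho> g v)"
    using rep by (simp add: lie_group_rep_def)
  ultimately have sm: "smooth_on (id \<circ> (\<lambda>(g, v). \<rho> g v) \<circ> inv_into T (map_prod lcoord id))
      (map_prod lcoord id ` (UNIV \<inter> T \<inter> (\<lambda>(g, v). \<rho> g v) -` UNIV))"
    unfolding smooth_map_def std_atlas_def by blast
  have mem: "(origin, v) \<in> map_prod lcoord id ` (UNIV \<inter> T \<inter> (\<lambda>(g, v). \<rho> g v) -` UNIV)"
    by (auto simp: T_def intro!: image_eqI[of _ _ "(\<one>, v)"])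
  obtain E where
    E: "((id \<circ> (\<lambda>(g, v). \<rho> g v) \<circ> inv_into T (map_prod lcoord id)) has_derivative E) (at (origin, v))"
    using smooth_on_has_derivative[OF sm mem] by (rule that)
  have "((\<lambda>x. (x, v)) has_derivative (\<lambda>u. (u, 0))) (at origin)" by (auto intro!: derivative_eq_intros)
  from has_derivative_compose[OF this E]
  have "((\<lambda>x. (\<lambda>(g, v). \<rho> g v) (inv_into T (map_prod lcoord id) (x, v))) has_derivative (\<lambda>u. E (u, 0))) (at origin)"
    by (simp only: o_def id_apply)
  then have d: "((\<lambda>x. \<rho> (lparam x) v) has_derivative (\<lambda>u. E (u, 0))) (at origin)"
  proof (rule has_derivative_transform_within_open[OF _ open_lcoord_image])
    fix x assume x: "x \<in> lcoord ` unit_nbhd"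
    have "inv_into T (map_prod lcoord id) (x, v) = (lparam x, v)"
      by (rule inv_into_f_eq[OF inj]) (use x in \<open>simp_all add: T_def\<close>)
    then show "(\<lambda>(g, v). \<rho> g v) (inv_into T (map_prod lcoord id) (x, v)) = \<rho> (lparam x) v" by simp
  qed simp
  have "lie_alg_act G A \<rho> u v = frechet_derivative (\<lambda>x. \<rho> (lparam x) v) (at origin) u" for u
    by (simp add: lie_alg_act_def tangent_map_eq lparam_def unit_nbhd_def lcoord_def)
  with d frechet_derivative_at[OF d] show ?thesis by simp
qed

lemma linear_lie_alg_act: "linear (lie_alg_act G A \<rho> u)" "linear (\<lambda>u. lie_alg_act G A \<rho> u v)"
proof -
  show "linear (lie_alg_act G A \<rho> u)"
    by (rule linear_derivative_of_linear_family[OF _ open_UNIV UNIV_I rho_has_derivative]) (rule rho_simps)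
  show "linear (\<lambda>u. lie_alg_act G A \<rho> u v)"
    by (rule has_derivative_linear[OF rho_has_derivative])
qed

section \<open>The actions on Hom(g, a)\<close>

lemma hom_act_apply: "blinfun_apply (hom_act G A \<rho> g \<alpha>) y = \<rho> g (blinfun_apply \<alpha> (Ad G A (inv g) y))"
proof -
  have "linear (\<lambda>y. \<rho> g (blinfun_apply \<alpha> (Ad G A (inv g) y)))"
    using linear_compose[OF linear_compose[OF linear_Ad bounded_linear.linear[OF blinfun.bounded_linear_right]] rho_simps(1)]
    by (simp add: o_def)
  then show ?thesis by (simp add: hom_act_def blinfun_apply_Blinfun)
qed

lemma bounded_linear_hom_act: "bounded_linear (hom_act G A \<rho> g)"
proof -
  have "hom_act G A \<rho> g = (\<lambda>\<alpha>. Blinfun (\<rho> g) o\<^sub>L (\<alpha> o\<^sub>L Blinfun (Ad G A (inv g))))"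
    by (intro ext blinfun_eqI) (simp add: hom_act_apply blinfun_apply_Blinfun linear_Ad rho_simps)
  then show ?thesis
    by (simp add: bounded_linear_compose[OF
          bounded_bilinear.bounded_linear_right[OF bounded_bilinear_blinfun_compose]
          bounded_bilinear.bounded_linear_left[OF bounded_bilinear_blinfun_compose]])
qed

definition hom_alg_act :: "('e \<Rightarrow>\<^sub>L 'a) \<Rightarrow> 'e \<Rightarrow> ('e \<Rightarrow>\<^sub>L 'a)" where
  "hom_alg_act \<alpha> u = Blinfun (\<lambda>z. lie_alg_act G A \<rho> u (blinfun_apply \<alpha> z) - blinfun_apply \<alpha> (lie_bracket G A u z))"

lemma hom_alg_act_apply:
  "blinfun_apply (hom_alg_act \<alpha> u) z
    = lie_alg_act G A \<rho> u (blinfun_apply \<alpha> z) - blinfun_apply \<alpha> (lie_bracket G A u z)"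
proof -
  have l: "linear (blinfun_apply \<alpha>)" by (rule bounded_linear.linear[OF blinfun.bounded_linear_right])
  have "linear (\<lambda>z. lie_alg_act G A \<rho> u (blinfun_apply \<alpha> z) - blinfun_apply \<alpha> (lie_bracket G A u z))"
    using linear_compose_sub[OF linear_compose[OF l linear_lie_alg_act(1)] linear_compose[OF linear_lie_bracket(1) l]]
    by (simp add: o_def)
  then show ?thesis by (simp add: hom_alg_act_def blinfun_apply_Blinfun)
qed

text \<open>At fixed \<open>z\<close> this is a product rule. \<open>Ad\<close> is evaluated at the
  inverse, whose derivative \<open>- u\<close> produces the negative bracket term.\<close>

lemma hom_act_has_derivative:
  "((\<lambda>x. hom_act G A \<rho> (lparam x) \<alpha>) has_derivative hom_alg_act \<alpha>) (at origin)"
proof (rule has_derivative_blinfun_componentwise)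
  fix z
  have l: "linear (blinfun_apply \<alpha>)" by (rule bounded_linear.linear[OF blinfun.bounded_linear_right])
  have "((\<lambda>x. Ad G A (lparam (linverse x)) z) has_derivative (\<lambda>u. lie_bracket G A (- u) z)) (at origin)"
    by (rule has_derivative_compose[OF linverse_has_derivative, of "\<lambda>x. Ad G A (lparam x) z"])
       (simp add: Ad_lparam_lie_bracket)
  then have "((\<lambda>x. Ad G A (inv (lparam x)) z) has_derivative (\<lambda>u. lie_bracket G A (- u) z)) (at origin)"
    by (rule has_derivative_transform_within_open[OF _ open_linverse_dom]) simp_all
  from bounded_linear.has_derivative[OF blinfun.bounded_linear_right this, of \<alpha>]
  have "((\<lambda>x. blinfun_apply \<alpha> (Ad G A (inv (lparam x)) z)) has_derivative
      (\<lambda>u. - blinfun_apply \<alpha> (lie_bracket G A u z))) (at origin)"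
    by (simp add: linear_neg[OF linear_lie_bracket(2)] linear_neg[OF l])
  from has_derivative_linear_family[where \<theta> = "\<lambda>x. \<rho> (lparam x)" and \<Theta> = "\<lambda>u. lie_alg_act G A \<rho> u",
      OF rho_simps(1) open_UNIV UNIV_I rho_has_derivative this]
  have "((\<lambda>x. \<rho> (lparam x) (blinfun_apply \<alpha> (Ad G A (inv (lparam x)) z))) has_derivative
     (\<lambda>u. lie_alg_act G A \<rho> u (blinfun_apply \<alpha> z) - blinfun_apply \<alpha> (lie_bracket G A u z))) (at origin)"
    by (simp add: rho_simps Ad_one)
  then show "((\<lambda>x. blinfun_apply (hom_act G A \<rho> (lparam x) \<alpha>) z) has_derivative
      (\<lambda>u. blinfun_apply (hom_alg_act \<alpha> u) z)) (at origin)"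
    by (simp add: hom_act_apply hom_alg_act_apply)
qed

lemma tau2_apply: "bilinear \<omega> \<Longrightarrow> blinfun_apply (blinfun_apply (tau2 \<omega>) x) y = \<omega> x y"
proof -
  assume b: "bilinear \<omega>"
  have l: "linear (\<omega> x)" for x using b by (simp add: bilinear_def)
  have l': "linear (\<lambda>x. \<omega> x y)" for y using b by (simp add: bilinear_def)
  have "linear (\<lambda>x. Blinfun (\<omega> x))"
    by (rule linearI; rule blinfun_eqI)
       (simp_all add: blinfun_apply_Blinfun[OF l] blinfun.add_left blinfun.scaleR_left linear_add[OF l'] linear_scale[OF l'])
  then show ?thesis by (simp add: tau2_def blinfun_apply_Blinfun[OF l] blinfun_apply_Blinfun)
qed

text \<open>Evaluated at a third vector, the one-cocycle identity for \<open>tau2 \<omega>\<close>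
  is a rearrangement of the identity defining \<open>ZL2\<close>. The paths \<open>c g\<close>,
  \<open>c h\<close> and \<open>c (g \<otimes> h)\<close> may be unrelated; only their end points
  matter.\<close>

lemma I1_mult:
  assumes sc: "simply_connected (UNIV :: 'g set)" and c: "path_family G A c" and \<omega>: "\<omega> \<in> ZL2 G A \<rho>"
  shows "I1 G A \<rho> c \<omega> (g \<otimes> h) = I1 G A \<rho> c \<omega> g + hom_act G A \<rho> g (I1 G A \<rho> c \<omega> h)"
proof -
  have b: "bilinear \<omega>"
    and z: "\<And>x y z. lie_alg_act G A \<rho> x (\<omega> y z) - lie_alg_act G A \<rho> y (\<omega> x z)
        - \<omega> (lie_bracket G A x y) z - \<omega> y (lie_bracket G A x z) + \<omega> x (lie_bracket G A y z) = 0"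
    using \<omega> by (auto simp: ZL2_def)
  interpret lie_group_one_cocycle G A "hom_act G A \<rho>" hom_alg_act "blinfun_apply (tau2 \<omega>)"
  proof (intro lie_group_one_cocycle.intro lie_group_one_cocycle_axioms.intro lie_group_axioms)
    show "hom_act G A \<rho> (g \<otimes> h) \<beta> = hom_act G A \<rho> g (hom_act G A \<rho> h \<beta>)" for g h \<beta>
      by (rule blinfun_eqI) (simp add: hom_act_apply rho_simps inv_mult_group Ad_mult)
    show "hom_act G A \<rho> \<one> \<beta> = \<beta>" for \<beta>
      by (rule blinfun_eqI) (simp add: hom_act_apply rho_simps Ad_one)
    show "hom_alg_act (blinfun_apply (tau2 \<omega>) v) u - hom_alg_act (blinfun_apply (tau2 \<omega>) u) v
        = blinfun_apply (tau2 \<omega>) (lie_bracket G A u v)" for u v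
    proof (rule blinfun_eqI)
      fix w
      show "blinfun_apply (hom_alg_act (blinfun_apply (tau2 \<omega>) v) u - hom_alg_act (blinfun_apply (tau2 \<omega>) u) v) w
        = blinfun_apply (blinfun_apply (tau2 \<omega>) (lie_bracket G A u v)) w"
        using z[of u v w] by (simp add: blinfun.diff_left hom_alg_act_apply tau2_apply[OF b] algebra_simps)
    qed
  qed (rule bounded_linear_hom_act hom_act_has_derivative bounded_linear.linear[OF blinfun.bounded_linear_right])+
  have sp: "smooth_path A (c g)" "c g 0 = \<one>" "c g 1 = g" for g
    using c by (auto simp: path_family_def)
  have "I1 G A \<rho> c \<omega> g = integral {0..1} (\<lambda>t. hom_act G A \<rho> (c g t) (blinfun_apply (tau2 \<omega>) (left_velocity (c g) t)))" for g
    by (simp add: I1_def path_integral_eq_form)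
  then show ?thesis
    using cocycle_integral_mult[OF sc smooth_path_left_deriv[OF sp(1)] sp(2,3)
        smooth_path_left_deriv[OF sp(1)] sp(2,3) smooth_path_left_deriv[OF sp(1)] sp(2,3)]
    by simp
qed

text \<open>The left velocity of a one-parameter subgroup is constantly \<open>X\<close>, so only
  the group action varies along the path.\<close>

lemma path_integral_generates:
  assumes X: "generates X \<gamma>"
  shows "path_integral A (eq_form G A \<rho> \<alpha>) (\<lambda>s. lie_exp G A (s *\<^sub>R X))
      = integral {0..1} (\<lambda>s. \<rho> (\<gamma> s) (blinfun_apply \<alpha> X))"
    and "(\<lambda>s. \<rho> (\<gamma> s) v) integrable_on {0..1}"
proof -
  have ops: "one_parameter_subgroup G A \<gamma>" using X by (simp add: generates_def)
  have lv: "left_velocity \<gamma> t = X" if "t \<in> {0..1}" for t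
    by (rule left_velocity_unique[OF one_parameter_subgroup_props(4)[OF ops] that generates_left_deriv[OF X]])
  show "path_integral A (eq_form G A \<rho> \<alpha>) (\<lambda>s. lie_exp G A (s *\<^sub>R X))
      = integral {0..1} (\<lambda>s. \<rho> (\<gamma> s) (blinfun_apply \<alpha> X))"
    unfolding lie_exp_scale[OF X] path_integral_eq_form
    by (rule integral_cong) (simp add: lv)
  have "isCont (\<lambda>s. \<rho> (\<gamma> s) v) s" for s
    by (rule isCont_o2[OF one_parameter_subgroup_props(3)[OF ops] rho_isCont])
  then show "(\<lambda>s. \<rho> (\<gamma> s) v) integrable_on {0..1}"
    by (intro integrable_continuous_real continuous_at_imp_continuous_on) auto
qed

end

theorem proposition3p19:
  fixes G :: "('g::{t2_space, second_countable_topology}) monoid"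
    and A :: "('g, 'e::euclidean_space) chart set"
    and \<rho> :: "'g \<Rightarrow> 'a::euclidean_space \<Rightarrow> 'a"
    and c :: "'g \<Rightarrow> real \<Rightarrow> 'g"
    and D :: "'e set" and U :: "'g set"
    and \<omega> :: "'e \<Rightarrow> 'e \<Rightarrow> 'a"
  assumes "lie_group G A" and "simply_connected (UNIV :: 'g set)"
    and "log_domain G A D"
    and "\<one>\<^bsub>G\<^esub> \<in> interior U" and "U \<subseteq> lie_exp G A ` D"
    and "lie_group_rep G A \<rho>"
    and "path_family G A c"
    and "\<omega> \<in> ZL2 G A \<rho>"
  shows "(\<forall>(g, h, k) \<in> U3_loc G U.
            \<rho> g (I2 G A \<rho> c D \<omega> h k) - I2 G A \<rho> c D \<omega> (g \<otimes>\<^bsub>G\<^esub> h) k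
              + I2 G A \<rho> c D \<omega> g (conj_op G h k) = 0)
       \<and> (\<forall>(g, h, k) \<in> U3_loc G U.
            \<rho> g (I2 G A \<rho> c D \<omega> h k) - I2 G A \<rho> c D \<omega> (conj_op G g h) (conj_op G g k)
              - \<rho> (conj_op G g h) (I2 G A \<rho> c D \<omega> g k)
              + I2 G A \<rho> c D \<omega> g (conj_op G h k) = 0)"
proof -
  interpret lie_group_representation G A \<rho>
    using assms(1,6) by (simp add: lie_group_representation_def lie_group_representation_axioms_def)
  let ?I1 = "I1 G A \<rho> c \<omega>" and ?I2 = "I2 G A \<rho> c D \<omega>"
  have conj_mult: "conj_op G (g \<otimes>\<^bsub>G\<^esub> h) k = conj_op G g (conj_op G h k)" for g h k
    by (simp add: conj_op_def inv_mult_group m_assoc)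
  have identity: "\<rho> g (?I2 h k) - ?I2 (g \<otimes>\<^bsub>G\<^esub> h) k + ?I2 g (conj_op G h k) = 0"
    if hk: "conj_op G h k \<in> U" for g h k
  proof -
    define X where "X = lie_log G A D (conj_op G h k)"
    define Y where "Y = lie_log G A D (conj_op G g (conj_op G h k))"
    have inj: "inj_on (lie_exp G A) D" using assms(3) by (simp add: log_domain_def)
    have X: "X \<in> D" "lie_exp G A X = conj_op G h k"
      using hk assms(5) by (auto simp: X_def lie_log_def inv_into_into f_inv_into_f)
    \<comment> \<open>\<open>Ad\<close>-invariance keeps this element on the chosen branch: it
      provides \<open>\<delta>\<close>, and injectivity of \<open>exp\<close> on \<open>D\<close>
      will identify it with \<open>Y\<close>.\<close>
    have AdX: "Ad G A g X \<in> D" using assms(3) X(1) by (simp add: log_domain_def)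
    obtain \<gamma> \<delta> where \<gamma>: "generates X \<gamma>" and \<delta>: "generates (Ad G A g X) \<delta>"
      using generates_exists[OF assms(3)] X(1) AdX by blast
    note conj = generates_conj[OF \<gamma> \<delta>]
    have "lie_exp G A (Ad G A g X) = conj_op G g (conj_op G h k)"
      using X(2) lie_exp_generates[OF \<gamma>] lie_exp_generates[OF \<delta>] conj by simp
    then have Y: "Y = Ad G A g X"
      unfolding Y_def lie_log_def by (rule inv_into_f_eq[OF inj AdX])
    \<comment> \<open>Both integrals run along \<open>\<delta>\<close>, since
      \<open>(g \<otimes> h) \<rhd> k = g \<rhd> (h \<rhd> k)\<close>; only the operators applied to
      \<open>Y\<close> differ.\<close>
    have "?I2 (g \<otimes>\<^bsub>G\<^esub> h) k - ?I2 g (conj_op G h k)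
        = integral {0..1} (\<lambda>s. \<rho> (\<delta> s) (blinfun_apply (?I1 (g \<otimes>\<^bsub>G\<^esub> h)) Y))
          - integral {0..1} (\<lambda>s. \<rho> (\<delta> s) (blinfun_apply (?I1 g) Y))"
      unfolding I2_def conj_mult Y_def[symmetric] unfolding Y path_integral_generates(1)[OF \<delta>] ..
    also have "\<dots> = integral {0..1} (\<lambda>s. \<rho> (\<delta> s) (blinfun_apply (?I1 (g \<otimes>\<^bsub>G\<^esub> h)) Y) - \<rho> (\<delta> s) (blinfun_apply (?I1 g) Y))"
      by (rule integral_diff[symmetric]; rule path_integral_generates(2)[OF \<delta>])
    also have "\<dots> = integral {0..1} (\<lambda>s. \<rho> g (\<rho> (\<gamma> s) (blinfun_apply (?I1 h) X)))"
    proof (rule integral_cong)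
      fix s
      have "\<rho> (\<delta> s) (blinfun_apply (?I1 (g \<otimes>\<^bsub>G\<^esub> h)) Y) - \<rho> (\<delta> s) (blinfun_apply (?I1 g) Y)
          = \<rho> (\<delta> s) (blinfun_apply (hom_act G A \<rho> g (?I1 h)) Y)"
        by (simp add: I1_mult[OF assms(2,7,8)] blinfun.add_left linear_add[OF rho_simps(1)])
      \<comment> \<open>In \<open>(g.I1 h) (Ad g X)\<close> the two adjoint actions cancel, leaving
        \<open>\<rho> g (I1 h X)\<close>. The factor \<open>g\<close> then cancels the
        \<open>inv g\<close> of the conjugate \<open>\<delta> s\<close>.\<close>
      also have "\<dots> = \<rho> (conj_op G g (\<gamma> s) \<otimes>\<^bsub>G\<^esub> g) (blinfun_apply (?I1 h) X)"
        by (simp add: Y hom_act_apply conj rho_simps(3))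
      also have "conj_op G g (\<gamma> s) \<otimes>\<^bsub>G\<^esub> g = g \<otimes>\<^bsub>G\<^esub> \<gamma> s" by (simp add: conj_op_def m_assoc)
      finally show "\<rho> (\<delta> s) (blinfun_apply (?I1 (g \<otimes>\<^bsub>G\<^esub> h)) Y) - \<rho> (\<delta> s) (blinfun_apply (?I1 g) Y)
          = \<rho> g (\<rho> (\<gamma> s) (blinfun_apply (?I1 h) X))" by (simp add: rho_simps(3))
    qed
    also have "\<dots> = \<rho> g (integral {0..1} (\<lambda>s. \<rho> (\<gamma> s) (blinfun_apply (?I1 h) X)))"
      using integral_linear[OF path_integral_generates(2)[OF \<gamma>] bounded_linear_rho[of g]]
      by (simp add: o_def)
    also have "\<dots> = \<rho> g (?I2 h k)"
      unfolding I2_def X_def[symmetric] path_integral_generates(1)[OF \<gamma>] ..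
    finally show ?thesis by (simp add: algebra_simps)
  qed
  have rack: "\<rho> g (?I2 h k) - ?I2 (conj_op G g h) (conj_op G g k) - \<rho> (conj_op G g h) (?I2 g k)
      + ?I2 g (conj_op G h k) = 0"
    if "conj_op G h k \<in> U" "conj_op G g k \<in> U" for g h k
  proof -
    have gh: "conj_op G g h \<otimes>\<^bsub>G\<^esub> g = g \<otimes>\<^bsub>G\<^esub> h" by (simp add: conj_op_def m_assoc)
    then have "conj_op G (conj_op G g h) (conj_op G g k) = conj_op G g (conj_op G h k)"
      by (simp add: conj_mult[symmetric])
    then have "\<rho> (conj_op G g h) (?I2 g k) - ?I2 (g \<otimes>\<^bsub>G\<^esub> h) k + ?I2 (conj_op G g h) (conj_op G g k) = 0"
      \<comment> \<open>Here \<open>g\<close> takes the place of \<open>h\<close>, so the membership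
        required is \<open>g \<rhd> k \<in> U\<close>.\<close>
      using identity[of g k "conj_op G g h"] that gh by simp
    with identity[of h k g] that show ?thesis by (simp add: algebra_simps)
  qed
  show ?thesis using identity rack by (auto simp: U3_loc_def)
qed

end
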